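(* Let $F=F(x_1,\dots,x_r)\in\mathbb{C}[x_1,\ldots,x_r]$ be a smooth form of degree $d\ge 3$ with $r\ge 3$, and let $G$ be a subgroup of $\mathrm{Aut}(F)$ with decomposition data $V_i,W_{ij},k_i,r_{ij},H_{ij},\bar H_{ij},m$ (as in the context), the underlying basis of $\mathbb{C}^r$ being compatible with $\mathbb{C}^r=\bigoplus_{i,j}W_{ij}$. Let $1\le i_1\le m$, $1\le j_1\le k_{i_1}$, $0<d_1<d$. Suppose there is a monomial $\mathfrak{m}\in S^{d_1}(W_{i_1j_1}^* )\otimes S^{d-d_1}\big(\bigoplus_{(i_2,j_2)\ne(i_1,j_1)}W_{i_2j_2}^*\big)$ in $F$. Then $\bar H_{i_1j_1}$ contains a normal subgroup $\bar{\bar H}_{i_1j_1}$ that preserves a non-zero form of degree $d_1$ (on $W_{i_1j_1}$) and satisfies $$|G|\le\frac{B(G,F)}{[H_{i_1j_1}:\bar{\bar H}_{i_1j_1}]}\le\frac{R(l(G),d)\cdot|\bar{\bar H}_{i_1j_1}|\cdot d^r\cdot r!}{\mathrm{JC}(r_{i_1j_1})}.$$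
   Context: A form $F\in\mathbb{C}[x_1,\dots,x_r]$ is smooth if the origin is the only common zero of its first partial derivatives. $\mathrm{Aut}(F)=\{A\in\mathrm{GL}(r,\mathbb{C})\mid A(F)=F\}$ where $A(F)=F(\sum_i a_{1i}x_i,\ldots,\sum_i a_{ri}x_i)$; it is finite. Analogously $\mathrm{Aut}(f)\subset\mathrm{GL}(W)$ for a form $f\in S^k(W^* )$. A subgroup of $\mathrm{PGL}(W)$ preserves $f$ if it is the image of some subgroup of $\mathrm{Aut}(f)$. A monomial is "in $F$" if its coefficient in $F$ is non-zero. A finite group acting irreducibly on a complex vector space $W$ acts primitively if $W$ cannot be decomposed as a direct sum of proper subspaces permuted by the group. A finite subgroup of $\mathrm{PGL}(k,\mathbb{C})$ is primitive if it is the image of a finite primitive subgroup of $\mathrm{GL}(k,\mathbb{C})$. $\mathrm{JC}(k)$ is the maximum order of a finite primitive subgroup of $\mathrm{PGL}(k,\mathbb{C})$. (By Collins: $\mathrm{JC}(k)=(k+1)!$ for $k=10,11$ and $k\ge 13$, and $\mathrm{JC}(k)=1,60,360,25920,25920,6531840,1451520,348364800,4199040,448345497600$ for $k=1,2,3,4,5,6,7,8,9,12$.) Decomposition data of a finite subgroup $G\subset\mathrm{GL}(r,\mathbb{C})$ (one choice fixed): $\mathbb{C}^r=V_1\oplus\cdots\oplus V_m$ with $V_i$ irreducible $G$-stable; $V_i=W_{i1}\oplus\cdots\oplus W_{ik_i}$ with subspaces permuted transitively by $G$ and $\mathrm{Stab}_G(W_{ij})=\{g\in G\mid g(W_{ij})=W_{ij}\}$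 acting primitively on $W_{ij}$; $r_{ij}=\dim W_{ij}$; $s=\sum_i k_i$; $H_{ij}\subset\mathrm{PGL}(W_{ij})$ is the image of $\mathrm{Stab}_G(W_{ij})$; $P=\bigcap_{i,j}\mathrm{Stab}_G(W_{ij})$; $\bar H_{ij}\subset H_{ij}$ is the image of $P$ in $\mathrm{PGL}(W_{ij})$. The subdegree sequence $l(G)$ is the tuple of all $r_{ij}$ arranged in non-increasing order. The basis is compatible with the decomposition if it is a union of bases of the $W_{ij}$ (in order), so each coordinate $x_k$ lies in one $W_{ij}^*$ (the dual basis is used on the dual space). Canonical bound: $B(G,F)=d^s\cdot\prod_{i,j}|H_{ij}|\cdot\prod_{i=1}^m k_i!$. Fermat-test ratio: for a non-increasing tuple $l=(r_1',\ldots,r_s')$ of positive integers with sum $r$ whose distinct values occur with multiplicities $a_1,\dots,a_t$, $R(l,d)=\dfrac{d^s\prod_{i=1}^s\mathrm{JC}(r_i')\prod_{j=1}^t a_j!}{d^r\cdot r!}$. *)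

theory Defs
  imports
    "HOL-Analysis.Analysis"
    "HOL-Algebra.Bij"
    "HOL-Algebra.Coset"
    "HOL-Library.Poly_Mapping"
    "HOL-Library.Function_Algebras"
begin

section \<open>General and projective linear groups of a subspace\<close>

locale complex_space = vector_space scale
  for scale :: "complex \<Rightarrow> 'b::ab_group_add \<Rightarrow> 'b"
begin

text \<open>Elements of \<open>GL W\<close> are functions that are \<open>undefined\<close> outside \<open>W\<close>, so that equality of
  functions is equality of linear automorphisms of \<open>W\<close>.\<close>

definition GL :: "'b set \<Rightarrow> ('b \<Rightarrow> 'b) monoid" where
  "GL W = (BijGroup W)\<lparr>carrier := {g \<in> Bij W.
      (\<forall>x\<in>W. \<forall>y\<in>W. g (x + y) = g x + g y) \<and>
      (\<forall>c. \<forall>x\<in>W. g (scale c x) = scale c (g x))}\<rparr>"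

definition homotheties :: "'b set \<Rightarrow> ('b \<Rightarrow> 'b) set" where
  "homotheties W = {restrict (scale c) W | c. c \<noteq> 0}"

definition PGL :: "'b set \<Rightarrow> ('b \<Rightarrow> 'b) set monoid" where
  "PGL W = GL W Mod homotheties W"

definition PGL_image :: "'b set \<Rightarrow> ('b \<Rightarrow> 'b) set \<Rightarrow> ('b \<Rightarrow> 'b) set set" where
  "PGL_image W K = (\<lambda>g. homotheties W #>\<^bsub>GL W\<^esub> g) ` K"

text \<open>\<open>W\<close> is the internal direct sum of the family \<open>U\<close>: the summation map from the product is
  a bijection onto \<open>W\<close>.\<close>

definition direct_sum :: "'i set \<Rightarrow> ('i \<Rightarrow> 'b set) \<Rightarrow> 'b set \<Rightarrow> bool" where
  "direct_sum I U W \<longleftrightarrow> finite I \<and> (\<forall>i\<in>I. subspace (U i)) \<and>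
     bij_betw (\<lambda>u. \<Sum>i\<in>I. u i) (PiE I U) W"

definition irreducible_action :: "'b set \<Rightarrow> ('b \<Rightarrow> 'b) set \<Rightarrow> bool" where
  "irreducible_action W K \<longleftrightarrow> subspace W \<and> W \<noteq> {0} \<and> (\<forall>g\<in>K. g ` W \<subseteq> W) \<and>
     (\<forall>U. subspace U \<and> U \<subseteq> W \<and> (\<forall>g\<in>K. g ` U \<subseteq> U) \<longrightarrow> U = {0} \<or> U = W)"

definition primitive_GL :: "'b set \<Rightarrow> ('b \<Rightarrow> 'b) set \<Rightarrow> bool" where
  "primitive_GL W K \<longleftrightarrow> subgroup K (GL W) \<and> finite K \<and> irreducible_action W K \<and>
     \<not> (\<exists>\<U>. direct_sum \<U> (\<lambda>U. U) W \<and> (\<forall>U\<in>\<U>. U \<subset> W) \<and> (\<forall>g\<in>K. \<forall>U\<in>\<U>. g ` U \<in> \<U>))"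

definition primitive_PGL :: "'b set \<Rightarrow> ('b \<Rightarrow> 'b) set set \<Rightarrow> bool" where
  "primitive_PGL W H \<longleftrightarrow> (\<exists>K. primitive_GL W K \<and> H = PGL_image W K)"

end

interpretation cvec: complex_space "(*s) :: complex \<Rightarrow> complex ^ 'n \<Rightarrow> complex ^ 'n" ..

section \<open>The constants JC(k)\<close>

text \<open>Since \<open>k\<close> is a number here, the space of column vectors of length \<open>k\<close> is modelled by the
  sequences supported on \<open>{..<k}\<close>. That the set in \<open>JC\<close> is finite, so that \<open>Max\<close> is the
  genuine maximum, is Jordan's theorem for primitive linear groups.\<close>

definition seq_scale :: "complex \<Rightarrow> (nat \<Rightarrow> complex) \<Rightarrow> nat \<Rightarrow> complex" where
  "seq_scale c v = (\<lambda>i. c * v i)"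

interpretation seq: complex_space seq_scale
  by unfold_locales (auto simp: seq_scale_def fun_eq_iff algebra_simps)

definition coord_space :: "nat \<Rightarrow> (nat \<Rightarrow> complex) set" where
  "coord_space k = {v. \<forall>i\<ge>k. v i = 0}"

definition JC :: "nat \<Rightarrow> nat" where
  "JC k = Max {card H | H. seq.primitive_PGL (coord_space k) H}"

section \<open>Forms and their automorphisms\<close>

type_synonym 'n mpoly = "('n \<Rightarrow>\<^sub>0 nat) \<Rightarrow>\<^sub>0 complex"

definition homogeneous :: "nat \<Rightarrow> ('n::finite) mpoly \<Rightarrow> bool" where
  "homogeneous d F \<longleftrightarrow>
     (\<forall>\<mm>\<in>Poly_Mapping.keys F. (\<Sum>k\<in>UNIV. Poly_Mapping.lookup \<mm> k) = d)"

definition mpoly_eval :: "('n::finite) mpoly \<Rightarrow> complex ^ 'n \<Rightarrow> complex" where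
  "mpoly_eval F v = (\<Sum>\<mm>\<in>Poly_Mapping.keys F.
     Poly_Mapping.lookup F \<mm> * (\<Prod>k\<in>UNIV. (v $ k) ^ Poly_Mapping.lookup \<mm> k))"

definition mpoly_pderiv :: "'n \<Rightarrow> ('n::finite) mpoly \<Rightarrow> 'n mpoly" where
  "mpoly_pderiv k F = (\<Sum>\<mm>\<in>Poly_Mapping.keys F.
     Poly_Mapping.single (\<mm> - Poly_Mapping.single k 1)
       (of_nat (Poly_Mapping.lookup \<mm> k) * Poly_Mapping.lookup F \<mm>))"

definition smooth_form :: "('n::finite) mpoly \<Rightarrow> bool" where
  "smooth_form F \<longleftrightarrow> {v. \<forall>k. mpoly_eval (mpoly_pderiv k F) v = 0} = {0}"

text \<open>\<open>lin_subst A F\<close> replaces each variable with index \<open>i\<close> by the linear form whose coefficients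
  are the \<open>i\<close>-th row of \<open>A\<close>.\<close>

definition lin_subst :: "complex ^ 'n ^ 'n \<Rightarrow> ('n::finite) mpoly \<Rightarrow> 'n mpoly" where
  "lin_subst A F = (\<Sum>\<mm>\<in>Poly_Mapping.keys F.
     Poly_Mapping.single 0 (Poly_Mapping.lookup F \<mm>) *
     (\<Prod>i\<in>UNIV. (\<Sum>j\<in>UNIV. Poly_Mapping.single (Poly_Mapping.single j 1) (A $ i $ j))
        ^ Poly_Mapping.lookup \<mm> i))"

definition GL_mat :: "(complex ^ 'n ^ 'n) monoid" where
  "GL_mat = \<lparr>carrier = {A. invertible A}, monoid.mult = (**), one = mat 1\<rparr>"

definition Aut :: "('n::finite) mpoly \<Rightarrow> (complex ^ 'n ^ 'n) set" where
  "Aut F = {A. invertible A \<and> lin_subst A F = F}"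

text \<open>The remaining definitions of this section are meant for subspaces \<open>W\<close> spanned by standard
  basis vectors. The dual basis of \<open>W\<close> then consists of the coordinates in \<open>coords W\<close>, and forms
  on \<open>W\<close> are polynomials in these coordinates.\<close>

definition coords :: "(complex ^ 'n) set \<Rightarrow> 'n set" where
  "coords W = {k. axis k 1 \<in> W}"

definition form_on :: "(complex ^ 'n) set \<Rightarrow> nat \<Rightarrow> ('n::finite) mpoly \<Rightarrow> bool" where
  "form_on W d f \<longleftrightarrow> homogeneous d f \<and>
     (\<forall>\<mm>\<in>Poly_Mapping.keys f. Poly_Mapping.keys \<mm> \<subseteq> coords W)"

text \<open>Matrix of \<open>g \<in> GL W\<close> in the basis of \<open>W\<close>, padded with zeros.\<close>

definition matrix_on :: "(complex ^ 'n) set \<Rightarrow> (complex ^ 'n \<Rightarrow> complex ^ 'n) \<Rightarrow> complex ^ 'n ^ 'n"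
  where "matrix_on W g = (\<chi> i j. if j \<in> coords W then g (axis j 1) $ i else 0)"

definition Aut_on ::
  "(complex ^ 'n) set \<Rightarrow> ('n::finite) mpoly \<Rightarrow> (complex ^ 'n \<Rightarrow> complex ^ 'n) set" where
  "Aut_on W f = {g \<in> carrier (cvec.GL W). lin_subst (matrix_on W g) f = f}"

definition preserves ::
  "(complex ^ 'n) set \<Rightarrow> (complex ^ 'n \<Rightarrow> complex ^ 'n) set set \<Rightarrow> ('n::finite) mpoly \<Rightarrow> bool" where
  "preserves W N f \<longleftrightarrow> (\<exists>K. subgroup K (cvec.GL W) \<and> K \<subseteq> Aut_on W f \<and> N = cvec.PGL_image W K)"

section \<open>Decomposition data\<close>

definition Stab :: "(complex ^ 'n ^ 'n) set \<Rightarrow> (complex ^ 'n) set \<Rightarrow> (complex ^ 'n ^ 'n) set" where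
  "Stab G W = {A \<in> G. (*v) A ` W = W}"

definition restrict_to ::
  "(complex ^ 'n) set \<Rightarrow> (complex ^ 'n ^ 'n) set \<Rightarrow> (complex ^ 'n \<Rightarrow> complex ^ 'n) set" where
  "restrict_to W K = (\<lambda>A. restrict ((*v) A) W) ` K"

definition decomposition_data ::
  "(complex ^ 'n ^ 'n) set \<Rightarrow> nat \<Rightarrow> (nat \<Rightarrow> nat) \<Rightarrow> (nat \<Rightarrow> (complex ^ 'n) set) \<Rightarrow>
   (nat \<Rightarrow> nat \<Rightarrow> (complex ^ 'n) set) \<Rightarrow> bool" where
  "decomposition_data G m k V W \<longleftrightarrow>
     subgroup G GL_mat \<and> finite G \<and>
     cvec.direct_sum {1..m} V UNIV \<and>
     (\<forall>i\<in>{1..m}.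
        cvec.irreducible_action (V i) ((*v) ` G) \<and>
        cvec.direct_sum {1..k i} (W i) (V i) \<and>
        (\<forall>A\<in>G. \<forall>j\<in>{1..k i}. \<exists>j'\<in>{1..k i}. (*v) A ` W i j = W i j') \<and>
        (\<forall>j\<in>{1..k i}. \<forall>j'\<in>{1..k i}. \<exists>A\<in>G. (*v) A ` W i j = W i j') \<and>
        (\<forall>j\<in>{1..k i}. cvec.primitive_GL (W i j) (restrict_to (W i j) (Stab G (W i j)))))"

definition H_group ::
  "(complex ^ 'n ^ 'n) set \<Rightarrow> (complex ^ 'n) set \<Rightarrow> (complex ^ 'n \<Rightarrow> complex ^ 'n) set set" where
  "H_group G U = cvec.PGL_image U (restrict_to U (Stab G U))"

definition P_group ::
  "(complex ^ 'n ^ 'n) set \<Rightarrow> nat \<Rightarrow> (nat \<Rightarrow> nat) \<Rightarrow> (nat \<Rightarrow> nat \<Rightarrow> (complex ^ 'n) set) \<Rightarrow>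
   (complex ^ 'n ^ 'n) set" where
  "P_group G m k W = (\<Inter>i\<in>{1..m}. \<Inter>j\<in>{1..k i}. Stab G (W i j))"

definition Hbar_group ::
  "(complex ^ 'n ^ 'n) set \<Rightarrow> nat \<Rightarrow> (nat \<Rightarrow> nat) \<Rightarrow> (nat \<Rightarrow> nat \<Rightarrow> (complex ^ 'n) set) \<Rightarrow>
   (complex ^ 'n) set \<Rightarrow> (complex ^ 'n \<Rightarrow> complex ^ 'n) set set" where
  "Hbar_group G m k W U = cvec.PGL_image U (restrict_to U (P_group G m k W))"

definition compatible_basis ::
  "nat \<Rightarrow> (nat \<Rightarrow> nat) \<Rightarrow> (nat \<Rightarrow> nat \<Rightarrow> (complex ^ 'n) set) \<Rightarrow> bool" where
  "compatible_basis m k W \<longleftrightarrow> (\<exists>B.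
     (\<forall>i\<in>{1..m}. \<forall>j\<in>{1..k i}. vec.independent (B i j) \<and> vec.span (B i j) = W i j) \<and>
     (\<Union>i\<in>{1..m}. \<Union>j\<in>{1..k i}. B i j) = cart_basis)"

definition subdegree_sequence ::
  "nat \<Rightarrow> (nat \<Rightarrow> nat) \<Rightarrow> (nat \<Rightarrow> nat \<Rightarrow> (complex ^ 'n) set) \<Rightarrow> nat list" where
  "subdegree_sequence m k W =
     rev (sort (concat (map (\<lambda>i. map (\<lambda>j. vec.dim (W i j)) [1..<Suc (k i)]) [1..<Suc m])))"

definition canonical_bound ::
  "nat \<Rightarrow> (complex ^ 'n ^ 'n) set \<Rightarrow> nat \<Rightarrow> (nat \<Rightarrow> nat) \<Rightarrow> (nat \<Rightarrow> nat \<Rightarrow> (complex ^ 'n) set) \<Rightarrow> nat"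
  where
  "canonical_bound d G m k W =
     d ^ (\<Sum>i=1..m. k i) * (\<Prod>i=1..m. \<Prod>j=1..k i. card (H_group G (W i j))) * (\<Prod>i=1..m. fact (k i))"

text \<open>The number \<open>r\<close> in the Fermat-test ratio is the sum of the tuple.\<close>

definition fermat_ratio :: "nat list \<Rightarrow> nat \<Rightarrow> real" where
  "fermat_ratio l d =
     real (d ^ length l * prod_list (map JC l) * (\<Prod>v\<in>set l. fact (count_list l v))) /
     real (d ^ sum_list l * fact (sum_list l))"

end

theory Submission
  imports Defs "HOL-Algebra.Multiplicative_Group" "HOL-Combinatorics.Permutations"
begin

text \<open>The group acts on the summands \<open>W i j\<close> by permutations, with kernel \<open>P\<close>. Inside \<open>P\<close> let
  \<open>T\<close> consist of the elements acting as scalars on every summand other than \<open>W i1 j1\<close>, and \<open>Q\<close> of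
  those acting as scalars on every summand. The subgroup sought is the image of \<open>T\<close> in
  \<open>PGL (W i1 j1)\<close>: in \<open>F\<close>, the coefficient of the part of \<open>\<mm>\<close> outside \<open>W i1 j1\<close> is a form of
  degree \<open>d1\<close> which \<open>T\<close> fixes up to a character, and rescaling removes the character. The first
  inequality follows by counting cosets along \<open>Q \<subseteq> T \<subseteq> P \<subseteq> G\<close>, where \<open>|Q| \<le> d ^ s\<close> because, by
  smoothness, every variable \<open>x\<close> occurs in a monomial \<open>x ^ (d - 1) * y\<close> of \<open>F\<close>. The second one
  needs that the maxima \<open>JC\<close> exist, that is, Jordan's theorem for primitive groups: elements
  close to the identity are scalar, so compactness bounds the order modulo scalars.\<close>

section \<open>Linear automorphisms modulo homotheties\<close>

text \<open>The index appears because the canonical bound counts the marked block with its whole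
  group \<open>H_group\<close>, whereas an element of \<open>T\<close> is determined modulo
  \<open>Q\<close> by its class in \<open>N\<close>. Making the other blocks scalar is what lets
  coefficients be compared: on the outer variables \<open>T\<close> is diagonal, so each outer
  monomial is only multiplied by a number. Being preserved concerns the image in PGL alone, so an
  element of \<open>T\<close> may be replaced by a multiple; the factor is a \<open>d1\<close>-th
  root of the character value, available because \<open>d1 > 0\<close>. The exponent
  \<open>s\<close> in the bound for \<open>Q\<close> comes from picking one variable per block. This
  gives \<open>s\<close> equations in \<open>s\<close> unknown scalars, whose shape is that of a
  self-map of the blocks: tails contribute at most \<open>d - 1\<close> each, a cycle of length
  \<open>c\<close> at most \<open>(d - 1) ^ c + 1\<close>. Jordan's theorem enters since
  \<open>JC\<close> is a \<open>Max\<close>, which bounds the members of a set only if the set is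
  finite. The radius 1/4 is chosen so that a commutator is at most half as far from the identity.
  Finally, \<open>JC\<close> speaks of sequence spaces and the blocks are subspaces of a space of
  column vectors, so primitivity has to be carried along linear isomorphisms.\<close>

context complex_space
begin

lemma GL_carrier_iff:
  "g \<in> carrier (GL W) \<longleftrightarrow> g \<in> extensional W \<and> bij_betw g W W \<and>
     (\<forall>x\<in>W. \<forall>y\<in>W. g (x + y) = g x + g y) \<and> (\<forall>c. \<forall>x\<in>W. g (scale c x) = scale c (g x))"
  by (auto simp: GL_def Bij_def)

lemma GL_closed: "g \<in> carrier (GL W) \<Longrightarrow> w \<in> W \<Longrightarrow> g w \<in> W"
  by (auto simp: GL_carrier_iff bij_betw_def)

lemma GL_inj: "g \<in> carrier (GL W) \<Longrightarrow> v \<in> W \<Longrightarrow> w \<in> W \<Longrightarrow> g v = g w \<longleftrightarrow> v = w"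
  by (auto simp: GL_carrier_iff bij_betw_def inj_on_def)

lemma GL_add: "g \<in> carrier (GL W) \<Longrightarrow> v \<in> W \<Longrightarrow> w \<in> W \<Longrightarrow> g (v + w) = g v + g w"
  by (auto simp: GL_carrier_iff)

lemma GL_scale: "g \<in> carrier (GL W) \<Longrightarrow> v \<in> W \<Longrightarrow> g (scale c v) = scale c (g v)"
  by (auto simp: GL_carrier_iff)

lemma GL_zero: "g \<in> carrier (GL W) \<Longrightarrow> subspace W \<Longrightarrow> g 0 = 0"
  using GL_scale[of g W 0 0] subspace_0[of W] by simp

lemma GL_diff:
  assumes "g \<in> carrier (GL W)" "subspace W" "v \<in> W" "w \<in> W"
  shows "g (v - w) = g v - g w"
proof -
  have "g (v + scale (-1) w) = g v + scale (-1) (g w)"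
    using assms by (simp add: GL_add GL_scale subspace_scale del: scale_minus_left)
  then show ?thesis by simp
qed

lemma GL_sum:
  assumes "g \<in> carrier (GL W)" "subspace W" "\<And>i. i \<in> I \<Longrightarrow> f i \<in> W"
  shows "g (sum f I) = (\<Sum>i\<in>I. g (f i))"
  using assms(3)
proof (induction I rule: infinite_finite_induct)
  case (insert x F)
  then show ?case using assms by (simp add: GL_add subspace_sum)
qed (use assms GL_zero in auto)

lemma GL_ext:
  "g \<in> carrier (GL W) \<Longrightarrow> h \<in> carrier (GL W) \<Longrightarrow> (\<And>w. w \<in> W \<Longrightarrow> g w = h w) \<Longrightarrow> g = h"
  by (auto simp: GL_carrier_iff intro: extensionalityI)

lemma GL_mult_eq: "g \<in> carrier (GL W) \<Longrightarrow> h \<in> carrier (GL W) \<Longrightarrow> g \<otimes>\<^bsub>GL W\<^esub> h = compose W g h"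
  by (auto simp: GL_def BijGroup_def)

lemma GL_mult_apply:
  "g \<in> carrier (GL W) \<Longrightarrow> h \<in> carrier (GL W) \<Longrightarrow> w \<in> W \<Longrightarrow> (g \<otimes>\<^bsub>GL W\<^esub> h) w = g (h w)"
  by (simp add: GL_mult_eq compose_def)

lemma GL_one: "\<one>\<^bsub>GL W\<^esub> = (\<lambda>x\<in>W. x)"
  by (simp add: GL_def BijGroup_def)

text \<open>As \<open>GL W\<close> is \<open>BijGroup W\<close> with a smaller carrier, it suffices
  that the linear bijections form a subgroup.\<close>

lemma group_GL:
  assumes W: "subspace W"
  shows "group (GL W)"
proof -
  interpret B: group "BijGroup W" by (rule group_BijGroup)
  have lin_inv: "inv_into W g y \<in> W \<and> g (inv_into W g y) = y"
    if "bij_betw g W W" "y \<in> W" for g and y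
    using that by (metis bij_betw_def f_inv_into_f inv_into_into)
  have "subgroup (carrier (GL W)) (BijGroup W)"
  proof
    show "carrier (GL W) \<subseteq> carrier (BijGroup W)"
      by (auto simp: GL_def BijGroup_def)
  next
    fix g h assume "g \<in> carrier (GL W)" "h \<in> carrier (GL W)"
    then have "compose W g h \<in> carrier (GL W)"
      using W unfolding GL_carrier_iff
      by (auto simp: compose_def bij_betw_apply subspace_add subspace_scale
          intro!: bij_betw_trans[of h W W g W, unfolded comp_def])
    then show "g \<otimes>\<^bsub>BijGroup W\<^esub> h \<in> carrier (GL W)"
      using \<open>g \<in> _\<close> \<open>h \<in> _\<close> by (auto simp: BijGroup_def GL_carrier_iff Bij_def)
  next
    show "\<one>\<^bsub>BijGroup W\<^esub> \<in> carrier (GL W)"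
      using W by (auto simp: GL_carrier_iff BijGroup_def subspace_add subspace_scale bij_betw_def inj_on_def)
  next
    fix g assume g: "g \<in> carrier (GL W)"
    then have gB: "g \<in> Bij W" by (simp add: GL_def)
    have bij: "bij_betw g W W" using g by (simp add: GL_carrier_iff)
    have "inv\<^bsub>BijGroup W\<^esub> g = (\<lambda>x\<in>W. inv_into W g x)"
      using gB by (rule inv_BijGroup)
    moreover have "(\<lambda>x\<in>W. inv_into W g x) \<in> carrier (GL W)"
      unfolding GL_carrier_iff
    proof (intro conjI ballI allI)
      show "bij_betw (\<lambda>x\<in>W. inv_into W g x) W W"
        using bij_betw_inv_into[OF bij] by (simp cong: bij_betw_cong)
    next
      fix x y assume xy: "x \<in> W" "y \<in> W"
      then have "g (inv_into W g x + inv_into W g y) = x + y"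
        using lin_inv[OF bij] g by (simp add: GL_add)
      then show "restrict (inv_into W g) W (x + y) = restrict (inv_into W g) W x + restrict (inv_into W g) W y"
        using xy W lin_inv[OF bij] bij by (simp add: subspace_add bij_betw_def inv_into_f_eq)
    next
      fix c x assume x: "x \<in> W"
      then have "g (scale c (inv_into W g x)) = scale c x"
        using lin_inv[OF bij] g by (simp add: GL_scale)
      then show "restrict (inv_into W g) W (scale c x) = scale c (restrict (inv_into W g) W x)"
        using x W lin_inv[OF bij] bij by (simp add: subspace_scale bij_betw_def inv_into_f_eq)
    qed auto
    ultimately show "inv\<^bsub>BijGroup W\<^esub> g \<in> carrier (GL W)" by simp
  qed
  then have "group ((BijGroup W)\<lparr>carrier := carrier (GL W)\<rparr>)"
    by (rule B.subgroup_imp_group)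
  then show ?thesis by (simp add: GL_def)
qed

lemma GL_inv_apply:
  assumes "subspace W" "g \<in> carrier (GL W)" "w \<in> W"
  shows "(inv\<^bsub>GL W\<^esub> g) (g w) = w" "g ((inv\<^bsub>GL W\<^esub> g) w) = w"
proof -
  interpret group "GL W" by (rule group_GL) fact
  show "(inv\<^bsub>GL W\<^esub> g) (g w) = w"
    using assms by (metis GL_mult_apply GL_one inv_closed l_inv restrict_apply)
  show "g ((inv\<^bsub>GL W\<^esub> g) w) = w"
    using assms by (metis GL_mult_apply GL_one inv_closed r_inv restrict_apply)
qed

lemma homothety_in_GL:
  assumes "subspace W" "c \<noteq> 0"
  shows "restrict (scale c) W \<in> carrier (GL W)"
proof -
  have "bij_betw (restrict (scale c) W) W W"
  proof (rule bij_betw_byWitness[where f' = "scale (inverse c)"])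
  qed (use assms in \<open>auto simp: subspace_scale\<close>)
  then show ?thesis using assms by (auto simp: GL_carrier_iff subspace_add subspace_scale scale_right_distrib)
qed

lemma homotheties_subgroup:
  assumes W: "subspace W"
  shows "subgroup (homotheties W) (GL W)"
proof -
  interpret group "GL W" by (rule group_GL) fact
  show ?thesis
  proof (rule subgroupI)
    show "homotheties W \<subseteq> carrier (GL W)"
      using W by (auto simp: homotheties_def homothety_in_GL)
    show "homotheties W \<noteq> {}" by (auto simp: homotheties_def intro: exI[of _ 1])
  next
    fix a assume "a \<in> homotheties W"
    then obtain c where c: "c \<noteq> 0" "a = restrict (scale c) W" by (auto simp: homotheties_def)
    have "inv\<^bsub>GL W\<^esub> a = restrict (scale (inverse c)) W"
    proof (rule inv_equality)
      show "restrict (scale (inverse c)) W \<otimes>\<^bsub>GL W\<^esub> a = \<one>\<^bsub>GL W\<^esub>"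
        using c W by (intro GL_ext[of _ W])
          (auto simp: homothety_in_GL GL_mult_apply GL_one subspace_scale one_closed[unfolded GL_one])
    qed (use c W in \<open>auto simp: homothety_in_GL\<close>)
    then show "inv\<^bsub>GL W\<^esub> a \<in> homotheties W"
      using c by (auto simp: homotheties_def intro: exI[of _ "inverse c"])
  next
    fix a b assume "a \<in> homotheties W" "b \<in> homotheties W"
    then obtain c c' where c: "c \<noteq> 0" "a = restrict (scale c) W" "c' \<noteq> 0" "b = restrict (scale c') W"
      by (auto simp: homotheties_def)
    have "a \<otimes>\<^bsub>GL W\<^esub> b = restrict (scale (c * c')) W"
      using c W by (intro GL_ext[of _ W]) (auto simp: homothety_in_GL GL_mult_apply subspace_scale)
    then show "a \<otimes>\<^bsub>GL W\<^esub> b \<in> homotheties W"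
      using c by (auto simp: homotheties_def intro: exI[of _ "c * c'"])
  qed
qed

lemma homotheties_normal:
  assumes W: "subspace W"
  shows "homotheties W \<lhd> GL W"
proof -
  interpret group "GL W" by (rule group_GL) fact
  have "x \<otimes>\<^bsub>GL W\<^esub> h \<otimes>\<^bsub>GL W\<^esub> inv\<^bsub>GL W\<^esub> x = h" if x: "x \<in> carrier (GL W)" and h: "h \<in> homotheties W" for x h
  proof -
    have hc: "h \<in> carrier (GL W)" using h homotheties_subgroup[OF W] subgroup.mem_carrier by metis
    obtain c where c: "c \<noteq> 0" "h = restrict (scale c) W" using h by (auto simp: homotheties_def)
    have "x \<otimes>\<^bsub>GL W\<^esub> h = h \<otimes>\<^bsub>GL W\<^esub> x"
      using W x hc GL_closed[OF x] by (intro GL_ext[of _ W]) (auto simp: GL_mult_apply c GL_scale subspace_scale)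
    then show ?thesis using x hc by (simp add: m_assoc)
  qed
  then show ?thesis using homotheties_subgroup[OF W] by (auto simp: normal_inv_iff)
qed

lemma group_PGL: "subspace W \<Longrightarrow> group (PGL W)"
  unfolding PGL_def by (intro normal.factorgroup_is_group homotheties_normal)

definition proj_class :: "'b set \<Rightarrow> ('b \<Rightarrow> 'b) \<Rightarrow> ('b \<Rightarrow> 'b) set" where
  "proj_class W g = homotheties W #>\<^bsub>GL W\<^esub> g"

lemma PGL_image_eq: "PGL_image W K = proj_class W ` K"
  by (simp add: PGL_image_def proj_class_def)

lemma proj_class_hom: "subspace W \<Longrightarrow> proj_class W \<in> hom (GL W) (PGL W)"
  unfolding PGL_def proj_class_def using normal.r_coset_hom_Mod[OF homotheties_normal] by auto

text \<open>A coset of the homotheties consists of the multiples of one map. Later arguments about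
  PGL use this proportionality criterion in place of cosets.\<close>

lemma proj_class_eq_iff:
  assumes W: "subspace W" and g: "g \<in> carrier (GL W)" and h: "h \<in> carrier (GL W)"
  shows "proj_class W g = proj_class W h \<longleftrightarrow> (\<exists>c. c \<noteq> 0 \<and> (\<forall>w\<in>W. g w = scale c (h w)))"
proof -
  interpret group "GL W" by (rule group_GL) fact
  have sub: "subgroup (homotheties W) (GL W)" by (rule homotheties_subgroup) fact
  have "proj_class W g = proj_class W h \<longleftrightarrow> g \<in> proj_class W h"
    unfolding proj_class_def using sub g h
    by (metis repr_independence rcos_self)
  also have "\<dots> \<longleftrightarrow> (\<exists>c. c \<noteq> 0 \<and> g = restrict (scale c) W \<otimes>\<^bsub>GL W\<^esub> h)"
    by (auto simp: proj_class_def r_coset_def homotheties_def)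
  also have "\<dots> \<longleftrightarrow> (\<exists>c. c \<noteq> 0 \<and> (\<forall>w\<in>W. g w = scale c (h w)))"
  proof -
    have "g = restrict (scale c) W \<otimes>\<^bsub>GL W\<^esub> h \<longleftrightarrow> (\<forall>w\<in>W. g w = scale c (h w))" if "c \<noteq> 0" for c
    proof -
      have "(restrict (scale c) W \<otimes>\<^bsub>GL W\<^esub> h) w = scale c (h w)" if "w \<in> W" for w
        using that \<open>c \<noteq> 0\<close> W h GL_closed[OF h] by (simp add: GL_mult_apply homothety_in_GL)
      then show ?thesis
        using \<open>c \<noteq> 0\<close> W g h by (metis GL_ext homothety_in_GL m_closed)
    qed
    then show ?thesis by blast
  qed
  finally show ?thesis .
qed

end

section \<open>Joint eigenspaces and primitivity\<close>

lemma sum_powers_root_of_unity: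
  fixes z :: complex
  assumes "z ^ n = 1" "z \<noteq> 1"
  shows "(\<Sum>i<n. z ^ i) = 0"
  using assms by (simp add: geometric_sum)

context complex_space
begin

text \<open>Some Fourier component \<open>e j\<close> of the orbit of a non-zero vector \<open>w\<close> is non-zero, because they add up
  to \<open>n\<close> times \<open>w\<close>.\<close>

lemma eigenvector_exists:
  assumes U: "subspace U" "U \<noteq> {0}" and closed: "\<And>w. w \<in> U \<Longrightarrow> g w \<in> U"
    and add: "\<And>v w. v \<in> U \<Longrightarrow> w \<in> U \<Longrightarrow> g (v + w) = g v + g w"
    and scale: "\<And>c w. w \<in> U \<Longrightarrow> g (scale c w) = scale c (g w)"
    and n: "n > 0" and period: "\<And>w. w \<in> U \<Longrightarrow> (g ^^ n) w = w"
  shows "\<exists>c w. w \<in> U \<and> w \<noteq> 0 \<and> g w = scale c w"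
proof -
  obtain w where w: "w \<in> U" "w \<noteq> 0" using U subspace_0[of U] by auto
  define \<rho> where "\<rho> j = exp (2 * of_real pi * \<i> * of_nat j / of_nat n)" for j
  have \<rho>_pow: "\<rho> j ^ i = \<rho> (i * j)" for i j
    by (simp add: \<rho>_def exp_of_nat_mult[symmetric] mult_ac)
  have \<rho>_1: "\<rho> j = 1 \<longleftrightarrow> n dvd j" for j
    using complex_root_unity_eq_1[of n j] n by (simp add: \<rho>_def)
  have gi: "(g ^^ i) w \<in> U" for i by (induction i) (use w closed in auto)
  define e where "e j = (\<Sum>i<n. scale (\<rho> j ^ i) ((g ^^ i) w))" for j
  have eU: "e j \<in> U" for j
    unfolding e_def by (intro subspace_sum subspace_scale U gi)
  have g_sum: "g (\<Sum>i\<in>I. f i) = (\<Sum>i\<in>I. g (f i))" if "\<And>i. f i \<in> U" for I :: "nat set" and f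
  proof (induction I rule: infinite_finite_induct)
    case (insert x F)
    then show ?case using that U by (simp add: add subspace_sum)
  qed (use scale[of 0 0] subspace_0[OF U(1)] in auto)
  \<comment> \<open>Applying \<open>g\<close> shifts the orbit by one index. The shifted sum gains
    the term at \<open>n\<close> and loses the term at 0, and both equal \<open>w\<close> by
    periodicity.\<close>
  have eigen: "scale (\<rho> j) (g (e j)) = e j" for j
  proof -
    have "scale (\<rho> j) (g (e j)) = (\<Sum>i<n. scale (\<rho> j ^ Suc i) ((g ^^ Suc i) w))"
      unfolding e_def by (subst g_sum) (auto simp: U gi subspace_scale scale scale_sum_right)
    also have "\<dots> = e j + scale (\<rho> j ^ n) ((g ^^ n) w) - w"
    proof -
      define f where "f i = scale (\<rho> j ^ i) ((g ^^ i) w)" for i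
      have "(\<Sum>i<n. f (Suc i)) = sum f {..<n} + f n - f 0"
        using sum.lessThan_Suc_shift[of f n] by (simp add: algebra_simps)
      then show ?thesis unfolding f_def e_def by simp
    qed
    also have "\<dots> = e j" using w \<rho>_1[of "n * j"] by (simp add: \<rho>_pow period)
    finally show ?thesis .
  qed
  have "(\<Sum>j<n. e j) = (\<Sum>i<n. scale (\<Sum>j<n. \<rho> j ^ i) ((g ^^ i) w))"
    unfolding e_def by (subst sum.swap) (simp add: scale_sum_left)
  also have "\<dots> = (\<Sum>i<n. if i = 0 then scale (of_nat n) w else 0)"
  proof (intro sum.cong refl)
    fix i assume i: "i \<in> {..<n}"
    show "scale (\<Sum>j<n. \<rho> j ^ i) ((g ^^ i) w) = (if i = 0 then scale (of_nat n) w else 0)"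
    proof (cases "i = 0")
      case False
      have "(\<Sum>j<n. \<rho> j ^ i) = (\<Sum>j<n. \<rho> i ^ j)" by (simp add: \<rho>_pow mult.commute)
      also have "\<dots> = 0"
        using False i by (intro sum_powers_root_of_unity) (auto simp: \<rho>_pow \<rho>_1 dest: dvd_imp_le)
      finally show ?thesis using False by simp
    qed simp
  qed
  also have "\<dots> = scale (of_nat n) w" using n by simp
  finally have "(\<Sum>j<n. e j) \<noteq> 0" using w n by simp
  then obtain j where j: "e j \<noteq> 0" by (meson sum.not_neutral_contains_not_neutral)
  have "\<rho> j \<noteq> 0" by (simp add: \<rho>_def)
  then have "g (e j) = scale (inverse (\<rho> j)) (e j)"
    using arg_cong[OF eigen[of j], of "scale (inverse (\<rho> j))"] by simp
  then show ?thesis using eU j by blast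
qed

section \<open>Internal direct sums as spanning families without relations\<close>

lemma direct_sumI:
  assumes I: "finite I" and U: "\<And>i. i \<in> I \<Longrightarrow> subspace (U i)" and W: "span (\<Union>i\<in>I. U i) = W"
    and indep: "\<And>u. (\<And>i. i \<in> I \<Longrightarrow> u i \<in> U i) \<Longrightarrow> sum u I = 0 \<Longrightarrow> \<forall>i\<in>I. u i = 0"
  shows "direct_sum I U W"
  unfolding direct_sum_def bij_betw_def
proof (intro conjI ballI I U)
  show "inj_on (\<lambda>u. \<Sum>i\<in>I. u i) (PiE I U)"
  proof (rule inj_onI)
    fix u v assume uv: "u \<in> PiE I U" "v \<in> PiE I U" "(\<Sum>i\<in>I. u i) = (\<Sum>i\<in>I. v i)"
    have "\<forall>i\<in>I. u i - v i = 0"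
      using uv U by (intro indep) (auto simp: sum_subtractf intro!: subspace_diff)
    then show "u = v" using uv by (intro PiE_ext[OF uv(1,2)]) auto
  qed
  let ?S = "(\<lambda>u. \<Sum>i\<in>I. u i) ` PiE I U"
  \<comment> \<open>Restriction to \<open>I\<close> turns an arbitrary selection into a member of
    the extensional product that \<open>direct_sum\<close> asks for.\<close>
  have SI: "(\<Sum>i\<in>I. u i) \<in> ?S" if "\<And>i. i \<in> I \<Longrightarrow> u i \<in> U i" for u
    using that by (intro image_eqI[of _ _ "restrict u I"]) auto
  have "span (\<Union>i\<in>I. U i) \<subseteq> ?S"
  proof (rule span_minimal)
    show "(\<Union>i\<in>I. U i) \<subseteq> ?S"
    proof
      fix w assume "w \<in> (\<Union>i\<in>I. U i)"
      then obtain i where i: "i \<in> I" "w \<in> U i" by auto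
      have "w = (\<Sum>l\<in>I. if l = i then w else 0)" using I i by simp
      moreover have "\<dots> \<in> ?S" using i U subspace_0 by (intro SI) auto
      ultimately show "w \<in> ?S" by simp
    qed
    show "subspace ?S"
    proof (rule subspaceI)
      have "(\<Sum>i\<in>I. 0) \<in> ?S" using U subspace_0 by (intro SI) auto
      then show "0 \<in> ?S" by simp
    next
      fix x y assume "x \<in> ?S" "y \<in> ?S"
      then obtain u v where uv: "u \<in> PiE I U" "v \<in> PiE I U" "x = (\<Sum>i\<in>I. u i)" "y = (\<Sum>i\<in>I. v i)" by auto
      have "(\<Sum>i\<in>I. u i + v i) \<in> ?S" using uv U by (intro SI) (auto intro!: subspace_add)
      then show "x + y \<in> ?S" using uv by (simp add: sum.distrib)
    next
      fix c x assume "x \<in> ?S"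
      then obtain u where u: "u \<in> PiE I U" "x = (\<Sum>i\<in>I. u i)" by auto
      have "(\<Sum>i\<in>I. scale c (u i)) \<in> ?S" using u U by (intro SI) (auto intro!: subspace_scale)
      then show "scale c x \<in> ?S" using u by (simp add: scale_sum_right)
    qed
  qed
  moreover have "?S \<subseteq> span (\<Union>i\<in>I. U i)" by (auto intro!: span_sum intro: span_base[OF UN_I])
  ultimately show "?S = W" using W by auto
qed

lemma direct_sumD:
  assumes ds: "direct_sum I U W"
  shows "finite I" "\<And>i. i \<in> I \<Longrightarrow> subspace (U i)"
    and "\<And>u. (\<And>i. i \<in> I \<Longrightarrow> u i \<in> U i) \<Longrightarrow> sum u I \<in> W"
    and "\<And>w. w \<in> W \<Longrightarrow> \<exists>u. (\<forall>i\<in>I. u i \<in> U i) \<and> w = sum u I"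
    and "\<And>u i. (\<And>i. i \<in> I \<Longrightarrow> u i \<in> U i) \<Longrightarrow> sum u I = 0 \<Longrightarrow> i \<in> I \<Longrightarrow> u i = 0"
proof -
  show "finite I" and sub: "\<And>i. i \<in> I \<Longrightarrow> subspace (U i)" using ds by (auto simp: direct_sum_def)
  have inj: "inj_on (\<lambda>u. \<Sum>i\<in>I. u i) (PiE I U)" and W: "(\<lambda>u. \<Sum>i\<in>I. u i) ` PiE I U = W"
    using ds by (auto simp: direct_sum_def bij_betw_def)
  have r: "restrict u I \<in> PiE I U" if "\<And>i. i \<in> I \<Longrightarrow> u i \<in> U i" for u using that by auto
  show "sum u I \<in> W" if "\<And>i. i \<in> I \<Longrightarrow> u i \<in> U i" for u
    using imageI[OF r[OF that], of "\<lambda>u. \<Sum>i\<in>I. u i"] W by simp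
  show "\<exists>u. (\<forall>i\<in>I. u i \<in> U i) \<and> w = sum u I" if w: "w \<in> W" for w
    using w unfolding W[symmetric] by (auto simp: PiE_iff)
  fix u i assume u: "\<And>i. i \<in> I \<Longrightarrow> u i \<in> U i" and "sum u I = 0" and i: "i \<in> I"
  then have "restrict u I = restrict (\<lambda>_. 0) I"
    using sub subspace_0 by (intro inj_onD[OF inj] r) auto
  then show "u i = 0" using i by (metis restrict_apply')
qed

text \<open>Only the values of \<open>\<alpha>\<close> on \<open>C\<close> matter; where distinct
  weights have to be distinct functions, they are taken from \<open>extensional C\<close>.\<close>

definition joint_eigenspace :: "'b set \<Rightarrow> ('b \<Rightarrow> 'b) set \<Rightarrow> (('b \<Rightarrow> 'b) \<Rightarrow> complex) \<Rightarrow> 'b set" where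
  "joint_eigenspace W C \<alpha> = {w \<in> W. \<forall>g\<in>C. g w = scale (\<alpha> g) w}"

lemma joint_eigenspaceI:
  "w \<in> W \<Longrightarrow> (\<And>g. g \<in> C \<Longrightarrow> g w = scale (\<alpha> g) w) \<Longrightarrow> w \<in> joint_eigenspace W C \<alpha>"
  unfolding joint_eigenspace_def by blast

lemma joint_eigenspaceD:
  "w \<in> joint_eigenspace W C \<alpha> \<Longrightarrow> w \<in> W"
  "w \<in> joint_eigenspace W C \<alpha> \<Longrightarrow> g \<in> C \<Longrightarrow> g w = scale (\<alpha> g) w"
  unfolding joint_eigenspace_def by blast+

lemma subspace_joint_eigenspace:
  assumes W: "subspace W" and C: "C \<subseteq> carrier (GL W)"
  shows "subspace (joint_eigenspace W C \<alpha>)"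
proof (rule subspaceI)
  fix c x assume x: "x \<in> joint_eigenspace W C \<alpha>"
  note xW = joint_eigenspaceD(1)[OF x]
  show "scale c x \<in> joint_eigenspace W C \<alpha>"
  proof (rule joint_eigenspaceI)
    fix g assume g: "g \<in> C"
    show "g (scale c x) = scale (\<alpha> g) (scale c x)"
      using C g xW by (subst GL_scale) (auto simp: joint_eigenspaceD(2)[OF x g] mult.commute)
  qed (simp add: W xW subspace_scale)
next
  fix x y assume x: "x \<in> joint_eigenspace W C \<alpha>" and y: "y \<in> joint_eigenspace W C \<alpha>"
  note xyW = joint_eigenspaceD(1)[OF x] joint_eigenspaceD(1)[OF y]
  show "x + y \<in> joint_eigenspace W C \<alpha>"
  proof (rule joint_eigenspaceI)
    fix g assume g: "g \<in> C"
    show "g (x + y) = scale (\<alpha> g) (x + y)"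
      using C g xyW by (subst GL_add)
        (auto simp: joint_eigenspaceD(2)[OF x g] joint_eigenspaceD(2)[OF y g] scale_right_distrib)
  qed (simp add: W xyW subspace_add)
next
  show "0 \<in> joint_eigenspace W C \<alpha>"
    using W C by (intro joint_eigenspaceI) (auto simp: subspace_0 GL_zero)
qed

text \<open>Commuting maps preserve each other's eigenspaces, so the next map has an eigenvector
  inside the joint eigenspace found so far. The finite period is what supplies eigenvectors.\<close>

lemma joint_eigenvector_exists:
  assumes W: "subspace W" "W \<noteq> {0}" and D: "finite D" "D \<subseteq> carrier (GL W)"
    and comm: "\<And>g h w. g \<in> D \<Longrightarrow> h \<in> D \<Longrightarrow> w \<in> W \<Longrightarrow> g (h w) = h (g w)"
    and per: "\<And>g. g \<in> D \<Longrightarrow> \<exists>n>0. \<forall>w\<in>W. (g ^^ n) w = w"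
  shows "\<exists>\<alpha>. joint_eigenspace W D \<alpha> \<noteq> {0}"
  using D comm per
proof (induction D rule: finite_induct)
  case empty
  then show ?case using W by (auto simp: joint_eigenspace_def)
next
  case (insert g D)
  have "\<exists>\<alpha>. joint_eigenspace W D \<alpha> \<noteq> {0}"
    by (rule insert.IH) (use insert.prems in auto)
  then obtain \<alpha> where \<alpha>: "joint_eigenspace W D \<alpha> \<noteq> {0}" (is "?U \<noteq> _") by blast
  have U: "subspace ?U" using insert.prems W by (intro subspace_joint_eigenspace) auto
  have g: "g \<in> carrier (GL W)" using insert.prems by auto
  obtain n where n: "n > 0" "\<forall>w\<in>W. (g ^^ n) w = w" using insert.prems(3)[of g] by auto
  have "\<exists>c w. w \<in> ?U \<and> w \<noteq> 0 \<and> g w = scale c w"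
  proof (rule eigenvector_exists[OF U \<alpha> _ _ _ n(1)])
    fix w assume w: "w \<in> ?U"
    have "h (g w) = scale (\<alpha> h) (g w)" if h: "h \<in> D" for h
    proof -
      have "h (g w) = g (h w)" using h insert.prems(2)[of h g w] joint_eigenspaceD(1)[OF w] by blast
      then show ?thesis using joint_eigenspaceD(2)[OF w h] GL_scale[OF g joint_eigenspaceD(1)[OF w]] by simp
    qed
    then show "g w \<in> ?U" using GL_closed[OF g] joint_eigenspaceD(1)[OF w] by (intro joint_eigenspaceI)
  qed (use g n GL_add GL_scale joint_eigenspaceD(1) in \<open>blast+\<close>)
  then obtain c w where w: "w \<in> ?U" "w \<noteq> 0" "g w = scale c w" by blast
  have "w \<in> joint_eigenspace W (insert g D) (\<alpha>(g := c))"
  proof (rule joint_eigenspaceI)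
    fix h assume "h \<in> insert g D"
    then show "h w = scale ((\<alpha>(g := c)) h) w"
      using w(3) joint_eigenspaceD(2)[OF w(1)] by (cases "h = g") simp_all
  qed (rule joint_eigenspaceD(1)[OF w(1)])
  then show ?case using w(2) by blast
qed

text \<open>Applying \<open>g\<close> to a relation and subtracting \<open>a g\<close> times it
  removes the summand of \<open>a\<close> and leaves a shorter relation of the same kind.
  Extensionality guarantees a \<open>g\<close> in \<open>C\<close> at which two weights
  differ.\<close>

lemma joint_eigenspaces_independent:
  assumes W: "subspace W" and C: "C \<subseteq> carrier (GL W)" and X: "finite X" "X \<subseteq> extensional C"
    and u: "\<And>\<alpha>. \<alpha> \<in> X \<Longrightarrow> u \<alpha> \<in> joint_eigenspace W C \<alpha>" and sum0: "(\<Sum>\<alpha>\<in>X. u \<alpha>) = 0"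
  shows "\<forall>\<alpha>\<in>X. u \<alpha> = 0"
  using X u sum0
proof (induction X arbitrary: u rule: finite_induct)
  case (insert a X)
  have step: "scale (\<alpha> g - a g) (u \<alpha>) = 0" if g: "g \<in> C" and \<alpha>: "\<alpha> \<in> X" for g \<alpha>
  proof -
    have gW: "g \<in> carrier (GL W)" using g C by auto
    have "\<forall>\<alpha>\<in>X. scale (\<alpha> g - a g) (u \<alpha>) = 0"
    proof (rule insert.IH)
      fix \<alpha> assume "\<alpha> \<in> X"
      then show "scale (\<alpha> g - a g) (u \<alpha>) \<in> joint_eigenspace W C \<alpha>"
        using insert.prems(2) subspace_scale[OF subspace_joint_eigenspace[OF W C]] by auto
    next
      have "0 = g (\<Sum>\<alpha>\<in>insert a X. u \<alpha>) - scale (a g) (\<Sum>\<alpha>\<in>insert a X. u \<alpha>)"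
        using insert.prems(3) GL_zero[OF gW W] by simp
      also have "g (\<Sum>\<alpha>\<in>insert a X. u \<alpha>) = (\<Sum>\<alpha>\<in>insert a X. scale (\<alpha> g) (u \<alpha>))"
        using joint_eigenspaceD(1)[OF insert.prems(2)] joint_eigenspaceD(2)[OF insert.prems(2) g]
        by (subst GL_sum[OF gW W]) (auto intro!: sum.cong)
      also have "\<dots> - scale (a g) (\<Sum>\<alpha>\<in>insert a X. u \<alpha>) = (\<Sum>\<alpha>\<in>insert a X. scale (\<alpha> g - a g) (u \<alpha>))"
        by (simp only: scale_sum_right sum_subtractf[symmetric] scale_left_diff_distrib)
      also have "\<dots> = (\<Sum>\<alpha>\<in>X. scale (\<alpha> g - a g) (u \<alpha>))" using insert.hyps by simp
      finally show "(\<Sum>\<alpha>\<in>X. scale (\<alpha> g - a g) (u \<alpha>)) = 0" by simp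
    qed (use insert.prems in auto)
    then show ?thesis using \<alpha> by blast
  qed
  have X0: "u \<alpha> = 0" if \<alpha>: "\<alpha> \<in> X" for \<alpha>
  proof -
    have "\<alpha> \<noteq> a" using \<alpha> insert.hyps by auto
    then obtain g where "g \<in> C" "\<alpha> g \<noteq> a g"
      using insert.prems(1) \<alpha> extensionalityI[of \<alpha> C a] by auto
    then show ?thesis using step[OF _ \<alpha>] by auto
  qed
  then have "u a = 0" using insert.prems(3) insert.hyps by simp
  then show ?case using X0 by auto
qed simp

lemma subgroup_GL_finite_order:
  assumes W: "subspace W" and K: "subgroup K (GL W)" "finite K" and g: "g \<in> K"
  shows "\<exists>n>0. \<forall>w\<in>W. (g ^^ n) w = w"
proof -
  interpret G: group "GL W" by (rule group_GL) fact
  interpret K: group "GL W\<lparr>carrier := K\<rparr>" by (rule G.subgroup_imp_group) fact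
  have gW: "g \<in> carrier (GL W)" using K g subgroup.mem_carrier by metis
  have pow: "w \<in> W \<Longrightarrow> (g [^]\<^bsub>GL W\<^esub> n) w = (g ^^ n) w" for n w
  proof (induction n arbitrary: w)
    case (Suc n)
    then show ?case using gW GL_closed[OF gW] by (simp add: GL_mult_apply funpow_swap1 del: funpow.simps) (simp add: funpow_swap1)
  qed (simp add: GL_one)
  have "g [^]\<^bsub>GL W\<^esub> card K = \<one>\<^bsub>GL W\<^esub>"
    using K.pow_order_eq_1[of g] g by (subst G.nat_pow_consistent[where H = K]) (simp add: order_def)
  moreover have "card K > 0" using g K by (auto simp: card_gt_0_iff)
  ultimately show ?thesis using pow by (metis GL_one restrict_apply)
qed

text \<open>The only place where primitivity is exploited. Since \<open>C\<close> is closed under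
  conjugation by \<open>K\<close>, its joint eigenspaces are permuted by \<open>K\<close>;
  irreducibility makes them span \<open>W\<close>, so they form a system of imprimitivity unless one
  of them is all of \<open>W\<close>.\<close>

lemma commuting_class_scalar:
  assumes prim: "primitive_GL W K" and CK: "C \<subseteq> K"
    and comm: "\<And>g h w. g \<in> C \<Longrightarrow> h \<in> C \<Longrightarrow> w \<in> W \<Longrightarrow> g (h w) = h (g w)"
    and conj: "\<And>x g. x \<in> K \<Longrightarrow> g \<in> C \<Longrightarrow> \<exists>h\<in>C. \<forall>w\<in>W. x (g w) = h (x w)"
  shows "\<exists>\<alpha>. \<forall>g\<in>C. \<forall>w\<in>W. g w = scale (\<alpha> g) w"
proof -
  have K: "subgroup K (GL W)" "finite K" and irr: "irreducible_action W K"
    using prim by (auto simp: primitive_GL_def)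
  have W: "subspace W" "W \<noteq> {0}" using irr by (auto simp: irreducible_action_def)
  interpret group "GL W" by (rule group_GL) fact
  have KG: "K \<subseteq> carrier (GL W)" using K subgroup.subset by metis
  have CG: "C \<subseteq> carrier (GL W)" using CK KG by simp
  have finC: "finite C" using CK K finite_subset by metis
  let ?E = "joint_eigenspace W C"
  define X where "X = {\<alpha> \<in> extensional C. ?E \<alpha> \<noteq> {0}}"
  have E_sub: "subspace (?E \<alpha>)" for \<alpha> using W CG by (intro subspace_joint_eigenspace)
  have E_W: "?E \<alpha> \<subseteq> W" for \<alpha> using joint_eigenspaceD(1) by blast
  have ext: "?E (restrict \<alpha> C) = ?E \<alpha>" for \<alpha>
    unfolding joint_eigenspace_def by (intro Collect_cong conj_cong ball_cong refl) simp
  have per: "\<exists>n>0. \<forall>w\<in>W. (g ^^ n) w = w" if "g \<in> C" for g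
    using subgroup_GL_finite_order W K CK that by blast
  then obtain N where N: "\<And>g. g \<in> C \<Longrightarrow> N g > 0 \<and> (\<forall>w\<in>W. (g ^^ N g) w = w)" by metis
  have X_eqI: "\<alpha> = \<alpha>'" if "\<alpha> \<in> X" "\<alpha>' \<in> X" "w \<noteq> 0" "w \<in> ?E \<alpha>" "w \<in> ?E \<alpha>'" for \<alpha> \<alpha>' w
  proof -
    have "\<alpha> g = \<alpha>' g" if "g \<in> C" for g
      using that \<open>w \<noteq> 0\<close> \<open>w \<in> ?E \<alpha>\<close> \<open>w \<in> ?E \<alpha>'\<close>
      by (metis joint_eigenspaceD(2) scale_right_imp_eq)
    then show ?thesis using that by (intro extensionalityI[of _ C]) (auto simp: X_def)
  qed
  have X_wit: "\<exists>w. w \<noteq> 0 \<and> w \<in> ?E \<alpha>" if "\<alpha> \<in> X" for \<alpha>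
    using that subspace_0[OF E_sub[of \<alpha>]] by (auto simp: X_def)
  have inj: "inj_on ?E X"
    by (rule inj_onI) (metis X_eqI X_wit)
  \<comment> \<open>A direct sum has a finite index set here. On a joint eigenvector an element with
    period \<open>N g\<close> has an \<open>N g\<close>-th root of unity as eigenvalue, which leaves
    finitely many weights.\<close>
  have finX: "finite X"
  proof (rule finite_subset)
    show "X \<subseteq> (\<Pi>\<^sub>E g\<in>C. {z. z ^ N g = 1})"
    proof
      fix \<alpha> assume \<alpha>: "\<alpha> \<in> X"
      obtain w where w: "w \<noteq> 0" "w \<in> ?E \<alpha>" using X_wit[OF \<alpha>] by blast
      have "\<alpha> g ^ N g = 1" if g: "g \<in> C" for g
      proof -
        have gW: "g \<in> carrier (GL W)" using g CG by auto
        have "(g ^^ i) w = scale (\<alpha> g ^ i) w" for i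
          by (induction i) (simp_all add: GL_scale[OF gW joint_eigenspaceD(1)[OF w(2)]]
              joint_eigenspaceD(2)[OF w(2) g] mult.commute)
        then have "scale (\<alpha> g ^ N g) w = scale 1 w" using N[OF g] w E_W by fastforce
        then show ?thesis using w by (metis scale_right_imp_eq)
      qed
      then show "\<alpha> \<in> (\<Pi>\<^sub>E g\<in>C. {z. z ^ N g = 1})" using \<alpha> by (auto simp: X_def PiE_def)
    qed
    show "finite (\<Pi>\<^sub>E g\<in>C. {z::complex. z ^ N g = 1})"
      using finC N by (intro finite_PiE finite_roots_unity) (auto simp: Suc_le_eq)
  qed
  define \<U> where "\<U> = ?E ` X"
  \<comment> \<open>Here \<open>c g\<close> plays the role of \<open>x^-1 g x\<close>: if
    \<open>w\<close> has weight \<open>\<alpha>\<close>, then \<open>x w\<close> has weight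
    \<open>\<alpha>\<close> composed with this conjugation.\<close>
  have maps: "\<exists>\<alpha>'\<in>X. x ` ?E \<alpha> \<subseteq> ?E \<alpha>'" if x: "x \<in> K" and \<alpha>: "\<alpha> \<in> X" for x \<alpha>
  proof -
    let ?y = "inv\<^bsub>GL W\<^esub> x"
    have y: "?y \<in> K" using K x subgroup.m_inv_closed by metis
    have xG: "x \<in> carrier (GL W)" using x KG by auto
    obtain c where c: "\<And>g. g \<in> C \<Longrightarrow> c g \<in> C \<and> (\<forall>w\<in>W. ?y (g w) = c g (?y w))"
      using conj[OF y] by metis
    have "x w \<in> ?E (\<lambda>g. \<alpha> (c g))" if w: "w \<in> ?E \<alpha>" for w
    proof -
      have wW: "w \<in> W" "x w \<in> W" using w E_W GL_closed[OF xG] by auto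
      have "g (x w) = scale (\<alpha> (c g)) (x w)" if g: "g \<in> C" for g
      proof -
        have "?y (g (x w)) = scale (\<alpha> (c g)) w"
          using c[OF g] wW GL_inv_apply(1)[OF W(1) xG wW(1)] joint_eigenspaceD(2)[OF w, of "c g"] by simp
        then have "x (?y (g (x w))) = scale (\<alpha> (c g)) (x w)" using GL_scale[OF xG] wW by simp
        then show ?thesis using GL_inv_apply(2)[OF W(1) xG] wW g CG GL_closed by (metis subsetD)
      qed
      then show ?thesis using wW(2) by (rule joint_eigenspaceI[rotated])
    qed
    then have sub: "x ` ?E \<alpha> \<subseteq> ?E (restrict (\<lambda>g. \<alpha> (c g)) C)" using ext by auto
    moreover have "restrict (\<lambda>g. \<alpha> (c g)) C \<in> X"
    proof -
      obtain w where w: "w \<noteq> 0" "w \<in> ?E \<alpha>" using X_wit[OF \<alpha>] by blast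
      have "x w \<noteq> 0"
        using w GL_inj[OF xG, of w 0] subspace_0[OF W(1)] GL_zero[OF xG W(1)] E_W by auto
      then have "?E (restrict (\<lambda>g. \<alpha> (c g)) C) \<noteq> {0}" using sub w by auto
      then show ?thesis by (auto simp: X_def)
    qed
    ultimately show ?thesis by blast
  qed
  \<comment> \<open>The inverse of \<open>x\<close> maps the target back into some eigenspace, which
    shares a non-zero vector with the original one and therefore equals it. So the inclusion from
    \<open>maps\<close> is an equality.\<close>
  have perm: "x ` U \<in> \<U>" if x: "x \<in> K" and U: "U \<in> \<U>" for x U
  proof -
    let ?y = "inv\<^bsub>GL W\<^esub> x"
    have y: "?y \<in> K" using K x subgroup.m_inv_closed by metis
    have xG: "x \<in> carrier (GL W)" using x KG by auto
    obtain \<alpha> where \<alpha>: "\<alpha> \<in> X" "U = ?E \<alpha>" using U by (auto simp: \<U>_def)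
    obtain \<alpha>' where \<alpha>': "\<alpha>' \<in> X" "x ` ?E \<alpha> \<subseteq> ?E \<alpha>'" using maps[OF x \<alpha>(1)] by blast
    obtain \<alpha>'' where \<alpha>'': "\<alpha>'' \<in> X" "?y ` ?E \<alpha>' \<subseteq> ?E \<alpha>''" using maps[OF y \<alpha>'(1)] by blast
    obtain w where w: "w \<noteq> 0" "w \<in> ?E \<alpha>" using X_wit[OF \<alpha>(1)] by blast
    then have "?y (x w) \<in> ?E \<alpha>''" using \<alpha>' \<alpha>'' by blast
    then have "w \<in> ?E \<alpha>''" using GL_inv_apply(1)[OF W(1) xG, of w] w E_W by (metis subsetD)
    then have "\<alpha>'' = \<alpha>" using X_eqI[OF \<alpha>''(1) \<alpha>(1) w(1)] w by auto
    have "?E \<alpha>' \<subseteq> x ` ?E \<alpha>"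
    proof
      fix v assume v: "v \<in> ?E \<alpha>'"
      then have "?y v \<in> ?E \<alpha>" using \<alpha>'' \<open>\<alpha>'' = \<alpha>\<close> by auto
      moreover have "x (?y v) = v" using GL_inv_apply(2)[OF W(1) xG, of v] v E_W by auto
      ultimately show "v \<in> x ` ?E \<alpha>" by force
    qed
    then have "x ` U = ?E \<alpha>'" using \<alpha>' \<alpha> by auto
    then show ?thesis using \<alpha>' by (auto simp: \<U>_def)
  qed
  have \<U>_sub: "\<And>U. U \<in> \<U> \<Longrightarrow> subspace U \<and> U \<subseteq> W" using E_sub E_W by (auto simp: \<U>_def)
  have fin\<U>: "finite \<U>" using finX by (simp add: \<U>_def)
  \<comment> \<open>By irreducibility: the span is stable under \<open>K\<close>, and it is non-zero
    because a joint eigenvector exists.\<close>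
  have span_W: "span (\<Union>\<U>) = W"
  proof -
    have sW: "span (\<Union>\<U>) \<subseteq> W" using \<U>_sub W by (intro span_minimal) auto
    have inv: "x ` span (\<Union>\<U>) \<subseteq> span (\<Union>\<U>)" if x: "x \<in> K" for x
    proof -
      have xG: "x \<in> carrier (GL W)" using x KG by auto
      have "span (\<Union>\<U>) \<subseteq> {w \<in> W. x w \<in> span (\<Union>\<U>)}"
      proof (rule span_minimal)
        show "\<Union>\<U> \<subseteq> {w \<in> W. x w \<in> span (\<Union>\<U>)}"
        proof
          fix w assume "w \<in> \<Union>\<U>"
          then obtain U where U: "U \<in> \<U>" "w \<in> U" by auto
          then have "x w \<in> \<Union>\<U>" using perm[OF x U(1)] by blast
          then show "w \<in> {w \<in> W. x w \<in> span (\<Union>\<U>)}"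
            using U \<U>_sub by (auto intro: span_base)
        qed
        show "subspace {w \<in> W. x w \<in> span (\<Union>\<U>)}"
          using W xG by (intro subspaceI)
            (auto simp: subspace_0 subspace_add subspace_scale GL_add GL_scale GL_zero span_0 span_add span_scale)
      qed
      then show ?thesis by auto
    qed
    have "\<exists>\<alpha>. ?E \<alpha> \<noteq> {0}"
      by (rule joint_eigenvector_exists[OF W finC CG]) (fact comm, fact per)
    then obtain \<alpha> where "?E \<alpha> \<noteq> {0}" by blast
    then have "restrict \<alpha> C \<in> X" by (auto simp: X_def ext)
    then have "span (\<Union>\<U>) \<noteq> {0}"
      using X_wit span_base[of _ "\<Union>\<U>"] unfolding \<U>_def by blast
    then show ?thesis
      using irr sW inv subspace_span[of "\<Union>\<U>"] unfolding irreducible_action_def by blast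
  qed
  have "direct_sum \<U> (\<lambda>U. U) W"
  proof (rule direct_sumI[OF fin\<U>])
    fix u assume u: "\<And>U. U \<in> \<U> \<Longrightarrow> u U \<in> U" and "sum u \<U> = 0"
    then have "(\<Sum>\<alpha>\<in>X. u (?E \<alpha>)) = 0" unfolding \<U>_def by (subst (asm) sum.reindex[OF inj]) simp
    then have "\<forall>\<alpha>\<in>X. u (?E \<alpha>) = 0"
      using u by (intro joint_eigenspaces_independent[OF W(1) CG finX]) (auto simp: X_def \<U>_def)
    then show "\<forall>U\<in>\<U>. u U = 0" by (auto simp: \<U>_def)
  qed (use \<U>_sub span_W in auto)
  then have "\<not> (\<forall>U\<in>\<U>. U \<subset> W)" using prim perm by (auto simp: primitive_GL_def)
  then obtain \<alpha> where "?E \<alpha> = W" using E_W by (auto simp: \<U>_def)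
  then show ?thesis using joint_eigenspaceD(2)[of _ W C \<alpha>] by blast
qed

end

section \<open>Invariant Hermitian forms\<close>

text \<open>The ambient type carries no inner product, and the forms in question are sums over a
  finite group of maps meaningful only on \<open>W\<close>; hence axioms relative to
  \<open>W\<close>. Antilinearity in the second argument follows from \<open>ip_cnj\<close>.\<close>

locale hermitian_space = complex_space scale
  for scale :: "complex \<Rightarrow> 'b::ab_group_add \<Rightarrow> 'b" +
  fixes W :: "'b set" and ip :: "'b \<Rightarrow> 'b \<Rightarrow> complex"
  assumes W: "subspace W"
    and ip_add: "\<lbrakk>u \<in> W; v \<in> W; w \<in> W\<rbrakk> \<Longrightarrow> ip (u + v) w = ip u w + ip v w"
    and ip_scale: "\<lbrakk>v \<in> W; w \<in> W\<rbrakk> \<Longrightarrow> ip (scale c v) w = c * ip v w"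
    and ip_cnj: "\<lbrakk>v \<in> W; w \<in> W\<rbrakk> \<Longrightarrow> ip w v = cnj (ip v w)"
    and ip_pos: "\<lbrakk>v \<in> W; v \<noteq> 0\<rbrakk> \<Longrightarrow> Re (ip v v) > 0"
begin

lemma ip_zero: "w \<in> W \<Longrightarrow> ip 0 w = 0"
  using ip_scale[of w w 0] by simp

lemma ip_sum:
  assumes "\<And>i. i \<in> I \<Longrightarrow> f i \<in> W" "w \<in> W"
  shows "ip (sum f I) w = (\<Sum>i\<in>I. ip (f i) w)"
  using assms(1)
proof (induction I rule: infinite_finite_induct)
  case (insert x F)
  then show ?case using assms(2) W by (simp add: ip_add subspace_sum)
qed (use assms ip_zero in auto)

definition orthonormal :: "'b set \<Rightarrow> bool" where
  "orthonormal E \<longleftrightarrow> E \<subseteq> W \<and> (\<forall>e\<in>E. \<forall>f\<in>E. ip e f = (if e = f then 1 else 0))"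

text \<open>For orthonormal \<open>E\<close>, the orthogonal projection onto the span of
  \<open>E\<close>.\<close>

definition fourier :: "'b set \<Rightarrow> 'b \<Rightarrow> 'b" where
  "fourier E v = (\<Sum>e\<in>E. scale (ip v e) e)"

lemma fourier_in: "E \<subseteq> W \<Longrightarrow> fourier E v \<in> W"
  unfolding fourier_def using W by (intro subspace_sum subspace_scale) auto

lemma ip_fourier:
  assumes "finite E" "orthonormal E" "f \<in> E"
  shows "ip (fourier E v) f = ip v f"
proof -
  have EW: "E \<subseteq> W" using assms by (simp add: orthonormal_def)
  have "ip (fourier E v) f = (\<Sum>e\<in>E. ip v e * ip e f)"
    unfolding fourier_def using EW assms W by (subst ip_sum) (auto simp: ip_scale subspace_scale subset_iff intro!: sum.cong)
  also have "\<dots> = (\<Sum>e\<in>E. if e = f then ip v f else 0)"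
    using assms by (intro sum.cong) (auto simp: orthonormal_def)
  also have "\<dots> = ip v f" using assms by simp
  finally show ?thesis .
qed

text \<open>Only an upper bound for the size can be kept, since a vector already in the span of its
  predecessors contributes nothing.\<close>

lemma gram_schmidt:
  assumes "finite S" "S \<subseteq> W"
  shows "\<exists>E. finite E \<and> card E \<le> card S \<and> orthonormal E \<and> span E = span S"
  using assms
proof (induction S rule: finite_induct)
  case empty
  then show ?case by (intro exI[of _ "{}"]) (auto simp: orthonormal_def)
next
  case (insert x S)
  then obtain E where E: "finite E" "card E \<le> card S" "orthonormal E" "span E = span S" by auto
  have EW: "E \<subseteq> W" and xW: "x \<in> W" using E insert by (auto simp: orthonormal_def)
  define y where "y = x - fourier E x"
  have yW: "y \<in> W" unfolding y_def using W xW fourier_in[OF EW] by (rule subspace_diff)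
  have four: "fourier E x \<in> span E"
    unfolding fourier_def by (intro span_sum span_scale span_base)
  have ip_y: "ip y f = 0" if "f \<in> E" for f
  proof -
    have "ip x f = ip y f + ip (fourier E x) f"
      using ip_add[of y "fourier E x" f] yW fourier_in[OF EW] that EW by (auto simp: y_def)
    then show ?thesis using ip_fourier[OF E(1,3) that] by simp
  qed
  show ?case
  proof (cases "y = 0")
    case True
    then have "x \<in> span S" using four E by (simp add: y_def)
    then have "span (insert x S) = span S" by (rule span_redundant)
    then show ?thesis using E insert by (intro exI[of _ E]) auto
  next
    case False
    define a where "a = Re (ip y y)"
    have a: "a > 0" using ip_pos yW False by (simp add: a_def)
    have ipyy: "ip y y = of_real a"
    proof -
      have "Im (ip y y) = 0" using arg_cong[OF ip_cnj[OF yW yW], of Im] by simp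
      then show ?thesis by (simp add: a_def complex_eq_iff)
    qed
    define z where "z = scale (of_real (1 / sqrt a)) y"
    have zW: "z \<in> W" unfolding z_def using W yW by (rule subspace_scale)
    have zz: "ip z z = 1"
    proof -
      have "ip z z = of_real (1 / sqrt a) * cnj (of_real (1 / sqrt a) * ip y y)"
        using yW zW by (simp add: z_def ip_scale ip_cnj[of "scale _ y" y])
      also have "\<dots> = of_real (1 / sqrt a * (1 / sqrt a) * a)"
        unfolding ipyy by (simp only: complex_cnj_mult complex_cnj_complex_of_real of_real_mult mult.assoc)
      also have "1 / sqrt a * (1 / sqrt a) * a = 1" using a by (simp add: field_simps)
      finally show ?thesis by simp
    qed
    have zf: "ip z f = 0 \<and> ip f z = 0" if "f \<in> E" for f
    proof -
      have "ip z f = 0" using ip_y[OF that] that EW yW by (auto simp: z_def ip_scale)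
      then show ?thesis using ip_cnj[of z f] zW EW that by auto
    qed
    have yz: "y = scale (of_real (sqrt a)) z" using a by (simp add: z_def flip: of_real_mult)
    have xyz: "x = scale (of_real (sqrt a)) z + fourier E x" using yz unfolding y_def by (simp only: diff_eq_eq)
    have span: "span (insert z E) = span (insert x S)"
    proof (rule span_eq[THEN iffD2], intro conjI)
      have "z \<in> span (insert x S)"
      proof -
        have "fourier E x \<in> span (insert x S)"
          using four E(4) span_mono[of S "insert x S"] by auto
        then have "y \<in> span (insert x S)" unfolding y_def by (intro span_diff[OF span_base]) auto
        then show ?thesis unfolding z_def by (rule span_scale)
      qed
      moreover have "E \<subseteq> span (insert x S)"
        using span_superset[of E] E(4) span_mono[of S "insert x S"] by auto
      ultimately show "insert z E \<subseteq> span (insert x S)" by auto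
      have "x \<in> span (insert z E)"
      proof -
        have "fourier E x \<in> span (insert z E)"
          using four span_mono[of E "insert z E"] by auto
        moreover have "scale (of_real (sqrt a)) z \<in> span (insert z E)"
          by (intro span_scale span_base) auto
        ultimately show ?thesis using xyz span_add by metis
      qed
      moreover have "S \<subseteq> span (insert z E)"
        using span_superset[of S] E(4) span_mono[of E "insert z E"] by auto
      ultimately show "insert x S \<subseteq> span (insert z E)" by auto
    qed
    have "z \<notin> E" using zf zz by force
    then show ?thesis using E insert span zf zz zW
      by (intro exI[of _ "insert z E"]) (auto simp: orthonormal_def)
  qed
qed

text \<open>The difference of \<open>v\<close> and its projection lies in the span of
  \<open>E\<close> and is orthogonal to \<open>E\<close>, hence orthogonal to itself.\<close>

lemma fourier_id:
  assumes E: "finite E" "orthonormal E" and v: "v \<in> W" "v \<in> span E"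
  shows "fourier E v = v"
proof -
  have EW: "E \<subseteq> W" using E by (simp add: orthonormal_def)
  define y where "y = v - fourier E v"
  have yW: "y \<in> W" unfolding y_def using W v(1) fourier_in[OF EW] by (rule subspace_diff)
  have "fourier E v \<in> span E"
    unfolding fourier_def by (intro span_sum span_scale span_base)
  then have "y \<in> span E" unfolding y_def using v by (intro span_diff)
  then obtain r where r: "y = (\<Sum>e\<in>E. scale (r e) e)" using E by (auto simp: span_finite)
  have ip_y: "ip f y = 0" if "f \<in> E" for f
  proof -
    have fW: "f \<in> W" using that EW by auto
    have "ip v f = ip y f + ip (fourier E v) f"
      using ip_add[of y "fourier E v" f] yW fourier_in[OF EW] fW by (auto simp: y_def)
    then have "ip y f = 0" using ip_fourier[OF E that] by simp
    then show ?thesis using ip_cnj[OF yW fW] by simp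
  qed
  have "ip y y = (\<Sum>e\<in>E. r e * ip e y)"
  proof -
    have "ip (\<Sum>e\<in>E. scale (r e) e) y = (\<Sum>e\<in>E. r e * ip e y)"
      using yW EW W by (subst ip_sum) (auto simp: subset_iff subspace_scale ip_scale intro!: sum.cong)
    then show ?thesis using r by simp
  qed
  then have "ip y y = 0" using ip_y by simp
  then have "y = 0" using ip_pos[OF yW] by fastforce
  then show ?thesis by (simp add: y_def)
qed

lemma parseval:
  assumes E: "finite E" "orthonormal E" "W \<subseteq> span E" and v: "v \<in> W"
  shows "(\<Sum>e\<in>E. (cmod (ip v e))\<^sup>2) = Re (ip v v)"
proof -
  have EW: "E \<subseteq> W" using E by (simp add: orthonormal_def)
  have "ip v v = ip (fourier E v) v" using fourier_id[OF E(1,2) v] v E by auto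
  also have "\<dots> = (\<Sum>e\<in>E. ip v e * ip e v)"
    unfolding fourier_def using v EW W
    by (subst ip_sum) (auto simp: subset_iff subspace_scale ip_scale intro!: sum.cong)
  also have "\<dots> = (\<Sum>e\<in>E. of_real ((cmod (ip v e))\<^sup>2))"
  proof (rule sum.cong[OF refl])
    fix e assume "e \<in> E"
    then have "ip e v = cnj (ip v e)" using EW v by (intro ip_cnj) auto
    then show "ip v e * ip e v = of_real ((cmod (ip v e))\<^sup>2)" by (simp only: complex_norm_square)
  qed
  finally show ?thesis by simp
qed

end

context complex_space
begin

text \<open>Weyl's unitary trick: the standard form in some basis, summed over the group, is
  invariant and still positive, and an orthonormal basis for it supplies the coordinates. The result
  is phrased through coordinates because the norm estimates need nothing else of the form.\<close>

lemma invariant_coordinates: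
  assumes K: "subgroup K (GL W)" "finite K" and W: "subspace W" and B: "finite B" "W = span B"
  shows "\<exists>E c. finite E \<and> card E \<le> card B \<and> E \<subseteq> W \<and>
     (\<forall>v\<in>W. \<forall>w\<in>W. \<forall>e\<in>E. c e (v + w) = c e v + c e w) \<and>
     (\<forall>v\<in>W. \<forall>a. \<forall>e\<in>E. c e (scale a v) = a * c e v) \<and>
     (\<forall>v\<in>W. v = (\<Sum>e\<in>E. scale (c e v) e)) \<and>
     (\<forall>e\<in>E. \<forall>f\<in>E. c f e = (if e = f then 1 else 0)) \<and>
     (\<forall>g\<in>K. \<forall>v\<in>W. (\<Sum>e\<in>E. (cmod (c e (g v)))\<^sup>2) = (\<Sum>e\<in>E. (cmod (c e v))\<^sup>2))"
proof -
  interpret group "GL W" by (rule group_GL) fact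
  have KG: "g \<in> carrier (GL W)" if "g \<in> K" for g using that K subgroup.mem_carrier by metis
  obtain B' where B': "B' \<subseteq> B" "independent B'" "span B' = span B"
    using maximal_independent_subset[of B] span_mono[of _ B] span_eq by (metis span_subspace subspace_span span_superset)
  have finB': "finite B'" using B' B finite_subset by metis
  have cardB': "card B' \<le> card B" using B' B card_mono by metis
  have B'W: "B' \<subseteq> W" using B' B span_superset by blast
  have WB': "v \<in> span B'" if "v \<in> W" for v using that B' B by simp
  define co where "co b v = representation B' v b" for b v
  have co_add: "co b (v + w) = co b v + co b w" if "v \<in> W" "w \<in> W" for b v w
    using that WB' B' by (simp add: co_def representation_add)
  have co_scale: "co b (scale a v) = a * co b v" if "v \<in> W" for b v a
    using that WB' B' by (simp add: co_def representation_scale)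
  have co_sum: "v = (\<Sum>b\<in>B'. scale (co b v) b)" if "v \<in> W" for v
    using sum_representation_eq[OF B'(2) WB'[OF that] finB' order.refl] by (simp add: co_def)
  define ip where "ip v w = (\<Sum>g\<in>K. \<Sum>b\<in>B'. co b (g v) * cnj (co b (g w)))" for v w
  interpret H: hermitian_space scale W ip
  proof
    show "subspace W" by fact
  next
    fix u v w assume "u \<in> W" "v \<in> W" "w \<in> W"
    then show "ip (u + v) w = ip u w + ip v w"
      using KG GL_closed by (simp add: ip_def GL_add[of _ W] co_add sum.distrib distrib_right)
  next
    fix v w c assume "v \<in> W" "w \<in> W"
    then show "ip (scale c v) w = c * ip v w"
      using KG GL_closed by (simp add: ip_def GL_scale[of _ W] co_scale sum_distrib_left mult.assoc)
  next
    fix v w assume "v \<in> W" "w \<in> W"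
    then show "ip w v = cnj (ip v w)" by (simp add: ip_def mult.commute)
  next
    fix v assume v: "v \<in> W" "v \<noteq> 0"
    have re: "Re (ip v v) = (\<Sum>g\<in>K. \<Sum>b\<in>B'. (cmod (co b (g v)))\<^sup>2)"
      by (simp add: ip_def complex_norm_square[symmetric] flip: of_real_power of_real_sum)
    have "\<exists>b\<in>B'. co b v \<noteq> 0"
    proof (rule ccontr)
      assume "\<not> ?thesis"
      then have "(\<Sum>b\<in>B'. scale (co b v) b) = 0" by simp
      then show False using co_sum[OF v(1)] v by simp
    qed
    then obtain b where b: "b \<in> B'" "co b v \<noteq> 0" by blast
    \<comment> \<open>The summand of the identity is already positive, and all other summands are
      non-negative.\<close>
    have one: "\<one>\<^bsub>GL W\<^esub> \<in> K" using K subgroup.one_closed by metis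
    have "0 < (cmod (co b (\<one>\<^bsub>GL W\<^esub> v)))\<^sup>2" using b v by (simp add: GL_one)
    also have "\<dots> \<le> (\<Sum>b\<in>B'. (cmod (co b (\<one>\<^bsub>GL W\<^esub> v)))\<^sup>2)"
      using b finB' by (intro member_le_sum) auto
    also have "\<dots> \<le> (\<Sum>g\<in>K. \<Sum>b\<in>B'. (cmod (co b (g v)))\<^sup>2)"
      using one K by (intro member_le_sum[where f = "\<lambda>g. \<Sum>b\<in>B'. (cmod (co b (g v)))\<^sup>2"]) (auto intro: sum_nonneg)
    finally show "Re (ip v v) > 0" using re by simp
  qed
  have inv: "ip (h v) (h v) = ip v v" if h: "h \<in> K" and v: "v \<in> W" for h v
  proof -
    have bij: "bij_betw (\<lambda>g. g \<otimes>\<^bsub>GL W\<^esub> h) K K"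
    proof (rule bij_betw_byWitness[where f' = "\<lambda>g. g \<otimes>\<^bsub>GL W\<^esub> inv\<^bsub>GL W\<^esub> h"])
    qed (use h K KG in \<open>auto simp: m_assoc subgroup.m_closed subgroup.m_inv_closed\<close>)
    have "ip v v = (\<Sum>g\<in>K. \<Sum>b\<in>B'. co b ((g \<otimes>\<^bsub>GL W\<^esub> h) v) * cnj (co b ((g \<otimes>\<^bsub>GL W\<^esub> h) v)))"
      unfolding ip_def by (rule sum.reindex_bij_betw[OF bij, symmetric])
    also have "\<dots> = ip (h v) (h v)"
      unfolding ip_def using h v KG by (intro sum.cong refl) (simp add: GL_mult_apply)
    finally show ?thesis by simp
  qed
  obtain E where E: "finite E" "card E \<le> card B'" "H.orthonormal E" "span E = span B'"
    using H.gram_schmidt[OF finB' B'W] by blast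
  have EW: "E \<subseteq> W" using E by (simp add: H.orthonormal_def)
  have WE: "W \<subseteq> span E" using WB' E by auto
  show ?thesis
  proof (intro exI[of _ E] exI[of _ "\<lambda>e v. ip v e"] conjI ballI allI)
    fix v assume "v \<in> W"
    then show "v = (\<Sum>e\<in>E. scale (ip v e) e)"
      using H.fourier_id[OF E(1,3), of v] WE by (auto simp: H.fourier_def)
  next
    fix g v assume "g \<in> K" "v \<in> W"
    then show "(\<Sum>e\<in>E. (cmod (ip (g v) e))\<^sup>2) = (\<Sum>e\<in>E. (cmod (ip v e))\<^sup>2)"
      using H.parseval[OF E(1,3) WE] GL_closed[OF KG] inv by simp
  qed (use E EW cardB' in \<open>auto simp: H.ip_add H.ip_scale subset_iff H.orthonormal_def\<close>)
qed

end

section \<open>Jordan's theorem for primitive groups\<close>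

text \<open>Coordinates in an orthonormal basis \<open>E\<close> of an invariant Hermitian form, so
  that \<open>K\<close> acts by isometries of the Euclidean norm \<open>nrm\<close> below.\<close>

locale invariant_norm = complex_space scale
  for scale :: "complex \<Rightarrow> 'b::ab_group_add \<Rightarrow> 'b" +
  fixes W :: "'b set" and K :: "('b \<Rightarrow> 'b) set" and E :: "'b set" and c :: "'b \<Rightarrow> 'b \<Rightarrow> complex"
  assumes W: "subspace W" and K: "subgroup K (GL W)" and finK: "finite K"
    and E: "finite E" "E \<subseteq> W"
    and c_add: "\<lbrakk>v \<in> W; w \<in> W; e \<in> E\<rbrakk> \<Longrightarrow> c e (v + w) = c e v + c e w"
    and c_scale: "\<lbrakk>v \<in> W; e \<in> E\<rbrakk> \<Longrightarrow> c e (scale a v) = a * c e v"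
    and c_expand: "v \<in> W \<Longrightarrow> v = (\<Sum>e\<in>E. scale (c e v) e)"
    and c_delta: "\<lbrakk>e \<in> E; f \<in> E\<rbrakk> \<Longrightarrow> c f e = (if e = f then 1 else 0)"
    and c_invariant: "\<lbrakk>g \<in> K; v \<in> W\<rbrakk> \<Longrightarrow> (\<Sum>e\<in>E. (cmod (c e (g v)))\<^sup>2) = (\<Sum>e\<in>E. (cmod (c e v))\<^sup>2)"
begin

sublocale G: group "GL W" by (rule group_GL) (rule W)

abbreviation mul (infixl "\<cdot>" 70) where "g \<cdot> h \<equiv> g \<otimes>\<^bsub>GL W\<^esub> h"
abbreviation ginv where "ginv \<equiv> m_inv (GL W)"

lemma K_GL: "g \<in> K \<Longrightarrow> g \<in> carrier (GL W)"
  using K subgroup.mem_carrier by metis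

lemmas K_closed = GL_closed[OF K_GL]
lemmas K_inv = subgroup.m_inv_closed[OF K]
lemmas K_mult = subgroup.m_closed[OF K]

definition nrm :: "'b \<Rightarrow> real" where
  "nrm v = L2_set (\<lambda>e. cmod (c e v)) E"

lemma c_diff:
  assumes "v \<in> W" "w \<in> W" "e \<in> E"
  shows "c e (v - w) = c e v - c e w"
  using c_add[of "v - w" w e] assms W by (simp add: subspace_diff)

lemma nrm_nonneg: "nrm v \<ge> 0" by (simp add: nrm_def)

lemma nrm_scale: "v \<in> W \<Longrightarrow> nrm (scale a v) = cmod a * nrm v"
  unfolding nrm_def by (subst L2_set_right_distrib) (auto simp: c_scale norm_mult intro!: L2_set_cong)

lemma nrm_eq_0_iff:
  assumes "v \<in> W"
  shows "nrm v = 0 \<longleftrightarrow> v = 0"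
proof
  assume "nrm v = 0"
  then have "\<forall>e\<in>E. c e v = 0" using E by (simp add: nrm_def L2_set_eq_0_iff)
  then show "v = 0" using c_expand[OF assms] by simp
next
  assume "v = 0"
  then show "nrm v = 0" using nrm_scale[of v 0] assms by simp
qed

lemma nrm_triangle:
  assumes "v \<in> W" "w \<in> W"
  shows "nrm (v + w) \<le> nrm v + nrm w"
proof -
  have "nrm (v + w) \<le> L2_set (\<lambda>e. cmod (c e v) + cmod (c e w)) E"
    unfolding nrm_def using assms by (intro L2_set_mono) (auto simp: c_add norm_triangle_ineq)
  also have "\<dots> \<le> nrm v + nrm w" unfolding nrm_def by (rule L2_set_triangle_ineq)
  finally show ?thesis .
qed

lemma nrm_minus: "v \<in> W \<Longrightarrow> nrm (- v) = nrm v"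
  using nrm_scale[of v "-1"] by simp

lemma nrm_diff:
  assumes "v \<in> W" "w \<in> W"
  shows "nrm (v - w) \<le> nrm v + nrm w"
  using nrm_triangle[of v "- w"] nrm_minus[of w] assms W by (simp add: subspace_neg)

lemma nrm_invariant: "g \<in> K \<Longrightarrow> v \<in> W \<Longrightarrow> nrm (g v) = nrm v"
  by (simp add: nrm_def L2_set_def c_invariant)

text \<open>In terms of operator norms: \<open>g - 1\<close> has norm at most
  \<open>\<epsilon>\<close>.\<close>

definition near_id :: "real \<Rightarrow> ('b \<Rightarrow> 'b) \<Rightarrow> bool" where
  "near_id \<epsilon> g \<longleftrightarrow> (\<forall>v\<in>W. nrm (g v - v) \<le> \<epsilon> * nrm v)"

definition scalar :: "('b \<Rightarrow> 'b) \<Rightarrow> bool" where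
  "scalar g \<longleftrightarrow> (\<exists>a. \<forall>w\<in>W. g w = scale a w)"

lemma near_id_conj:
  assumes x: "x \<in> K" and h: "h \<in> K" and near: "near_id \<epsilon> h"
  shows "near_id \<epsilon> (x \<cdot> h \<cdot> ginv x)"
  unfolding near_id_def
proof
  fix v assume v: "v \<in> W"
  define u where "u = (ginv x) v"
  have u: "u \<in> W" "x u = v" using v x K_closed[OF K_inv[OF x]] GL_inv_apply(2)[OF W K_GL[OF x]] by (auto simp: u_def)
  have "(x \<cdot> h \<cdot> ginv x) v = x (h u)"
    using x h v u K_GL by (simp add: GL_mult_apply u_def)
  then have "nrm ((x \<cdot> h \<cdot> ginv x) v - v) = nrm (x (h u - u))"
    using u x h K_closed K_GL by (simp add: GL_diff[OF _ W])
  also have "\<dots> = nrm (h u - u)"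
    using nrm_invariant[OF x] u h K_closed W by (simp add: subspace_diff)
  also have "\<dots> \<le> \<epsilon> * nrm u" using near u by (simp add: near_id_def)
  also have "nrm u = nrm v" using nrm_invariant[OF x u(1)] u by simp
  finally show "nrm ((x \<cdot> h \<cdot> ginv x) v - v) \<le> \<epsilon> * nrm v" .
qed

text \<open>With \<open>v = h (g u)\<close> the difference is
  \<open>(g - 1) ((h - 1) u) - (h - 1) ((g - 1) u)\<close>, and \<open>u\<close> has the same norm
  as \<open>v\<close>. That the two distances get multiplied is what makes commutators
  contract.\<close>

lemma near_id_commutator:
  assumes g: "g \<in> K" "near_id a g" and h: "h \<in> K" "near_id b h" and ab: "a \<ge> 0" "b \<ge> 0"
  shows "near_id (2 * a * b) (g \<cdot> h \<cdot> ginv (h \<cdot> g))"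
  unfolding near_id_def
proof
  fix v assume v: "v \<in> W"
  have hg: "h \<cdot> g \<in> K" using g h K_mult by simp
  define u where "u = (ginv (h \<cdot> g)) v"
  have u: "u \<in> W" "(h \<cdot> g) u = v"
    using v K_closed[OF K_inv[OF hg]] GL_inv_apply(2)[OF W K_GL[OF hg]] by (auto simp: u_def)
  have nu: "nrm u = nrm v" using nrm_invariant[OF hg u(1)] u by simp
  have hgu: "h (g u) = v" using u g h K_GL by (simp add: GL_mult_apply)
  have in_W': "g u \<in> W" "h u \<in> W" "g u - u \<in> W" "h u - u \<in> W"
    using u g h K_closed W by (auto intro: subspace_diff)
  then have in_W: "g u \<in> W" "h u \<in> W" "g u - u \<in> W" "h u - u \<in> W" "g (h u - u) \<in> W" "h (g u - u) \<in> W"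
    using g h K_closed by auto
  have "(g \<cdot> h \<cdot> ginv (h \<cdot> g)) v = g (h u)"
    using g h v u hg K_GL by (simp add: GL_mult_apply u_def)
  then have "(g \<cdot> h \<cdot> ginv (h \<cdot> g)) v - v
      = (g (h u - u) - (h u - u)) - (h (g u - u) - (g u - u))"
    using u g h K_GL in_W hgu by (simp add: GL_diff[OF _ W])
  then have "nrm ((g \<cdot> h \<cdot> ginv (h \<cdot> g)) v - v)
      \<le> nrm (g (h u - u) - (h u - u)) + nrm (h (g u - u) - (g u - u))"
    using nrm_diff[of "g (h u - u) - (h u - u)" "h (g u - u) - (g u - u)"] in_W W by (simp add: subspace_diff)
  also have "\<dots> \<le> a * nrm (h u - u) + b * nrm (g u - u)"
    using g h in_W by (intro add_mono) (auto simp: near_id_def)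
  also have "\<dots> \<le> a * (b * nrm u) + b * (a * nrm u)"
    using g h u ab by (intro add_mono mult_left_mono) (auto simp: near_id_def)
  finally show "nrm ((g \<cdot> h \<cdot> ginv (h \<cdot> g)) v - v) \<le> 2 * a * b * nrm v"
    by (simp add: nu)
qed

text \<open>The operator norm of \<open>g - 1\<close>, a single number that can be minimised over a
  finite set. The premise \<open>near_id a g\<close> in the lemmas about it keeps the infimum from
  being taken over the empty set.\<close>

definition opdist :: "('b \<Rightarrow> 'b) \<Rightarrow> real" where
  "opdist g = Inf {a. 0 \<le> a \<and> near_id a g}"

lemma opdist_nonneg: "near_id a g \<Longrightarrow> 0 \<le> a \<Longrightarrow> opdist g \<ge> 0"
  unfolding opdist_def by (intro cInf_greatest) auto

lemma opdist_le: "near_id a g \<Longrightarrow> 0 \<le> a \<Longrightarrow> opdist g \<le> a"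
  unfolding opdist_def by (intro cInf_lower) (auto intro!: bdd_belowI[of _ 0])

text \<open>The infimum is attained: for each fixed non-zero \<open>v\<close> the quotient
  \<open>nrm (g v - v) / nrm v\<close> is a lower bound of all admissible constants.\<close>

lemma near_id_opdist:
  assumes g: "g \<in> K" and "near_id a g" "0 \<le> a"
  shows "near_id (opdist g) g"
  unfolding near_id_def
proof
  fix v assume v: "v \<in> W"
  show "nrm (g v - v) \<le> opdist g * nrm v"
  proof (cases "v = 0")
    case True
    then show ?thesis using GL_zero[OF K_GL[OF g] W] nrm_eq_0_iff[of 0] subspace_0[OF W] by simp
  next
    case False
    then have pos: "nrm v > 0" using nrm_eq_0_iff[OF v] nrm_nonneg[of v] by simp
    have "nrm (g v - v) / nrm v \<le> opdist g"
      unfolding opdist_def using assms v pos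
      by (intro cInf_greatest) (auto simp: near_id_def divide_simps)
    then show ?thesis using pos by (simp add: divide_simps)
  qed
qed

text \<open>Iterating the relation gives \<open>g^i h = l^i h g^i\<close>. The finite order of
  \<open>g\<close> makes \<open>l\<close> a root of unity, and the closeness of \<open>h\<close> to
  1 keeps all powers of \<open>l\<close> within 1/2 of 1. But the powers of a root of unity other
  than 1 add up to 0 over a period, which is impossible so close to 1.\<close>

lemma scalar_commutator_trivial:
  assumes g: "g \<in> K" and h: "h \<in> K" "near_id (1/4) h" and W0: "W \<noteq> {0}"
    and l: "\<And>u. u \<in> W \<Longrightarrow> g (h u) = scale l (h (g u))"
  shows "l = 1"
proof (rule ccontr)
  assume "l \<noteq> 1"
  obtain n where n: "n > 0" "\<And>w. w \<in> W \<Longrightarrow> (g ^^ n) w = w"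
    using subgroup_GL_finite_order[OF W K finK g] by blast
  obtain w where w: "w \<in> W" "w \<noteq> 0" using W0 subspace_0[OF W] by auto
  have nw: "nrm w > 0" using nrm_eq_0_iff[OF w(1)] w nrm_nonneg[of w] by simp
  have gi_W: "(g ^^ i) u \<in> W" if "u \<in> W" for u i
    by (induction i) (use that K_closed[OF g] in auto)
  have gi_nrm: "nrm ((g ^^ i) u) = nrm u" if "u \<in> W" for u i
    by (induction i) (use that gi_W nrm_invariant[OF g] in auto)
  have gi_diff: "(g ^^ i) (u - v) = (g ^^ i) u - (g ^^ i) v" if "u \<in> W" "v \<in> W" for u v i
    by (induction i) (use that gi_W GL_diff[OF K_GL[OF g] W] in auto)
  have hW: "h u \<in> W" if "u \<in> W" for u using K_closed[OF h(1)] that by simp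
  have gi_h: "(g ^^ i) (h u) = scale (l ^ i) (h ((g ^^ i) u))" if u: "u \<in> W" for u i
    by (induction i) (use u gi_W hW l GL_scale[OF K_GL[OF g]] in \<open>auto simp: mult.commute\<close>)
  have "scale (l ^ n) (h w) = scale 1 (h w)" using gi_h[OF w(1), of n] n w hW by simp
  moreover have "h w \<noteq> 0"
    using w GL_inj[OF K_GL[OF h(1)], of w 0] GL_zero[OF K_GL[OF h(1)] W] subspace_0[OF W] by simp
  ultimately have ln: "l ^ n = 1" by (metis scale_right_imp_eq)
  \<comment> \<open>The radius 1/2 is 1/4 + 1/4: with \<open>v = (g ^^ i) w\<close>, both
    \<open>(g ^^ i) (h w)\<close> and \<open>h v\<close> are within a quarter of the norm of
    \<open>w\<close> from \<open>v\<close>.\<close>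
  have close: "cmod (l ^ i - 1) \<le> 1/2" for i
  proof -
    define v where "v = (g ^^ i) w"
    have v: "v \<in> W" "nrm v = nrm w" using gi_W gi_nrm w by (auto simp: v_def)
    have "scale (l ^ i - 1) (h v) = ((g ^^ i) (h w) - v) - (h v - v)"
      using gi_h[OF w(1), of i] by (simp add: v_def scale_left_diff_distrib)
    then have "nrm (scale (l ^ i - 1) (h v)) \<le> nrm ((g ^^ i) (h w) - v) + nrm (h v - v)"
      using nrm_diff[of "(g ^^ i) (h w) - v" "h v - v"] gi_W[OF hW[OF w(1)]] v hW W by (simp add: subspace_diff)
    also have "nrm ((g ^^ i) (h w) - v) = nrm (h w - w)"
      using gi_diff[OF hW[OF w(1)] w(1), of i] gi_nrm[of "h w - w" i] w hW W by (simp add: v_def subspace_diff)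
    also have "nrm (h w - w) + nrm (h v - v) \<le> 1/4 * nrm w + 1/4 * nrm v"
      using h w v unfolding near_id_def by (intro add_mono) auto
    finally have "cmod (l ^ i - 1) * nrm w \<le> 1/2 * nrm w"
      using v hW nrm_invariant[OF h(1)] by (simp add: nrm_scale)
    then show ?thesis using nw by simp
  qed
  have "real n = cmod (\<Sum>i<n. l ^ i - 1)"
    using sum_powers_root_of_unity[OF ln \<open>l \<noteq> 1\<close>] by (simp add: sum_subtractf)
  also have "\<dots> \<le> (\<Sum>i<n. 1/2)" by (rule sum_norm_le) (rule close)
  finally show False using n by simp
qed

text \<open>If some non-scalar element were this close to the identity, take one at minimal distance:
  its commutator with any other close element is closer still, hence scalar, hence trivial. So the
  conjugates of the minimal element commute, and primitivity makes them scalar.\<close>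

lemma near_id_scalar:
  assumes prim: "primitive_GL W K" and g: "g \<in> K" "near_id (1/4) g"
  shows "scalar g"
proof (rule ccontr)
  assume "\<not> scalar g"
  define Bad where "Bad = {g \<in> K. near_id (1/4) g \<and> \<not> scalar g}"
  have W0: "W \<noteq> {0}" using prim by (auto simp: primitive_GL_def irreducible_action_def)
  have "finite Bad" using finK by (simp add: Bad_def)
  moreover have "Bad \<noteq> {}" using g \<open>\<not> scalar g\<close> by (auto simp: Bad_def)
  ultimately obtain b where b: "b \<in> Bad" "\<And>x. x \<in> Bad \<Longrightarrow> opdist b \<le> opdist x"
    using ex_is_arg_min_if_finite[of Bad opdist] by (auto simp: is_arg_min_linorder)
  \<comment> \<open>Membership in \<open>Bad\<close> at distance at most that of \<open>b\<close>,
    and not just \<open>x = b\<close>, because the conjugates of \<open>b\<close> are to be inserted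
    for \<open>x\<close>.\<close>
  have comm: "x (h u) = h (x u)"
    if x: "x \<in> Bad" "opdist x \<le> opdist b" and h: "h \<in> K" "near_id (1/4) h" and u: "u \<in> W" for x h u
  proof -
    have xK: "x \<in> K" "near_id (1/4) x" "\<not> scalar x" using x by (auto simp: Bad_def)
    have nx: "near_id (opdist x) x" using near_id_opdist[OF xK(1,2)] by simp
    have pos: "opdist x > 0"
    proof (rule ccontr)
      assume "\<not> ?thesis"
      then have "opdist x = 0" using opdist_nonneg[OF xK(2)] by simp
      then have "x w = w" if "w \<in> W" for w
        using nx that nrm_eq_0_iff[of "x w - w"] nrm_nonneg[of "x w - w"] K_closed[OF xK(1)] W
        by (auto simp: near_id_def subspace_diff)
      then have "scalar x" unfolding scalar_def by (intro exI[of _ 1]) simp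
      then show False using xK by simp
    qed
    let ?y = "x \<cdot> h \<cdot> ginv (h \<cdot> x)"
    have yK: "?y \<in> K" using xK h K_mult K_inv by simp
    \<comment> \<open>The origin of the constant 1/4: twice \<open>opdist x\<close> times 1/4 is
      half of \<open>opdist x\<close>.\<close>
    have ny: "near_id (opdist x / 2) ?y"
      using near_id_commutator[OF xK(1) nx h] pos by simp
    have "opdist x \<le> 1/4" using opdist_le[OF xK(2)] by simp
    then have "near_id (1/4) ?y" 
      using ny nrm_nonneg pos unfolding near_id_def
      by (smt (verit) mult_right_mono field_sum_of_halves)
    moreover have "opdist ?y < opdist b" using opdist_le[OF ny] pos x by simp
    ultimately have "scalar ?y" using b(2)[of ?y] yK by (auto simp: Bad_def)
    then obtain l where l: "\<And>w. w \<in> W \<Longrightarrow> ?y w = scale l w" by (auto simp: scalar_def)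
    have eq: "x (h w) = scale l (h (x w))" if w: "w \<in> W" for w
    proof -
      have "?y \<cdot> (h \<cdot> x) = x \<cdot> h"
        using xK h K_GL by (simp add: G.m_assoc)
      then have "?y (h (x w)) = x (h w)"
        using GL_mult_apply[OF K_GL[OF yK] K_GL[OF K_mult[OF h(1) xK(1)]] w]
          GL_mult_apply[OF K_GL[OF h(1)] K_GL[OF xK(1)] w] GL_mult_apply[OF K_GL[OF xK(1)] K_GL[OF h(1)] w]
        by simp
      then show ?thesis using l[OF K_closed[OF h(1) K_closed[OF xK(1) w]]] by simp
    qed
    have "l = 1" by (rule scalar_commutator_trivial[OF xK(1) h W0 eq])
    then show ?thesis using eq[OF u] by (simp only: scale_one)
  qed
  define C where "C = (\<lambda>x. x \<cdot> b \<cdot> ginv x) ` K"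
  have bK: "b \<in> K" "near_id (1/4) b" "\<not> scalar b" using b by (auto simp: Bad_def)
  have CK: "C \<subseteq> K" using bK K_mult K_inv by (auto simp: C_def)
  have C_Bad: "z \<in> Bad \<and> opdist z \<le> opdist b" if "z \<in> C" for z
  proof -
    obtain x where x: "x \<in> K" and z: "z = x \<cdot> b \<cdot> ginv x"
      using \<open>z \<in> C\<close> by (auto simp: C_def)
    have "near_id (1/4) z" "near_id (opdist b) z"
      using near_id_conj[OF x bK(1)] bK near_id_opdist[OF bK(1,2)] by (auto simp: z)
    moreover have "\<not> scalar z"
    proof
      assume "scalar z"
      then obtain a where a: "\<And>w. w \<in> W \<Longrightarrow> z w = scale a w" by (auto simp: scalar_def)
      have "b w = scale a w" if w: "w \<in> W" for w
      proof -
        have "z \<cdot> x = x \<cdot> b" using x bK K_GL by (simp add: z G.m_assoc)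
        moreover have "z \<in> carrier (GL W)" using x bK K_GL by (simp add: z)
        ultimately have "x (b w) = z (x w)"
          using GL_mult_apply[OF _ K_GL[OF x] w, of z] GL_mult_apply[OF K_GL[OF x] K_GL[OF bK(1)] w] by simp
        also have "\<dots> = x (scale a w)" using a w x K_closed GL_scale[OF K_GL[OF x]] by simp
        finally show ?thesis
          using GL_inj[OF K_GL[OF x]] w K_closed[OF bK(1)] W by (simp add: subspace_scale)
      qed
      then show False using bK by (auto simp: scalar_def)
    qed
    ultimately show ?thesis using that CK opdist_le opdist_nonneg[OF bK(2)] by (auto simp: Bad_def)
  qed
  have "\<exists>\<alpha>. \<forall>g\<in>C. \<forall>w\<in>W. g w = scale (\<alpha> g) w"
  proof (rule commuting_class_scalar[OF prim CK])
    fix z z' w assume "z \<in> C" "z' \<in> C" "w \<in> W"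
    then show "z (z' w) = z' (z w)" using comm C_Bad CK by (auto simp: Bad_def)
  next
    fix y z assume y: "y \<in> K" and "z \<in> C"
    then obtain x where x: "x \<in> K" and z: "z = x \<cdot> b \<cdot> ginv x"
      by (auto simp: C_def)
    let ?z = "(y \<cdot> x) \<cdot> b \<cdot> ginv (y \<cdot> x)"
    have "?z \<in> C" unfolding C_def using y x K_mult by (intro imageI) simp
    moreover have zy: "?z \<cdot> y = y \<cdot> z"
      using x y bK K_GL by (simp add: z G.m_assoc G.inv_mult_group)
    have "y (z w) = ?z (y w)" if w: "w \<in> W" for w
    proof -
      have G: "?z \<in> carrier (GL W)" "y \<in> carrier (GL W)" "z \<in> carrier (GL W)"
        using y \<open>?z \<in> C\<close> \<open>z \<in> C\<close> CK K_GL by blast+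
      show ?thesis
        using arg_cong[OF zy, of "\<lambda>f. f w"] GL_mult_apply[OF G(1,2) w] GL_mult_apply[OF G(2,3) w] by (simp only:)
    qed
    ultimately show "\<exists>h\<in>C. \<forall>w\<in>W. y (z w) = h (y w)" by blast
  qed
  moreover have "b \<in> C"
  proof -
    have "b = \<one>\<^bsub>GL W\<^esub> \<cdot> b \<cdot> ginv \<one>\<^bsub>GL W\<^esub>" using bK K_GL by simp
    then show ?thesis unfolding C_def using subgroup.one_closed[OF K] by (rule image_eqI)
  qed
  ultimately show False using bK by (auto simp: scalar_def)
qed

text \<open>The mesh is chosen so that agreement of all matrix entries up to \<open>2 / grid\<close> forces a distance of
  at most \<open>2 * (card E)\<^sup>2 / grid \<le> 1 / 4\<close>.\<close>

definition grid :: "nat" where "grid = 8 * card E ^ 2 + 1"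

text \<open>The matrix of \<open>g\<close> in the basis \<open>E\<close>, with column index
  \<open>e\<close> and row index \<open>f\<close>, rounded to the lattice of Gaussian integers
  divided by \<open>grid\<close>.\<close>

definition code :: "('b \<Rightarrow> 'b) \<Rightarrow> 'b \<times> 'b \<Rightarrow> int \<times> int" where
  "code g = (\<lambda>(e, f)\<in>E \<times> E. (\<lfloor>grid * Re (c f (g e))\<rfloor>, \<lfloor>grid * Im (c f (g e))\<rfloor>))"

lemma code_range:
  assumes g: "g \<in> K"
  shows "code g \<in> (\<Pi>\<^sub>E p\<in>E \<times> E. {- int grid..int grid} \<times> {- int grid..int grid})"
proof -
  have "(\<lfloor>grid * Re (c f (g e))\<rfloor>, \<lfloor>grid * Im (c f (g e))\<rfloor>) \<in> {- int grid..int grid} \<times> {- int grid..int grid}"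
    if e: "e \<in> E" and f: "f \<in> E" for e f
  proof -
    have eW: "e \<in> W" using e E by auto
    \<comment> \<open>The matrix is unitary, so its entries have modulus at most 1.\<close>
    have "cmod (c f (g e)) \<le> nrm (g e)"
      unfolding nrm_def using E f by (intro member_le_L2_set) auto
    also have "nrm (g e) = nrm e" using nrm_invariant[OF g eW] .
    also have "\<dots> = 1"
    proof -
      have "(\<Sum>f\<in>E. (cmod (c f e))\<^sup>2) = (\<Sum>f\<in>E. if f = e then 1 else 0)"
        using e by (intro sum.cong) (auto simp: c_delta)
      then show ?thesis using E e by (simp add: nrm_def L2_set_def)
    qed
    finally have le: "cmod (c f (g e)) \<le> 1" .
    have fl: "\<lfloor>grid * x\<rfloor> \<in> {- int grid..int grid}" if "\<bar>x\<bar> \<le> 1" for x :: real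
    proof -
      have "real grid * \<bar>x\<bar> \<le> real grid" using that by (simp add: mult_left_le)
      then have "\<bar>real grid * x\<bar> \<le> real grid" by (simp add: abs_mult)
      then have "real grid * x \<le> real grid" "- real grid \<le> real grid * x" by linarith+
      then show ?thesis by (auto simp: le_floor_iff floor_le_iff)
    qed
    show ?thesis using fl[of "Re (c f (g e))"] fl[of "Im (c f (g e))"] le
        abs_Re_le_cmod[of "c f (g e)"] abs_Im_le_cmod[of "c f (g e)"] by auto
  qed
  then show ?thesis by (auto simp: code_def)
qed

text \<open>Equal codes make the matrices close entry by entry, hence \<open>g\<close> and
  \<open>h\<close> close in norm. Applying the inverse of the isometry \<open>h\<close> moves the
  estimate to the identity, where \<open>near_id_scalar\<close> takes over.\<close>

lemma code_eq_imp:
  assumes prim: "primitive_GL W K" and g: "g \<in> K" and h: "h \<in> K" and eq: "code g = code h"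
  shows "proj_class W g = proj_class W h"
proof -
  let ?n = "real (card E)"
  have "grid > 0" by (simp add: grid_def)
  then have L: "real grid > 0" by simp
  have entry: "cmod (c f (g e) - c f (h e)) \<le> 2 / grid" if e: "e \<in> E" and f: "f \<in> E" for e f
  proof -
    have fl: "\<bar>x - y\<bar> \<le> 1 / grid" if "\<lfloor>grid * x\<rfloor> = \<lfloor>grid * y\<rfloor>" for x y :: real
    proof -
      have "\<bar>grid * x - grid * y\<bar> < 1" using that by linarith
      then have "grid * \<bar>x - y\<bar> < 1" by (simp add: abs_mult flip: right_diff_distrib)
      then show ?thesis using L by (simp add: field_simps)
    qed
    have "code g (e, f) = code h (e, f)" using eq by simp
    then have "\<lfloor>grid * Re (c f (g e))\<rfloor> = \<lfloor>grid * Re (c f (h e))\<rfloor>"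
      "\<lfloor>grid * Im (c f (g e))\<rfloor> = \<lfloor>grid * Im (c f (h e))\<rfloor>" using e f by (auto simp: code_def)
    then have "\<bar>Re (c f (g e) - c f (h e))\<bar> \<le> 1 / grid" "\<bar>Im (c f (g e) - c f (h e))\<bar> \<le> 1 / grid"
      using fl by auto
    then show ?thesis using cmod_le[of "c f (g e) - c f (h e)"] by simp
  qed
  have close: "nrm (g v - h v) \<le> 1/4 * nrm v" if v: "v \<in> W" for v
  proof -
    have gv: "g v \<in> W" "h v \<in> W" using v g h K_closed by auto
    have cx: "c f (x v) = (\<Sum>e\<in>E. c e v * c f (x e))" if x: "x \<in> K" and f: "f \<in> E" for x f
    proof -
      have "x v = (\<Sum>e\<in>E. scale (c e v) (x e))"
      proof -
        have "x v = x (\<Sum>e\<in>E. scale (c e v) e)" using c_expand[OF v] by simp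
        also have "\<dots> = (\<Sum>e\<in>E. x (scale (c e v) e))"
          using E W by (intro GL_sum[OF K_GL[OF x] W] subspace_scale) auto
        also have "\<dots> = (\<Sum>e\<in>E. scale (c e v) (x e))"
          using E by (intro sum.cong refl GL_scale[OF K_GL[OF x]]) auto
        finally show ?thesis .
      qed
      moreover have "c f (\<Sum>e\<in>F. scale (c e v) (x e)) = (\<Sum>e\<in>F. c e v * c f (x e))" if "F \<subseteq> E" for F
        using finite_subset[OF that E(1)] that
      proof (induction F rule: finite_induct)
        case empty
        have "c f (scale 0 0) = 0" using f subspace_0[OF W] by (subst c_scale) auto
        then show ?case by simp
      next
        case (insert e F)
        have "scale (c e v) (x e) \<in> W" "(\<Sum>e\<in>F. scale (c e v) (x e)) \<in> W" "x e \<in> W"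
          using insert.prems E K_closed[OF x] W by (auto intro!: subspace_scale subspace_sum)
        then show ?case using insert f by (simp add: c_add c_scale)
      qed
      ultimately show ?thesis by simp
    qed
    have "nrm (g v - h v) \<le> (\<Sum>f\<in>E. cmod (c f (g v - h v)))"
      unfolding nrm_def by (rule L2_set_le_sum) auto
    also have "\<dots> \<le> (\<Sum>f\<in>E. ?n * (nrm v * (2 / grid)))"
    proof (rule sum_mono)
      fix f assume f: "f \<in> E"
      have "c f (g v - h v) = (\<Sum>e\<in>E. c e v * (c f (g e) - c f (h e)))"
        using gv f g h by (simp add: c_diff cx sum_subtractf right_diff_distrib)
      also have "cmod \<dots> \<le> (\<Sum>e\<in>E. nrm v * (2 / grid))"
      proof (rule sum_norm_le)
        fix e assume e: "e \<in> E"
        have "cmod (c e v) \<le> nrm v" unfolding nrm_def using E e by (intro member_le_L2_set) auto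
        then show "cmod (c e v * (c f (g e) - c f (h e))) \<le> nrm v * (2 / grid)"
          unfolding norm_mult by (rule mult_mono[OF _ entry[OF e f] nrm_nonneg norm_ge_zero])
      qed
      finally show "cmod (c f (g v - h v)) \<le> ?n * (nrm v * (2 / grid))" by simp
    qed
    also have "\<dots> = (2 * ?n^2 / grid) * nrm v" by (simp add: power2_eq_square)
    also have "\<dots> \<le> 1/4 * nrm v"
    proof (rule mult_right_mono[OF _ nrm_nonneg])
      have "8 * ?n^2 \<le> real grid" by (simp add: grid_def)
      then show "2 * ?n^2 / grid \<le> 1/4" using L by (simp add: field_simps)
    qed
    finally show ?thesis .
  qed
  let ?x = "ginv h \<cdot> g"
  have xK: "?x \<in> K" using g h K_inv K_mult by simp
  have hx: "h (?x v) = g v" if "v \<in> W" for v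
  proof -
    have "h \<cdot> ?x = g" using g h K_GL by (simp add: G.m_assoc[symmetric])
    then show ?thesis using GL_mult_apply[OF K_GL[OF h] K_GL[OF xK] that] by simp
  qed
  have "near_id (1/4) ?x"
    unfolding near_id_def
  proof
    fix v assume v: "v \<in> W"
    have "nrm (?x v - v) = nrm (h (?x v - v))"
      using nrm_invariant[OF h] v K_closed[OF xK] W by (simp add: subspace_diff)
    also have "h (?x v - v) = g v - h v"
      using GL_diff[OF K_GL[OF h] W] v K_closed[OF xK] hx by simp
    finally show "nrm (?x v - v) \<le> 1/4 * nrm v" using close[OF v] by simp
  qed
  then obtain a where a: "\<And>w. w \<in> W \<Longrightarrow> ?x w = scale a w"
    using near_id_scalar[OF prim xK] by (auto simp: scalar_def)
  have ga: "g w = scale a (h w)" if "w \<in> W" for w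
    using hx[OF that] a[OF that] GL_scale[OF K_GL[OF h] that] by simp
  obtain w where w: "w \<in> W" "w \<noteq> 0"
    using prim subspace_0[OF W] by (auto simp: primitive_GL_def irreducible_action_def)
  have "g w \<noteq> 0"
    using w GL_inj[OF K_GL[OF g], of w 0] GL_zero[OF K_GL[OF g] W] subspace_0[OF W] by simp
  then have "a \<noteq> 0" using ga[OF w(1)] by auto
  then show ?thesis using proj_class_eq_iff[OF W K_GL[OF g] K_GL[OF h]] ga by blast
qed

text \<open>The class of an element depends only on its code, so there are at most as many classes
  as possible codes: \<open>(2 * grid + 1) ^ 2\<close> pairs of integers for each of the
  \<open>card E ^ 2\<close> entries.\<close>

lemma card_PGL_image_le:
  assumes prim: "primitive_GL W K"
  shows "card (PGL_image W K) \<le> ((2 * grid + 1) ^ 2) ^ (card E ^ 2)"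
proof -
  have "PGL_image W K = (\<lambda>x. proj_class W (SOME g. g \<in> K \<and> code g = x)) ` code ` K"
    (is "_ = ?f ` _")
  proof -
    have "proj_class W g = ?f (code g)" if "g \<in> K" for g
    proof -
      have "(SOME h. h \<in> K \<and> code h = code g) \<in> K \<and> code (SOME h. h \<in> K \<and> code h = code g) = code g"
        by (rule someI[of "\<lambda>h. h \<in> K \<and> code h = code g" g]) (use that in auto)
      then show ?thesis using code_eq_imp[OF prim that] by metis
    qed
    then show ?thesis by (simp add: PGL_image_eq image_image cong: image_cong)
  qed
  then have "card (PGL_image W K) \<le> card (code ` K)"
    using finK by (simp add: card_image_le)
  also have "\<dots> \<le> card (\<Pi>\<^sub>E p\<in>E \<times> E. {- int grid..int grid} \<times> {- int grid..int grid})"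
    using code_range E by (intro card_mono finite_PiE) auto
  also have "\<dots> = ((2 * grid + 1) ^ 2) ^ (card E ^ 2)"
    using E by (simp add: card_PiE card_cartesian_product power2_eq_square nat_add_distrib nat_mult_distrib)
  finally show ?thesis .
qed

end

text \<open>The preceding bound with \<open>grid\<close> written out for \<open>n = card E\<close>,
  so that it depends on nothing but the dimension.\<close>

definition jordan_bound :: "nat \<Rightarrow> nat" where
  "jordan_bound n = ((2 * (8 * n ^ 2 + 1) + 1) ^ 2) ^ (n ^ 2)"

lemma jordan_bound_mono:
  assumes "m \<le> n"
  shows "jordan_bound m \<le> jordan_bound n"
proof -
  have sq: "m ^ 2 \<le> n ^ 2" using assms by (simp add: power_mono)
  have "jordan_bound m \<le> ((2 * (8 * n ^ 2 + 1) + 1) ^ 2) ^ (m ^ 2)"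
    unfolding jordan_bound_def using sq by (intro power_mono) auto
  also have "\<dots> \<le> jordan_bound n"
    unfolding jordan_bound_def using sq by (intro power_increasing) auto
  finally show ?thesis .
qed

theorem (in complex_space) jordan_primitive:
  assumes prim: "primitive_GL W K" and B: "finite B" "W = span B"
  shows "card (PGL_image W K) \<le> jordan_bound (card B)"
proof -
  have K: "subgroup K (GL W)" "finite K" and W: "subspace W"
    using prim by (auto simp: primitive_GL_def irreducible_action_def)
  obtain E c where *: "finite E" "card E \<le> card B" "E \<subseteq> W"
     "\<forall>v\<in>W. \<forall>w\<in>W. \<forall>e\<in>E. c e (v + w) = c e v + c e w"
     "\<forall>v\<in>W. \<forall>a. \<forall>e\<in>E. c e (scale a v) = a * c e v"
     "\<forall>v\<in>W. v = (\<Sum>e\<in>E. scale (c e v) e)"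
     "\<forall>e\<in>E. \<forall>f\<in>E. c f e = (if e = f then 1 else 0)"
     "\<forall>g\<in>K. \<forall>v\<in>W. (\<Sum>e\<in>E. (cmod (c e (g v)))\<^sup>2) = (\<Sum>e\<in>E. (cmod (c e v))\<^sup>2)"
    using invariant_coordinates[OF K W B] by blast
  interpret I: invariant_norm scale W K E c
  proof (intro invariant_norm.intro invariant_norm_axioms.intro complex_space_axioms)
    show "subspace W" "subgroup K (GL W)" "finite K" by fact+
  qed (use * in \<open>blast+\<close>)
  have "card (PGL_image W K) \<le> jordan_bound (card E)"
    using I.card_PGL_image_le[OF prim] by (simp add: I.grid_def jordan_bound_def)
  also have "\<dots> \<le> jordan_bound (card B)" using * by (intro jordan_bound_mono)
  finally show ?thesis .
qed

section \<open>Change of ambient space\<close>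

lemma card_image_eq_if_same_kernel:
  assumes "\<And>x y. x \<in> K \<Longrightarrow> y \<in> K \<Longrightarrow> f x = f y \<longleftrightarrow> g x = g y"
  shows "card (f ` K) = card (g ` K)"
proof -
  have f: "g (inv_into K f (f x)) = g x" if "x \<in> K" for x
    using assms[of "inv_into K f (f x)" x] that by (simp add: inv_into_into f_inv_into_f)
  have g: "f (inv_into K g (g x)) = f x" if "x \<in> K" for x
    using assms[of "inv_into K g (g x)" x] that by (simp add: inv_into_into f_inv_into_f)
  have "bij_betw (\<lambda>z. g (inv_into K f z)) (f ` K) (g ` K)"
    by (rule bij_betw_byWitness[where f' = "\<lambda>z. f (inv_into K g z)"]) (auto simp: f g)
  then show ?thesis by (rule bij_betw_same_card)
qed

text \<open>Needed because \<open>JC\<close> is defined on spaces of sequences while the blocks lie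
  in \<open>complex ^ 'n\<close>. The map is a function on the whole ambient type but linear and
  bijective only between the two subspaces.\<close>

locale complex_space_iso = A: complex_space s1 + B: complex_space s2
  for s1 :: "complex \<Rightarrow> 'a::ab_group_add \<Rightarrow> 'a" and s2 :: "complex \<Rightarrow> 'b::ab_group_add \<Rightarrow> 'b" +
  fixes \<phi> :: "'a \<Rightarrow> 'b" and V :: "'a set" and W :: "'b set"
  assumes V: "A.subspace V" and W: "B.subspace W" and bij: "bij_betw \<phi> V W"
    and add: "\<lbrakk>x \<in> V; y \<in> V\<rbrakk> \<Longrightarrow> \<phi> (x + y) = \<phi> x + \<phi> y"
    and scale: "x \<in> V \<Longrightarrow> \<phi> (s1 a x) = s2 a (\<phi> x)"
begin

abbreviation "\<psi> \<equiv> inv_into V \<phi>"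

lemma \<phi>_in: "x \<in> V \<Longrightarrow> \<phi> x \<in> W" using bij by (auto simp: bij_betw_def)
lemma \<psi>_in: "y \<in> W \<Longrightarrow> \<psi> y \<in> V" using bij by (auto simp: bij_betw_def inv_into_into)
lemma \<psi>_\<phi>: "x \<in> V \<Longrightarrow> \<psi> (\<phi> x) = x" using bij by (auto simp: bij_betw_def)
lemma \<phi>_\<psi>: "y \<in> W \<Longrightarrow> \<phi> (\<psi> y) = y" using bij by (auto simp: bij_betw_def f_inv_into_f)
lemma \<phi>_inj: "x \<in> V \<Longrightarrow> y \<in> V \<Longrightarrow> \<phi> x = \<phi> y \<longleftrightarrow> x = y" using \<psi>_\<phi> by metis

lemma \<psi>_add: "x \<in> W \<Longrightarrow> y \<in> W \<Longrightarrow> \<psi> (x + y) = \<psi> x + \<psi> y"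
  using add[of "\<psi> x" "\<psi> y"] \<psi>_in \<phi>_\<psi> \<psi>_\<phi> V A.subspace_add by metis
lemma \<psi>_scale: "x \<in> W \<Longrightarrow> \<psi> (s2 a x) = s1 a (\<psi> x)"
  using scale[of "\<psi> x"] \<psi>_in \<phi>_\<psi> \<psi>_\<phi> V A.subspace_scale by metis

lemma inverse: "complex_space_iso s2 s1 \<psi> W V"
  by unfold_locales (use V W \<psi>_add \<psi>_scale bij_betw_inv_into[OF bij] in auto)

lemma \<phi>_0: "\<phi> 0 = 0" using scale[of 0 0] V A.subspace_0 by auto

lemma \<phi>_sum: "(\<And>i. i \<in> I \<Longrightarrow> f i \<in> V) \<Longrightarrow> \<phi> (sum f I) = (\<Sum>i\<in>I. \<phi> (f i))"
proof (induction I rule: infinite_finite_induct)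
  case (insert x F)
  then show ?case using V by (simp add: add A.subspace_sum)
qed (use \<phi>_0 in auto)

lemma subspace_image:
  assumes U: "A.subspace U" "U \<subseteq> V"
  shows "B.subspace (\<phi> ` U)"
proof (rule B.subspaceI)
  show "0 \<in> \<phi> ` U" using \<phi>_0 A.subspace_0[OF U(1)] by force
next
  fix x y assume "x \<in> \<phi> ` U" "y \<in> \<phi> ` U"
  then obtain u v where uv: "u \<in> U" "v \<in> U" "x = \<phi> u" "y = \<phi> v" by auto
  then have "x + y = \<phi> (u + v)" using add[of u v] U(2) by (metis subsetD)
  then show "x + y \<in> \<phi> ` U" using A.subspace_add[OF U(1) uv(1,2)] by simp
next
  fix c x assume "x \<in> \<phi> ` U"
  then obtain u where u: "u \<in> U" "x = \<phi> u" by auto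
  then have "s2 c x = \<phi> (s1 c u)" using scale[of u c] U by auto
  then show "s2 c x \<in> \<phi> ` U" using A.subspace_scale[OF U(1) u(1)] by simp
qed

lemma \<psi>_image: "U \<subseteq> V \<Longrightarrow> \<psi> ` \<phi> ` U = U"
  using \<psi>_\<phi> by (force simp: image_image)

lemma \<phi>_image: "U \<subseteq> W \<Longrightarrow> \<phi> ` \<psi> ` U = U"
  using \<phi>_\<psi> by (force simp: image_image)

lemma direct_sum_image:
  assumes ds: "A.direct_sum \<U> (\<lambda>U. U) V" and sub: "\<forall>U\<in>\<U>. U \<subseteq> V"
  shows "B.direct_sum ((`) \<phi> ` \<U>) (\<lambda>U. U) W"
proof (rule B.direct_sumI)
  show "finite ((`) \<phi> ` \<U>)" using A.direct_sumD(1)[OF ds] by simp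
  show "B.subspace X" if "X \<in> (`) \<phi> ` \<U>" for X
    using that sub A.direct_sumD(2)[OF ds] by (auto intro!: subspace_image)
  show "B.span (\<Union>X\<in>(`) \<phi> ` \<U>. X) = W"
  proof
    show "B.span (\<Union>X\<in>(`) \<phi> ` \<U>. X) \<subseteq> W" using sub \<phi>_in by (intro B.span_minimal W) auto
    show "W \<subseteq> B.span (\<Union>X\<in>(`) \<phi> ` \<U>. X)"
    proof
      fix w assume w: "w \<in> W"
      obtain u where u: "\<forall>U\<in>\<U>. u U \<in> U" "\<psi> w = sum u \<U>"
        using A.direct_sumD(4)[OF ds \<psi>_in[OF w]] by blast
      then have "w = (\<Sum>U\<in>\<U>. \<phi> (u U))"
        using \<phi>_\<psi>[OF w] \<phi>_sum[of \<U> u] sub by (metis subsetD)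
      then show "w \<in> B.span (\<Union>X\<in>(`) \<phi> ` \<U>. X)" using u(1)
        by (auto intro!: B.span_sum intro: B.span_base)
    qed
  qed
  fix u assume u: "\<And>X. X \<in> (`) \<phi> ` \<U> \<Longrightarrow> u X \<in> X" and 0: "sum u ((`) \<phi> ` \<U>) = 0"
  have inj: "inj_on ((`) \<phi>) \<U>"
    using sub \<psi>_image by (intro inj_onI) metis
  have \<phi>u: "\<psi> (u (\<phi> ` U)) \<in> U" "\<phi> (\<psi> (u (\<phi> ` U))) = u (\<phi> ` U)" if U: "U \<in> \<U>" for U
  proof -
    obtain x where x: "u (\<phi> ` U) = \<phi> x" "x \<in> U" using u[OF imageI[OF U]] by blast
    moreover have "x \<in> V" using x(2) sub U by blast
    ultimately show "\<psi> (u (\<phi> ` U)) \<in> U" "\<phi> (\<psi> (u (\<phi> ` U))) = u (\<phi> ` U)"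
      by (simp_all add: \<psi>_\<phi>)
  qed
  have \<psi>u: "\<psi> (u (\<phi> ` U)) \<in> V" if "U \<in> \<U>" for U using \<phi>u(1)[OF that] sub that by blast
  have "\<phi> (\<Sum>U\<in>\<U>. \<psi> (u (\<phi> ` U))) = (\<Sum>U\<in>\<U>. u (\<phi> ` U))"
    using \<phi>u(2) by (subst \<phi>_sum[OF \<psi>u]) auto
  also have "\<dots> = \<phi> 0" using 0 by (simp add: sum.reindex[OF inj] \<phi>_0)
  finally have "(\<Sum>U\<in>\<U>. \<psi> (u (\<phi> ` U))) = 0"
    using \<phi>_inj[OF A.direct_sumD(3)[OF ds \<phi>u(1)] A.subspace_0[OF V]] by blast
  then have "\<psi> (u (\<phi> ` U)) = 0" if "U \<in> \<U>" for U
    using A.direct_sumD(5)[OF ds, of "\<lambda>U. \<psi> (u (\<phi> ` U))"] \<phi>u(1) that by blast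
  then show "\<forall>X\<in>(`) \<phi> ` \<U>. u X = 0" using \<phi>u(2) \<phi>_0 by fastforce
qed

definition conj :: "('a \<Rightarrow> 'a) \<Rightarrow> 'b \<Rightarrow> 'b" where
  "conj g = (\<lambda>y\<in>W. \<phi> (g (\<psi> y)))"

lemma conj_GL: "g \<in> carrier (A.GL V) \<Longrightarrow> conj g \<in> carrier (B.GL W)"
  unfolding B.GL_carrier_iff
proof (intro conjI ballI allI)
  assume g: "g \<in> carrier (A.GL V)"
  have "bij_betw g V V" using g by (simp add: A.GL_carrier_iff)
  then have "bij_betw (\<lambda>y. \<phi> (g (\<psi> y))) W W"
    using bij_betw_trans[OF bij_betw_trans[OF bij_betw_inv_into[OF bij]] bij] by (simp add: comp_def)
  then show "bij_betw (conj g) W W" by (simp add: conj_def cong: bij_betw_cong)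
  show "conj g (x + y) = conj g x + conj g y" if "x \<in> W" "y \<in> W" for x y
    using that W g A.GL_closed[OF g] by (simp add: conj_def B.subspace_add \<psi>_add \<psi>_in add A.GL_add[OF g])
  show "conj g (s2 c x) = s2 c (conj g x)" if "x \<in> W" for c x
    using that W g A.GL_closed[OF g] by (simp add: conj_def B.subspace_scale \<psi>_scale \<psi>_in scale A.GL_scale[OF g])
qed (auto simp: conj_def)

lemma conj_apply: "x \<in> V \<Longrightarrow> conj g (\<phi> x) = \<phi> (g x)"
  by (simp add: conj_def \<phi>_in \<psi>_\<phi>)

lemma conj_hom: "group_hom (A.GL V) (B.GL W) conj"
proof (intro group_hom.intro group_hom_axioms.intro A.group_GL B.group_GL V W homI conj_GL)
  fix g h assume gh: "g \<in> carrier (A.GL V)" "h \<in> carrier (A.GL V)"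
  interpret A: group "A.GL V" by (rule A.group_GL) (rule V)
  interpret B: group "B.GL W" by (rule B.group_GL) (rule W)
  show "conj (g \<otimes>\<^bsub>A.GL V\<^esub> h) = conj g \<otimes>\<^bsub>B.GL W\<^esub> conj h"
  proof (rule B.GL_ext[of _ W])
    fix y assume y: "y \<in> W"
    then have "(conj g \<otimes>\<^bsub>B.GL W\<^esub> conj h) y = conj g (conj h y)"
      using gh by (intro B.GL_mult_apply conj_GL)
    then show "conj (g \<otimes>\<^bsub>A.GL V\<^esub> h) y = (conj g \<otimes>\<^bsub>B.GL W\<^esub> conj h) y"
      using gh y by (simp add: A.GL_mult_apply \<psi>_in conj_def \<psi>_\<phi> \<phi>_in A.GL_closed)
  qed (use gh conj_GL in auto)
qed

text \<open>Invariant subspaces and systems of imprimitivity of the transported group are pulled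
  back along \<open>\<psi>\<close>, which turns the action of \<open>conj g\<close> into that of
  \<open>g\<close>.\<close>

lemma primitive_GL_conj:
  assumes prim: "A.primitive_GL V K"
  shows "B.primitive_GL W (conj ` K)"
proof -
  interpret inv: complex_space_iso s2 s1 \<psi> W V by (rule inverse)
  interpret h: group_hom "A.GL V" "B.GL W" conj by (rule conj_hom)
  have K: "subgroup K (A.GL V)" "finite K" and irr: "A.irreducible_action V K"
    using prim by (auto simp: A.primitive_GL_def)
  have KG: "g \<in> carrier (A.GL V)" if "g \<in> K" for g using that K subgroup.mem_carrier by metis
  have conj_\<psi>: "\<psi> ` conj g ` U = g ` \<psi> ` U" if g: "g \<in> K" and U: "U \<subseteq> W" for g U
  proof -
    have "\<psi> (conj g y) = g (\<psi> y)" if "y \<in> U" for y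
      using that U A.GL_closed[OF KG[OF g] \<psi>_in] by (auto simp: conj_def \<psi>_\<phi> subset_iff)
    then show ?thesis by (force simp: image_image)
  qed
  have V0: "V \<noteq> {0}" using irr by (simp add: A.irreducible_action_def)
  show ?thesis
    unfolding B.primitive_GL_def
  proof (intro conjI)
    show "subgroup (conj ` K) (B.GL W)" using K(1) by (rule h.subgroup_img_is_subgroup)
    show "finite (conj ` K)" using K by simp
    show "B.irreducible_action W (conj ` K)"
      unfolding B.irreducible_action_def
    proof (intro conjI ballI allI impI)
      show "B.subspace W" by (rule W)
      show "W \<noteq> {0}"
      proof
        assume "W = {0}"
        then have "V = {inv_into V \<phi> 0}" using \<psi>_image[of V] bij by (auto simp: bij_betw_def)
        then show False using V0 A.subspace_0[OF V] by (metis singletonD)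
      qed
      show "g ` W \<subseteq> W" if "g \<in> conj ` K" for g
        using that KG conj_GL B.GL_closed by blast
      fix U assume U: "B.subspace U \<and> U \<subseteq> W \<and> (\<forall>g\<in>conj ` K. g ` U \<subseteq> U)"
      have "A.subspace (\<psi> ` U)" using U by (intro inv.subspace_image) auto
      moreover have "\<psi> ` U \<subseteq> V" using U \<psi>_in by auto
      moreover have "g ` \<psi> ` U \<subseteq> \<psi> ` U" if "g \<in> K" for g
      proof -
        have "g ` \<psi> ` U = \<psi> ` conj g ` U" using conj_\<psi>[OF that] U by simp
        also have "\<dots> \<subseteq> \<psi> ` U" using U that by (intro image_mono) auto
        finally show ?thesis .
      qed
      moreover have "\<forall>U. A.subspace U \<and> U \<subseteq> V \<and> (\<forall>g\<in>K. g ` U \<subseteq> U) \<longrightarrow> U = {0} \<or> U = V"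
        using irr unfolding A.irreducible_action_def by (elim conjE)
      ultimately have "\<psi> ` U = {0} \<or> \<psi> ` U = V" by simp
      then have "\<phi> ` \<psi> ` U = {0} \<or> \<phi> ` \<psi> ` U = W"
        using \<phi>_0 bij by (elim disjE) (simp_all add: bij_betw_def)
      then show "U = {0} \<or> U = W" using \<phi>_image[of U] U by simp
    qed
    show "\<nexists>\<U>. B.direct_sum \<U> (\<lambda>U. U) W \<and> (\<forall>U\<in>\<U>. U \<subset> W) \<and> (\<forall>g\<in>conj ` K. \<forall>U\<in>\<U>. g ` U \<in> \<U>)"
    proof
      assume "\<exists>\<U>. B.direct_sum \<U> (\<lambda>U. U) W \<and> (\<forall>U\<in>\<U>. U \<subset> W) \<and> (\<forall>g\<in>conj ` K. \<forall>U\<in>\<U>. g ` U \<in> \<U>)"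
      then obtain \<U> where \<U>: "B.direct_sum \<U> (\<lambda>U. U) W" "\<forall>U\<in>\<U>. U \<subset> W"
        "\<And>g U. g \<in> K \<Longrightarrow> U \<in> \<U> \<Longrightarrow> conj g ` U \<in> \<U>" by blast
      have "A.direct_sum ((`) \<psi> ` \<U>) (\<lambda>U. U) V"
        using \<U> by (intro inv.direct_sum_image) auto
      moreover have "\<psi> ` U \<subset> V" if "U \<in> \<U>" for U
      proof -
        have "\<psi> ` U \<subseteq> V" using \<U>(2) that \<psi>_in by blast
        moreover have "\<psi> ` U \<noteq> V"
        proof
          assume "\<psi> ` U = V"
          then have "\<phi> ` \<psi> ` U = W" using bij by (simp add: bij_betw_def)
          moreover have "U \<subset> W" using \<U>(2) that by blast
          ultimately show False using \<phi>_image[of U] by simp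
        qed
        ultimately show ?thesis by auto
      qed
      moreover have "g ` \<psi> ` U \<in> (`) \<psi> ` \<U>" if "g \<in> K" "U \<in> \<U>" for g U
        using conj_\<psi>[OF that(1), of U] \<U>(2,3) that by (metis image_eqI psubset_imp_subset)
      moreover have "\<nexists>\<U>. A.direct_sum \<U> (\<lambda>U. U) V \<and> (\<forall>U\<in>\<U>. U \<subset> V) \<and> (\<forall>g\<in>K. \<forall>U\<in>\<U>. g ` U \<in> \<U>)"
        using prim unfolding A.primitive_GL_def by (elim conjE)
      ultimately show False by (elim notE, intro exI[of _ "(`) \<psi> ` \<U>"]) auto
    qed
  qed
qed

text \<open>Both sides count the classes of the same set \<open>K\<close> under proportionality, a
  relation that the isomorphism preserves.\<close>

lemma card_PGL_image_conj:
  assumes K: "K \<subseteq> carrier (A.GL V)"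
  shows "card (B.PGL_image W (conj ` K)) = card (A.PGL_image V K)"
  unfolding A.PGL_image_eq B.PGL_image_eq image_image
proof (rule card_image_eq_if_same_kernel)
  fix g h assume "g \<in> K" "h \<in> K"
  then have g: "g \<in> carrier (A.GL V)" and h: "h \<in> carrier (A.GL V)" using K by auto
  have "(\<forall>w\<in>W. conj g w = s2 c (conj h w)) \<longleftrightarrow> (\<forall>v\<in>V. g v = s1 c (h v))" for c
  proof -
    have "(\<forall>w\<in>W. conj g w = s2 c (conj h w)) \<longleftrightarrow> (\<forall>v\<in>V. conj g (\<phi> v) = s2 c (conj h (\<phi> v)))"
      using bij by (auto simp: bij_betw_def)
    also have "\<dots> \<longleftrightarrow> (\<forall>v\<in>V. g v = s1 c (h v))"
    proof (intro ball_cong refl)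
      fix v assume v: "v \<in> V"
      then have "conj g (\<phi> v) = s2 c (conj h (\<phi> v)) \<longleftrightarrow> \<phi> (g v) = \<phi> (s1 c (h v))"
        using A.GL_closed[OF h] by (simp add: conj_apply scale)
      also have "\<dots> \<longleftrightarrow> g v = s1 c (h v)"
        using v A.GL_closed[OF h v] A.GL_closed[OF g v] V by (intro \<phi>_inj A.subspace_scale)
      finally show "conj g (\<phi> v) = s2 c (conj h (\<phi> v)) \<longleftrightarrow> g v = s1 c (h v)" .
    qed
    finally show ?thesis .
  qed
  then show "B.proj_class W (conj g) = B.proj_class W (conj h) \<longleftrightarrow> A.proj_class V g = A.proj_class V h"
    using g h by (simp add: A.proj_class_eq_iff[OF V] B.proj_class_eq_iff[OF W] conj_GL)
qed

end

section \<open>Coordinate subspaces and the maxima \<open>JC\<close>\<close>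

definition coord_subspace :: "'n set \<Rightarrow> (complex ^ 'n) set" where
  "coord_subspace C = {v. \<forall>i. i \<notin> C \<longrightarrow> v $ i = 0}"

lemma subspace_coord_subspace: "vec.subspace (coord_subspace C)"
  by (rule vec.subspaceI) (auto simp: coord_subspace_def)

lemma span_axis: 
  fixes C :: "'n::finite set"
  shows "vec.span ((\<lambda>i. axis i 1) ` C) = coord_subspace C"
proof (rule vec.span_unique)
  show "(\<lambda>i. axis i 1) ` C \<subseteq> coord_subspace C" by (auto simp: coord_subspace_def axis_def)
  show "vec.subspace (coord_subspace C)" by (rule subspace_coord_subspace)
  fix T :: "(complex ^ 'n) set" assume T: "(\<lambda>i. axis i 1) ` C \<subseteq> T" "vec.subspace T"
  show "coord_subspace C \<subseteq> T"
  proof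
    fix v :: "complex ^ 'n" assume v: "v \<in> coord_subspace C"
    have "v = (\<Sum>i\<in>C. v $ i *s axis i 1)"
    proof -
      have "(\<Sum>i\<in>C. v $ i *s axis i 1) $ j = v $ j" for j
        using v by (auto simp: axis_def coord_subspace_def if_distrib cong: if_cong)
      then show ?thesis by (simp add: vec_eq_iff)
    qed
    also have "\<dots> \<in> T" using T by (intro vec.subspace_sum vec.subspace_scale) auto
    finally show "v \<in> T" .
  qed
qed

lemma dim_coord_subspace: "vec.dim (coord_subspace C) = card C"
  for C :: "'n::finite set"
proof -
  have inj: "inj_on (\<lambda>i. axis i (1::complex)) C"
    by (auto simp: inj_on_def axis_eq_axis)
  have "vec.independent ((\<lambda>i. axis i (1::complex)) ` C)"
    using vec.independent_mono[OF independent_cart_basis, of "(\<lambda>i. axis i (1::complex)) ` C"]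
    by (auto simp: cart_basis_def)
  then show ?thesis
    using vec.dim_span_eq_card_independent[of "(\<lambda>i. axis i (1::complex)) ` C"] inj
    by (simp add: span_axis card_image)
qed

lemma coord_space_span:
  "coord_space k = seq.span ((\<lambda>i j. if j = i then 1 else 0) ` {..<k})"
proof (rule seq.span_unique[symmetric])
  show "(\<lambda>i j. if j = i then 1 else 0) ` {..<k} \<subseteq> coord_space k" by (auto simp: coord_space_def)
  show "seq.subspace (coord_space k)"
    by (rule seq.subspaceI) (auto simp: coord_space_def seq_scale_def)
  fix T assume T: "(\<lambda>i j. if j = i then 1 else 0) ` {..<k} \<subseteq> T" "seq.subspace T"
  show "coord_space k \<subseteq> T"
  proof
    fix v assume v: "v \<in> coord_space k"
    have "(\<Sum>i<k. seq_scale (v i) (\<lambda>j. if j = i then 1 else 0)) \<in> T"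
      using T by (intro seq.subspace_sum seq.subspace_scale) auto
    moreover have "(\<Sum>i<n. seq_scale (v i) (\<lambda>j. if j = i then 1 else 0)) = (\<lambda>j. if j < n then v j else 0)" for n
      by (induction n) (auto simp: fun_eq_iff seq_scale_def less_Suc_eq)
    moreover have "(\<lambda>j. if j < k then v j else 0) = v"
      using v by (auto simp: coord_space_def fun_eq_iff)
    ultimately show "v \<in> T" by simp
  qed
qed

text \<open>\<open>Max\<close> is an upper bound only for a finite set of numbers; the uniform
  Jordan bound provides the finiteness.\<close>

lemma card_le_JC:
  assumes "seq.primitive_PGL (coord_space k) H"
  shows "card H \<le> JC k"
proof -
  have "card H \<le> jordan_bound k" if prim: "seq.primitive_PGL (coord_space k) H" for H
  proof -
    obtain K where K: "seq.primitive_GL (coord_space k) K" "H = seq.PGL_image (coord_space k) K"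
      using prim by (auto simp: seq.primitive_PGL_def)
    let ?B = "(\<lambda>i j. if j = i then 1 else 0 :: complex) ` {..<k}"
    have "card H \<le> jordan_bound (card ?B)"
      unfolding K(2) by (rule seq.jordan_primitive[OF K(1) _ coord_space_span]) simp
    also have "\<dots> \<le> jordan_bound k" using card_image_le[of "{..<k}"] by (intro jordan_bound_mono) auto
    finally show ?thesis .
  qed
  then have "{card H | H. seq.primitive_PGL (coord_space k) H} \<subseteq> {..jordan_bound k}" by auto
  then have "finite {card H | H. seq.primitive_PGL (coord_space k) H}" by (rule finite_subset) simp
  then show ?thesis unfolding JC_def using assms by (intro Max_ge) auto
qed

lemma primitive_card_le_JC:
  fixes C :: "'n::finite set"
  assumes "cvec.primitive_GL (coord_subspace C) K"
  shows "card (cvec.PGL_image (coord_subspace C) K) \<le> JC (card C)"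
proof -
  obtain h where h: "bij_betw h {..<card C} C"
    using ex_bij_betw_nat_finite[of C] by (auto simp: atLeast0LessThan)
  \<comment> \<open>Renumbering the coordinates in \<open>C\<close> by \<open>{..<card C}\<close>,
    with zeros beyond, identifies the coordinate subspace with the sequence space.\<close>
  define \<phi> :: "complex ^ 'n \<Rightarrow> nat \<Rightarrow> complex" where "\<phi> v = (\<lambda>i. if i < card C then v $ h i else 0)" for v
  interpret complex_space_iso "(*s)" seq_scale \<phi> "coord_subspace C" "coord_space (card C)"
  proof unfold_locales
    show "vec.subspace (coord_subspace C)" by (rule subspace_coord_subspace)
    show "seq.subspace (coord_space (card C))" unfolding coord_space_span by (rule seq.subspace_span)
    show "bij_betw \<phi> (coord_subspace C) (coord_space (card C))"
    proof (rule bij_betw_byWitness[where f' = "\<lambda>x. \<chi> j. if j \<in> C then x (inv_into {..<card C} h j) else 0"])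
      show "\<forall>v\<in>coord_subspace C. (\<chi> j. if j \<in> C then \<phi> v (inv_into {..<card C} h j) else 0) = v"
        using h bij_betw_inv_into_right[OF h] bij_betw_apply[OF bij_betw_inv_into[OF h]]
        by (auto simp: vec_eq_iff \<phi>_def coord_subspace_def)
      show "\<forall>x\<in>coord_space (card C). \<phi> (\<chi> j. if j \<in> C then x (inv_into {..<card C} h j) else 0) = x"
        using h bij_betw_inv_into_left[OF h] bij_betw_apply[OF h]
        by (auto simp: fun_eq_iff \<phi>_def coord_space_def)
    qed (auto simp: \<phi>_def coord_space_def coord_subspace_def)
  qed (auto simp: \<phi>_def seq_scale_def fun_eq_iff)
  have "seq.primitive_PGL (coord_space (card C)) (seq.PGL_image (coord_space (card C)) (conj ` K))"
    using primitive_GL_conj[OF assms] by (auto simp: seq.primitive_PGL_def)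
  then have "card (seq.PGL_image (coord_space (card C)) (conj ` K)) \<le> JC (card C)" by (rule card_le_JC)
  moreover have "K \<subseteq> carrier (cvec.GL (coord_subspace C))"
    using assms subgroup.subset by (auto simp: cvec.primitive_GL_def)
  ultimately show ?thesis by (simp add: card_PGL_image_conj)
qed

section \<open>Polynomials as functions and diagonal symmetries of smooth forms\<close>

abbreviation (input) "lookup \<equiv> Poly_Mapping.lookup"
abbreviation (input) "keys \<equiv> Poly_Mapping.keys"
abbreviation (input) "single \<equiv> Poly_Mapping.single"

definition monom_eval :: "('n::finite \<Rightarrow>\<^sub>0 nat) \<Rightarrow> complex ^ 'n \<Rightarrow> complex" where
  "monom_eval \<mm> v = (\<Prod>k\<in>UNIV. (v $ k) ^ lookup \<mm> k)"

lemma monom_eval_add: "monom_eval (\<mm> + \<nn>) v = monom_eval \<mm> v * monom_eval \<nn> v"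
  by (simp add: monom_eval_def lookup_add power_add prod.distrib)

lemma monom_eval_0: "monom_eval 0 v = 1"
  by (simp add: monom_eval_def)

lemma monom_eval_mult: "monom_eval \<mm> (\<chi> k. u $ k * v $ k) = monom_eval \<mm> u * monom_eval \<mm> v"
  by (simp add: monom_eval_def power_mult_distrib prod.distrib)

lemma monom_eval_single: "monom_eval (single k n) v = (v $ k) ^ n"
proof -
  have "monom_eval (single k n) v = (\<Prod>j\<in>UNIV. if j = k then (v $ k) ^ n else 1)"
    unfolding monom_eval_def by (intro prod.cong) (auto simp: lookup_single when_def)
  then show ?thesis by simp
qed

lemma mpoly_eval_superset:
  assumes "finite S" "keys F \<subseteq> S"
  shows "mpoly_eval F v = (\<Sum>\<mm>\<in>S. lookup F \<mm> * monom_eval \<mm> v)"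
  unfolding mpoly_eval_def monom_eval_def
  using assms by (intro sum.mono_neutral_left) (auto simp: in_keys_iff)

text \<open>Distinct monomials are distinct characters of the multiplicative monoid of vectors, so
  Dedekind's argument applies.\<close>

lemma monomials_independent:
  assumes "finite S" "\<And>v. (\<Sum>\<mm>\<in>S. c \<mm> * monom_eval \<mm> v) = 0"
  shows "\<forall>\<mm>\<in>S. c \<mm> = 0"
  using assms
proof (induction S arbitrary: c rule: finite_induct)
  case (insert a S)
  have c0: "c \<mm> = 0" if \<mm>: "\<mm> \<in> S" for \<mm>
  proof -
    have "\<mm> \<noteq> a" using \<mm> insert.hyps by auto
    then obtain k where k: "lookup \<mm> k \<noteq> lookup a k"
      by (meson poly_mapping_eqI)
    \<comment> \<open>Powers of 2 have pairwise different moduli, so this point tells the two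
      exponents of \<open>k\<close> apart.\<close>
    define u :: "complex ^ 'a" where "u = (\<chi> j. if j = k then 2 else 1)"
    have mu: "monom_eval \<nn> u = 2 ^ lookup \<nn> k" for \<nn>
    proof -
      have "monom_eval \<nn> u = (\<Prod>j\<in>UNIV. if j = k then 2 ^ lookup \<nn> k else 1)"
        unfolding monom_eval_def u_def by (intro prod.cong) auto
      then show ?thesis by simp
    qed
    have "(\<Sum>\<nn>\<in>S. c \<nn> * (monom_eval \<nn> u - monom_eval a u) * monom_eval \<nn> v) = 0" for v
    proof -
      let ?w = "\<chi> k. u $ k * v $ k"
      have "0 = (\<Sum>\<nn>\<in>insert a S. c \<nn> * monom_eval \<nn> ?w)
          - monom_eval a u * (\<Sum>\<nn>\<in>insert a S. c \<nn> * monom_eval \<nn> v)"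
        using insert.prems[of ?w] insert.prems[of v] by simp
      also have "\<dots> = (\<Sum>\<nn>\<in>insert a S. c \<nn> * (monom_eval \<nn> u - monom_eval a u) * monom_eval \<nn> v)"
        by (simp only: monom_eval_mult sum_distrib_left sum_subtractf[symmetric]) (simp add: algebra_simps)
      also have "\<dots> = (\<Sum>\<nn>\<in>S. c \<nn> * (monom_eval \<nn> u - monom_eval a u) * monom_eval \<nn> v)"
        using insert.hyps by simp
      finally show ?thesis by simp
    qed
    then have "c \<mm> * (monom_eval \<mm> u - monom_eval a u) = 0"
      using insert.IH[of "\<lambda>\<nn>. c \<nn> * (monom_eval \<nn> u - monom_eval a u)"] \<mm> by blast
    moreover have "monom_eval \<mm> u \<noteq> monom_eval a u"
    proof -
      have "cmod (monom_eval \<mm> u) \<noteq> cmod (monom_eval a u)" using k by (simp add: mu norm_power)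
      then show ?thesis by metis
    qed
    ultimately show ?thesis by simp
  qed
  have "c a * monom_eval a (\<chi> k. 1) = 0" using insert.prems[of "\<chi> k. 1"] insert.hyps c0 by simp
  then have "c a = 0" by (simp add: monom_eval_def)
  then show ?case using c0 by auto
qed simp

text \<open>Reduces identities between polynomials, such as invariance under a substitution, to
  identities between functions.\<close>

lemma mpoly_eval_inject:
  assumes "\<And>v. mpoly_eval F v = mpoly_eval G v"
  shows "F = G"
proof (rule poly_mapping_eqI)
  fix \<mm>
  let ?S = "keys F \<union> keys G"
  have "\<forall>\<nn>\<in>?S. lookup F \<nn> - lookup G \<nn> = 0"
  proof (rule monomials_independent)
    fix v
    show "(\<Sum>\<nn>\<in>?S. (lookup F \<nn> - lookup G \<nn>) * monom_eval \<nn> v) = 0"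
      using assms[of v] mpoly_eval_superset[of ?S F v] mpoly_eval_superset[of ?S G v]
      by (simp add: left_diff_distrib sum_subtractf)
  qed auto
  then show "lookup F \<mm> = lookup G \<mm>"
    by (metis UnI1 UnI2 eq_iff_diff_eq_0 in_keys_iff)
qed

lemma mpoly_eval_add: "mpoly_eval (F + G) v = mpoly_eval F v + mpoly_eval G v"
proof -
  let ?S = "keys F \<union> keys G"
  have "keys (F + G) \<subseteq> ?S" by (rule Poly_Mapping.keys_add)
  then show ?thesis
    by (simp add: mpoly_eval_superset[of ?S] lookup_add distrib_right sum.distrib)
qed

lemma mpoly_eval_0: "mpoly_eval 0 v = 0"
  by (simp add: mpoly_eval_def)

lemma mpoly_eval_sum: "mpoly_eval (sum f I) v = (\<Sum>i\<in>I. mpoly_eval (f i) v)"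
  by (induction I rule: infinite_finite_induct) (auto simp: mpoly_eval_0 mpoly_eval_add)

lemma mpoly_eval_single: "mpoly_eval (single \<mm> a) v = a * monom_eval \<mm> v"
  using mpoly_eval_superset[of "{\<mm>}" "single \<mm> a" v] by simp

lemma poly_mapping_sum_single:
  "F = (\<Sum>\<mm>\<in>keys F. single \<mm> (lookup F \<mm>))"
proof (rule poly_mapping_eqI)
  fix \<nn>
  show "lookup F \<nn> =
    lookup (\<Sum>\<mm>\<in>keys F. single \<mm> (lookup F \<mm>)) \<nn>"
    by (cases "\<nn> \<in> keys F") (auto simp: lookup_sum lookup_single when_def in_keys_iff)
qed

lemma mpoly_eval_mult: "mpoly_eval (F * G) v = mpoly_eval F v * mpoly_eval G v"
proof -
  let ?f = "\<lambda>F \<mm>. single \<mm> (lookup F \<mm> :: complex)"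
  have "mpoly_eval (F * G) v = mpoly_eval (sum (?f F) (keys F) * sum (?f G) (keys G)) v"
    using poly_mapping_sum_single[of F] poly_mapping_sum_single[of G] by simp
  also have "\<dots> = (\<Sum>\<mm>\<in>keys F. \<Sum>\<nn>\<in>keys G.
      (lookup F \<mm> * monom_eval \<mm> v) * (lookup G \<nn> * monom_eval \<nn> v))"
    by (simp add: sum_product mult_single mpoly_eval_sum mpoly_eval_single monom_eval_add mult_ac)
  also have "\<dots> = mpoly_eval F v * mpoly_eval G v"
    by (simp add: sum_product[symmetric] mpoly_eval_superset[OF finite_keys order.refl])
  finally show ?thesis .
qed

lemma mpoly_eval_1: "mpoly_eval 1 v = 1"
  using mpoly_eval_single[of 0 1 v] by (simp add: monom_eval_0 single_one)

lemma mpoly_eval_power: "mpoly_eval (F ^ n) v = mpoly_eval F v ^ n"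
  by (induction n) (auto simp: mpoly_eval_1 mpoly_eval_mult)

lemma mpoly_eval_prod: "mpoly_eval (prod f I) v = (\<Prod>i\<in>I. mpoly_eval (f i) v)"
  by (induction I rule: infinite_finite_induct) (auto simp: mpoly_eval_1 mpoly_eval_mult)

text \<open>Row \<open>i\<close> of \<open>A\<close> replaces variable \<open>i\<close>, which on
  functions is composition with multiplication by \<open>A\<close>. From here on automorphisms are
  handled as invariances of functions.\<close>

lemma mpoly_eval_lin_subst: "mpoly_eval (lin_subst A F) v = mpoly_eval F (A *v v)"
proof -
  have "mpoly_eval (lin_subst A F) v = (\<Sum>\<mm>\<in>keys F. lookup F \<mm> *
     (\<Prod>i\<in>UNIV. (\<Sum>j\<in>UNIV. A $ i $ j * v $ j) ^ lookup \<mm> i))"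
    unfolding lin_subst_def
    by (simp add: mpoly_eval_sum mpoly_eval_mult mpoly_eval_prod mpoly_eval_power mpoly_eval_single
        monom_eval_0 monom_eval_single)
  also have "\<dots> = mpoly_eval F (A *v v)"
    by (simp add: mpoly_eval_def matrix_vector_mult_def)
  finally show ?thesis .
qed

lemma Aut_eval: "A \<in> Aut F \<Longrightarrow> mpoly_eval F (A *v v) = mpoly_eval F v"
  unfolding Aut_def by (metis (mono_tags, lifting) mem_Collect_eq mpoly_eval_lin_subst)

text \<open>Otherwise all partial derivatives of \<open>F\<close> vanish at the basis vector of index \<open>a\<close>.\<close>

lemma smooth_form_monomial:
  assumes hom: "homogeneous d F" and smooth: "smooth_form F" and d: "d > 0"
  shows "\<exists>b. single a (d - 1) + single b 1 \<in> keys F"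
proof -
  have "axis a (1::complex) \<noteq> 0" by (simp add: axis_eq_0_iff)
  then have "axis a 1 \<notin> {v. \<forall>k. mpoly_eval (mpoly_pderiv k F) v = 0}"
    using smooth unfolding smooth_form_def by (metis singletonD)
  then obtain b where b: "mpoly_eval (mpoly_pderiv b F) (axis a 1) \<noteq> 0" by auto
  have "mpoly_eval (mpoly_pderiv b F) (axis a 1) = (\<Sum>\<mm>\<in>keys F.
     of_nat (lookup \<mm> b) * lookup F \<mm>
       * monom_eval (\<mm> - single b 1) (axis a 1))"
    unfolding mpoly_pderiv_def by (simp add: mpoly_eval_sum mpoly_eval_single)
  then obtain \<mm> where \<mm>: "\<mm> \<in> keys F" "lookup \<mm> b \<noteq> 0"
    "monom_eval (\<mm> - single b 1) (axis a 1) \<noteq> 0"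
    using b by (metis (no_types, lifting) mult_eq_0_iff of_nat_0 sum.neutral)
  let ?n = "\<mm> - single b 1"
  have n0: "lookup ?n k = 0" if "k \<noteq> a" for k
  proof (rule ccontr)
    assume "lookup ?n k \<noteq> 0"
    then have "(axis a (1::complex) $ k) ^ lookup ?n k = 0"
      using that by (simp add: axis_def)
    then have "monom_eval ?n (axis a 1) = 0" unfolding monom_eval_def by (auto intro: prod_zero)
    then show False using \<mm> by simp
  qed
  \<comment> \<open>Subtraction of exponents is truncated at 0; the monomial can be recovered
    because the exponent of \<open>b\<close> is positive.\<close>
  have m_eq: "\<mm> = ?n + single b 1"
    using \<mm>(2) by (intro poly_mapping_eqI) (auto simp: lookup_add lookup_minus lookup_single when_def)
  have n_eq: "?n = single a (lookup ?n a)"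
    using n0 by (intro poly_mapping_eqI) (auto simp: lookup_single when_def)
  have "d = (\<Sum>k\<in>UNIV. lookup \<mm> k)" using hom \<mm> by (simp add: homogeneous_def)
  also have "\<dots> = (\<Sum>k\<in>UNIV. lookup ?n k) + (\<Sum>k\<in>UNIV. lookup (single b 1) k)"
    using arg_cong[OF m_eq, of "\<lambda>m. \<Sum>k\<in>UNIV. lookup m k"]
    by (simp only: lookup_add sum.distrib)
  also have "(\<Sum>k\<in>UNIV. lookup ?n k) = (\<Sum>k\<in>UNIV. if k = a then lookup ?n a else 0)"
    using n0 by (intro sum.cong) auto
  also have "\<dots> + (\<Sum>k\<in>UNIV. lookup (single b 1) k) = lookup ?n a + 1"
    by (simp add: lookup_single when_def)
  finally have "lookup ?n a = d - 1" by simp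
  then show ?thesis using \<mm>(1) m_eq n_eq by metis
qed

text \<open>A diagonal substitution multiplies each monomial by its own value at the diagonal, so
  invariance can be read off coefficient by coefficient.\<close>

lemma torus_fixes_monomial:
  assumes "\<And>v. mpoly_eval F (\<chi> k. t k * v $ k) = mpoly_eval F v" "\<mm> \<in> keys F"
  shows "monom_eval \<mm> (\<chi> k. t k) = 1"
proof -
  have "\<forall>\<nn>\<in>keys F. lookup F \<nn> * (monom_eval \<nn> (\<chi> k. t k) - 1) = 0"
  proof (rule monomials_independent)
    fix v
    have "0 = mpoly_eval F (\<chi> k. t k * v $ k) - mpoly_eval F v" using assms by simp
    also have "\<dots> = (\<Sum>\<nn>\<in>keys F. lookup F \<nn> * (monom_eval \<nn> (\<chi> k. t k) - 1) * monom_eval \<nn> v)"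
      using monom_eval_mult[of _ "\<chi> k. t k" v]
      by (simp add: mpoly_eval_superset[of "keys F"] sum_subtractf[symmetric] algebra_simps)
    finally show "(\<Sum>\<nn>\<in>keys F. lookup F \<nn> * (monom_eval \<nn> (\<chi> k. t k) - 1) * monom_eval \<nn> v) = 0"
      by simp
  qed simp
  then show ?thesis using assms(2) by (auto simp: in_keys_iff)
qed

section \<open>Counting the solutions of the monomial equations\<close>

lemma card_le_fibres:
  assumes "finite T" "f ` S \<subseteq> T" "\<And>y. y \<in> T \<Longrightarrow> finite {x \<in> S. f x = y} \<and> card {x \<in> S. f x = y} \<le> c"
  shows "finite S \<and> card S \<le> c * card T"
proof -
  have S: "S = (\<Union>y\<in>T. {x \<in> S. f x = y})" using assms(2) by auto
  have "finite S" by (subst S) (use assms in auto)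
  moreover have "card S \<le> c * card T"
  proof -
    have "card S \<le> (\<Sum>y\<in>T. card {x \<in> S. f x = y})"
      using card_UN_le[OF assms(1), of "\<lambda>y. {x \<in> S. f x = y}"] S by simp
    also have "\<dots> \<le> (\<Sum>y\<in>T. c)" using assms(3) by (intro sum_mono) auto
    finally show ?thesis by (simp add: mult.commute)
  qed
  ultimately show ?thesis by simp
qed

text \<open>The unknowns are the scalars on the blocks. The equation at \<open>i\<close> says that a
  monomial \<open>x ^ (d - 1) * y\<close> is fixed, with \<open>x\<close> in block \<open>i\<close>
  and \<open>y\<close> in block \<open>\<sigma> i\<close>.\<close>

definition torus_solutions :: "nat \<Rightarrow> ('i \<Rightarrow> 'i) \<Rightarrow> 'i set \<Rightarrow> ('i \<Rightarrow> complex) set" where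
  "torus_solutions d \<sigma> I = {t \<in> extensional I. \<forall>i\<in>I. t (\<sigma> i) * t i ^ (d - 1) = 1}"

lemma torus_solutions_restrict:
  assumes "t \<in> torus_solutions d \<sigma> I" "J \<subseteq> I" "\<sigma> ` J \<subseteq> J"
  shows "restrict t J \<in> torus_solutions d \<sigma> J"
  using assms by (auto simp: torus_solutions_def)

text \<open>Each step of \<open>\<sigma>\<close> raises to the power \<open>1 - d\<close>, so
  \<open>n\<close> steps give the exponent \<open>(1 - d) ^ n\<close>. Its sign depends on the
  parity of \<open>n\<close> and is expressed by \<open>inverse\<close> to stay with natural
  exponents.\<close>

lemma torus_solutions_iterate:
  assumes t: "t \<in> torus_solutions d \<sigma> I" and \<sigma>: "\<sigma> ` I \<subseteq> I" and i: "i \<in> I"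
  shows "t ((\<sigma> ^^ n) i) = (if even n then t i ^ ((d - 1) ^ n) else inverse (t i ^ ((d - 1) ^ n)))"
proof (induction n)
  case (Suc n)
  have "(\<sigma> ^^ n) i \<in> I" by (induction n) (use \<sigma> i in auto)
  then have "t (\<sigma> ((\<sigma> ^^ n) i)) * t ((\<sigma> ^^ n) i) ^ (d - 1) = 1" using t by (auto simp: torus_solutions_def)
  then have "t ((\<sigma> ^^ Suc n) i) = inverse (t ((\<sigma> ^^ n) i) ^ (d - 1))"
    by (metis comp_apply funpow.simps(2) inverse_unique mult.commute inverse_inverse_eq)
  then show ?case using Suc by (simp add: power_mult[symmetric] power_inverse mult.commute)
qed simp

text \<open>The induction step common to both cases below. Solutions are fibred over their
  restrictions to a stable subset \<open>J\<close>; a fibre embeds through the value at the single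
  point \<open>i\<close>, for which \<open>R\<close> lists the candidates.\<close>

lemma card_torus_solutions_step:
  assumes J: "J \<subseteq> I" "\<sigma> ` J \<subseteq> J" and I: "finite I"
    and IH: "finite (torus_solutions d \<sigma> J)" "card (torus_solutions d \<sigma> J) \<le> d ^ card J"
    and det: "\<And>t t'. t \<in> torus_solutions d \<sigma> I \<Longrightarrow> t' \<in> torus_solutions d \<sigma> I \<Longrightarrow>
      (\<And>x. x \<in> J \<Longrightarrow> t x = t' x) \<Longrightarrow> t i = t' i \<Longrightarrow> \<forall>x\<in>I. t x = t' x"
    and R: "\<And>u. u \<in> torus_solutions d \<sigma> J \<Longrightarrow> finite (R u) \<and> card (R u) \<le> d ^ card (I - J)"
      "\<And>t. t \<in> torus_solutions d \<sigma> I \<Longrightarrow> t i \<in> R (restrict t J)"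
  shows "finite (torus_solutions d \<sigma> I) \<and> card (torus_solutions d \<sigma> I) \<le> d ^ card I"
proof -
  have "finite (torus_solutions d \<sigma> I) \<and>
      card (torus_solutions d \<sigma> I) \<le> d ^ card (I - J) * card (torus_solutions d \<sigma> J)"
  proof (rule card_le_fibres[where f = "\<lambda>t. restrict t J"])
    show "finite (torus_solutions d \<sigma> J)" by (rule IH)
    show "(\<lambda>t. restrict t J) ` torus_solutions d \<sigma> I \<subseteq> torus_solutions d \<sigma> J"
      using torus_solutions_restrict[OF _ J] by blast
    fix u assume u: "u \<in> torus_solutions d \<sigma> J"
    let ?S = "{t \<in> torus_solutions d \<sigma> I. restrict t J = u}"
    have "inj_on (\<lambda>t. t i) ?S"
    proof (rule inj_onI)
      fix t t' assume t: "t \<in> ?S" "t' \<in> ?S" "t i = t' i"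
      have "\<forall>x\<in>I. t x = t' x"
      proof (rule det)
        show "t x = t' x" if "x \<in> J" for x
          using t that by (metis (mono_tags, lifting) mem_Collect_eq restrict_apply')
      qed (use t in auto)
      then show "t = t'" using t by (intro extensionalityI[of _ I]) (auto simp: torus_solutions_def)
    qed
    moreover have "(\<lambda>t. t i) ` ?S \<subseteq> R u" using R(2) by auto
    ultimately have "finite ?S" "card ?S \<le> card (R u)"
      using R(1)[OF u] by (auto intro: inj_on_finite card_inj_on_le)
    then show "finite ?S \<and> card ?S \<le> d ^ card (I - J)" using R(1)[OF u] by simp
  qed
  moreover have "d ^ card (I - J) * card (torus_solutions d \<sigma> J) \<le> d ^ card (I - J) * d ^ card J"
    using IH by simp
  moreover have "card I = card (I - J) + card J"
    using card_Diff_subset[OF finite_subset[OF J(1) I] J(1)] card_mono[OF I J(1)] by simp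
  ultimately show ?thesis by (metis order_trans power_add)
qed

text \<open>On an orbit of length \<open>c\<close> a solution is determined by its value \<open>z\<close> at one point, and going round
  the orbit gives \<open>z = z powi ((1 - d) ^ c)\<close>, which has at most \<open>(d - 1) ^ c + 1\<close> solutions.\<close>

lemma card_torus_solutions_orbit:
  assumes d: "d \<ge> 3" and I: "finite I" "\<sigma> ` I = I" and i: "i \<in> I"
    and IH: "\<And>J. J \<subset> I \<Longrightarrow> \<sigma> ` J \<subseteq> J \<Longrightarrow>
      finite (torus_solutions d \<sigma> J) \<and> card (torus_solutions d \<sigma> J) \<le> d ^ card J"
  shows "finite (torus_solutions d \<sigma> I) \<and> card (torus_solutions d \<sigma> I) \<le> d ^ card I"
proof -
  have inj: "inj_on \<sigma> I" using I by (simp add: finite_surj_inj)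
  have orb: "(\<sigma> ^^ n) i \<in> I" for n by (induction n) (use I i in auto)
  \<comment> \<open>Injectivity allows steps to be undone, so the orbit of \<open>i\<close> is a
    cycle without a tail.\<close>
  have cancel: "(\<sigma> ^^ p) i = i" if "(\<sigma> ^^ n) i = (\<sigma> ^^ (n + p)) i" for n p
    using that
  proof (induction n)
    case (Suc n)
    then have "\<sigma> ((\<sigma> ^^ n) i) = \<sigma> ((\<sigma> ^^ (n + p)) i)" by simp
    then show ?case using inj_onD[OF inj _ orb orb] Suc.IH by blast
  qed simp
  have "\<exists>n>0. (\<sigma> ^^ n) i = i"
  proof -
    have "\<not> inj_on (\<lambda>n. (\<sigma> ^^ n) i) (UNIV :: nat set)"
    proof
      assume "inj_on (\<lambda>n. (\<sigma> ^^ n) i) (UNIV :: nat set)"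
      moreover have "finite (range (\<lambda>n. (\<sigma> ^^ n) i))"
        using orb I finite_subset[of "range (\<lambda>n. (\<sigma> ^^ n) i)" I] by auto
      ultimately show False using finite_imageD infinite_UNIV_nat by blast
    qed
    then obtain n m where "n < m" "(\<sigma> ^^ n) i = (\<sigma> ^^ m) i"
      unfolding inj_on_def by (metis linorder_neqE_nat)
    then show ?thesis using cancel[of n "m - n"] by (intro exI[of _ "m - n"]) auto
  qed
  define c where "c = (LEAST n. n > 0 \<and> (\<sigma> ^^ n) i = i)"
  have c: "c > 0" "(\<sigma> ^^ c) i = i"
    using LeastI_ex[OF \<open>\<exists>n>0. (\<sigma> ^^ n) i = i\<close>] by (auto simp: c_def)
  have least: "\<not> (n > 0 \<and> (\<sigma> ^^ n) i = i)" if "n < c" for n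
    using that not_less_Least unfolding c_def by blast
  define Orb where "Orb = (\<lambda>n. (\<sigma> ^^ n) i) ` {..<c}"
  have "inj_on (\<lambda>n. (\<sigma> ^^ n) i) {..<c}"
  proof (rule linorder_inj_onI)
    fix n m assume nm: "n < m" "n \<in> {..<c}" "m \<in> {..<c}"
    show "(\<sigma> ^^ n) i \<noteq> (\<sigma> ^^ m) i"
    proof
      assume "(\<sigma> ^^ n) i = (\<sigma> ^^ m) i"
      then have "(\<sigma> ^^ (m - n)) i = i" using cancel[of n "m - n"] nm by simp
      moreover have "0 < m - n" "m - n < c" using nm by auto
      ultimately show False using least[of "m - n"] by blast
    qed
  qed auto
  then have cardO: "card Orb = c" by (simp add: Orb_def card_image)
  have OI: "Orb \<subseteq> I" using orb by (auto simp: Orb_def)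
  have iO: "i \<in> Orb" using c by (auto simp: Orb_def intro!: image_eqI[of _ _ 0])
  \<comment> \<open>No point outside the orbit maps into it, hence the complement is stable under
    \<open>\<sigma>\<close>. The predecessor of \<open>i\<close> itself is the last point of the
    cycle, which is the case \<open>n = 0\<close>.\<close>
  have pre_orb: "x \<in> Orb" if x: "x \<in> I" "\<sigma> x \<in> Orb" for x
  proof -
    obtain n where n: "n < c" "\<sigma> x = (\<sigma> ^^ n) i" using x by (auto simp: Orb_def)
    define p where "p = (if n = 0 then c - 1 else n - 1)"
    have p: "p < c" "\<sigma> ((\<sigma> ^^ p) i) = (\<sigma> ^^ n) i"
      using n c by (cases c; cases n; auto simp: p_def)+
    have "x = (\<sigma> ^^ p) i" using inj_onD[OF inj _ x(1) orb] n p by metis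
    then show ?thesis using p by (auto simp: Orb_def)
  qed
  let ?J = "I - Orb"
  have J: "?J \<subset> I" "\<sigma> ` ?J \<subseteq> ?J" using iO OI I pre_orb by auto
  note IHJ = IH[OF J]
  \<comment> \<open>The absolute value of \<open>(1 - d) ^ c - 1\<close>, so that going round the
    orbit becomes \<open>z ^ N = 1\<close>.\<close>
  define N where "N = (if even c then (d - 1) ^ c - 1 else (d - 1) ^ c + 1)"
  \<comment> \<open>Here \<open>d >= 3\<close> matters: for \<open>d = 2\<close> and even
    \<open>c\<close> the exponent \<open>N\<close> would be 0 and the equation
    \<open>z ^ N = 1\<close> would have infinitely many solutions.\<close>
  have pow_c: "(d - 1) ^ c > 1" using d c by (intro one_less_power) auto
  have N0: "N > 0" using pow_c by (simp add: N_def)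
  \<comment> \<open>The chain ends in \<open>(d - 1) ^ c + 1 <= d ^ c\<close>, with equality for
    \<open>c = 1\<close>: a fixed point of \<open>\<sigma>\<close> gives exactly the
    \<open>d\<close>-th roots of unity.\<close>
  have "N \<le> (d - 1) ^ c + 1" unfolding N_def by (split if_split) linarith
  also have "\<dots> \<le> d ^ c"
    using c(1)
  proof (induction c rule: nat_induct_non_zero)
    case (Suc c)
    have "(d - 1) ^ Suc c + 1 \<le> (d - 1) * ((d - 1) ^ c + 1) + 1 * ((d - 1) ^ c + 1)"
      by (simp add: distrib_left)
    also have "\<dots> = d * ((d - 1) ^ c + 1)" using d by (simp only: distrib_right[symmetric]) simp
    also have "\<dots> \<le> d * d ^ c" using Suc.IH by (rule mult_le_mono2)
    also have "\<dots> = d ^ Suc c" by simp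
    finally show ?case .
  qed (use d in simp)
  finally have N_le: "N \<le> d ^ c" .
  have root: "t i ^ N = 1" if t: "t \<in> torus_solutions d \<sigma> I" for t
  proof -
    have nz: "t i \<noteq> 0"
      using t i d by (auto simp: torus_solutions_def power_0_left)
    have it: "t i = (if even c then t i ^ ((d - 1) ^ c) else inverse (t i ^ ((d - 1) ^ c)))"
      using torus_solutions_iterate[OF t _ i, of c] c I by simp
    show ?thesis
    proof (cases "even c")
      case True
      then have N: "Suc N = (d - 1) ^ c" using pow_c by (simp add: N_def)
      have "t i * t i ^ N = t i ^ ((d - 1) ^ c)" by (simp only: N[symmetric] power_Suc)
      also have "\<dots> = t i * 1" using it True by simp
      finally have "t i * t i ^ N = t i * 1" .
      then show ?thesis using nz by (metis mult_left_cancel)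
    next
      case False
      then have "t i = inverse (t i ^ ((d - 1) ^ c))" using it by simp
      then have "t i * t i ^ ((d - 1) ^ c) = inverse (t i ^ ((d - 1) ^ c)) * t i ^ ((d - 1) ^ c)"
        by (rule arg_cong)
      also have "\<dots> = 1" using nz by (intro left_inverse) simp
      finally show ?thesis using False by (simp add: N_def)
    qed
  qed
  show ?thesis
  proof (rule card_torus_solutions_step[where J = ?J and i = i and R = "\<lambda>_. {z. z ^ N = 1}"])
    show "?J \<subseteq> I" "\<sigma> ` ?J \<subseteq> ?J" using J by auto
    fix t t' assume t: "t \<in> torus_solutions d \<sigma> I" "t' \<in> torus_solutions d \<sigma> I"
      "\<And>x. x \<in> ?J \<Longrightarrow> t x = t' x" "t i = t' i"
    show "\<forall>x\<in>I. t x = t' x"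
    proof
      fix x assume x: "x \<in> I"
      show "t x = t' x"
      proof (cases "x \<in> Orb")
        case True
        then obtain n where "x = (\<sigma> ^^ n) i" by (auto simp: Orb_def)
        then show ?thesis using t torus_solutions_iterate[of t d \<sigma> I i n]
            torus_solutions_iterate[of t' d \<sigma> I i n] I i by auto
      qed (use t(3) x in auto)
    qed
  next
    have "card {z::complex. z ^ N = 1} \<le> N" using N0 by (intro card_roots_unity) auto
    moreover have "I - ?J = Orb" using OI by auto
    ultimately show "finite {z::complex. z ^ N = 1} \<and> card {z::complex. z ^ N = 1} \<le> d ^ card (I - ?J)"
      using N_le N0 cardO by (auto intro: finite_roots_unity)
  qed (use IHJ I root in auto)
qed

text \<open>A point \<open>j\<close> outside the image of \<open>\<sigma>\<close> occurs in its own
  equation only, so its value is one of at most \<open>d - 1\<close> roots determined by the rest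
  and \<open>j\<close> can be removed. Once no such point is left, \<open>\<sigma>\<close> permutes
  the finite set and a whole orbit is removed.\<close>

lemma card_torus_solutions:
  assumes d: "d \<ge> 3" and "finite I" "\<sigma> ` I \<subseteq> I"
  shows "finite (torus_solutions d \<sigma> I) \<and> card (torus_solutions d \<sigma> I) \<le> d ^ card I"
  using assms(2,3)
proof (induction "card I" arbitrary: I rule: less_induct)
  case less
  have IH: "finite (torus_solutions d \<sigma> J) \<and> card (torus_solutions d \<sigma> J) \<le> d ^ card J"
    if "J \<subset> I" "\<sigma> ` J \<subseteq> J" for J
    using less that by (metis finite_subset psubset_card_mono psubset_imp_subset)
  show ?case
  proof (cases "\<sigma> ` I = I")
    case True
    show ?thesis
    proof (cases "I = {}")
      case True
      then have "torus_solutions d \<sigma> I = {\<lambda>_. undefined}" by (auto simp: torus_solutions_def)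
      then show ?thesis using True by simp
    next
      case False
      then obtain i where "i \<in> I" by auto
      then show ?thesis using card_torus_solutions_orbit[OF d less.prems(1) True] IH by blast
    qed
  next
    case False
    then obtain j where j: "j \<in> I" "j \<notin> \<sigma> ` I" using less.prems by auto
    let ?J = "I - {j}"
    have J: "?J \<subset> I" "\<sigma> ` ?J \<subseteq> ?J" using j less.prems by auto
    note IHJ = IH[OF J]
    show ?thesis
    proof (rule card_torus_solutions_step[where J = ?J and i = j and R = "\<lambda>u. {z. z ^ (d - 1) = inverse (u (\<sigma> j))}"])
      show "?J \<subseteq> I" "\<sigma> ` ?J \<subseteq> ?J" using J by auto
      have IJ: "I - ?J = {j}" using j by auto
      fix u :: "'a \<Rightarrow> complex"
      show "finite {z. z ^ (d - 1) = inverse (u (\<sigma> j))} \<and> card {z. z ^ (d - 1) = inverse (u (\<sigma> j))} \<le> d ^ card (I - ?J)"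
      \<comment> \<open>With \<open>inverse 0 = 0\<close> a vanishing value leaves the single
        candidate 0, so the bound holds for it as well.\<close>
      proof (cases "u (\<sigma> j) = 0")
        case True
        then show ?thesis using d by (simp add: IJ power_0_left)
      next
        case False
        then show ?thesis using d card_nth_roots[of "inverse (u (\<sigma> j))" "d - 1"]
          by (auto simp: IJ intro!: finite_nth_roots)
      qed
    next
      fix t assume t: "t \<in> torus_solutions d \<sigma> I"
      have "\<sigma> j \<in> ?J" using j less.prems by (metis Diff_iff imageI insertE singletonD subsetD empty_iff)
      moreover have "t (\<sigma> j) * t j ^ (d - 1) = 1" using t j by (simp add: torus_solutions_def)
      ultimately show "t j \<in> {z. z ^ (d - 1) = inverse (restrict t ?J (\<sigma> j))}" by (simp add: inverse_unique)
    qed (use IHJ less.prems in auto)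
  qed
qed

section \<open>Groups permuting the blocks of a decomposition\<close>

lemma (in group_hom) normal_image:
  assumes S: "subgroup S G" and T: "subgroup T G" "T \<subseteq> S"
    and conj: "\<And>s t. s \<in> S \<Longrightarrow> t \<in> T \<Longrightarrow> s \<otimes> t \<otimes> inv s \<in> T"
  shows "(h ` T) \<lhd> (H\<lparr>carrier := h ` S\<rparr>)"
proof -
  have hS: "subgroup (h ` S) H" and hT: "subgroup (h ` T) H"
    using S T subgroup_img_is_subgroup by blast+
  interpret I: group "H\<lparr>carrier := h ` S\<rparr>" by (rule H.subgroup_imp_group[OF hS])
  have "subgroup (h ` T) (H\<lparr>carrier := h ` S\<rparr>)"
    using T by (intro H.subgroup_incl[OF hT hS] image_mono)
  moreover have "h s \<otimes>\<^bsub>H\<^esub> h t \<otimes>\<^bsub>H\<^esub> inv\<^bsub>H\<^esub> (h s) \<in> h ` T" if "s \<in> S" "t \<in> T" for s t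
  proof -
    have st: "s \<in> carrier G" "t \<in> carrier G"
      using that subgroup.mem_carrier[OF S] subgroup.mem_carrier[OF T(1)] by auto
    then have "h s \<otimes>\<^bsub>H\<^esub> h t \<otimes>\<^bsub>H\<^esub> inv\<^bsub>H\<^esub> (h s) = h (s \<otimes> t \<otimes> inv s)" by simp
    then show ?thesis using conj[OF that] by simp
  qed
  ultimately show ?thesis
    using H.m_inv_consistent[OF hS] by (auto simp: I.normal_inv_iff)
qed

text \<open>Left translation by the inverse of one point embeds a fibre into \<open>Q\<close>. Used
  for each of the three steps from \<open>G\<close> down to \<open>Q\<close>; as \<open>f\<close> is
  an arbitrary function, it may be built from choices, like the permutation of the blocks.\<close>

lemma (in group) card_le_coset_fibres:
  assumes S: "finite S" "S \<subseteq> carrier G" and T: "finite T" "f ` S \<subseteq> T" and Q: "finite Q"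
    and fibre: "\<And>x y. x \<in> S \<Longrightarrow> y \<in> S \<Longrightarrow> f x = f y \<Longrightarrow> inv x \<otimes> y \<in> Q"
  shows "card S \<le> card Q * card T"
proof -
  have "finite S \<and> card S \<le> card Q * card T"
  proof (rule card_le_fibres[OF T])
    fix y assume "y \<in> T"
    show "finite {x \<in> S. f x = y} \<and> card {x \<in> S. f x = y} \<le> card Q"
    proof (cases "{x \<in> S. f x = y} = {}")
      case True
      then show ?thesis by (metis card.empty finite.emptyI le0)
    next
      case False
      then obtain x where x: "x \<in> S" "f x = y" by auto
      have "inj_on (\<lambda>z. inv x \<otimes> z) {x \<in> S. f x = y}"
        using S x by (intro inj_onI) (auto simp: subset_iff)
      moreover have "(\<lambda>z. inv x \<otimes> z) ` {x \<in> S. f x = y} \<subseteq> Q"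
        using fibre x by auto
      ultimately show ?thesis using card_inj_on_le Q S by auto
    qed
  qed
  then show ?thesis by simp
qed

lemma (in complex_space) direct_sum_subset:
  assumes ds: "direct_sum I U W" and i: "i \<in> I"
  shows "U i \<subseteq> W"
proof
  fix x assume x: "x \<in> U i"
  have "(\<Sum>l\<in>I. if l = i then x else 0) \<in> W"
    using x direct_sumD(2)[OF ds] subspace_0 by (intro direct_sumD(3)[OF ds]) auto
  then show "x \<in> W" using direct_sumD(1)[OF ds] i by simp
qed

lemma (in complex_space) direct_sum_Int:
  assumes ds: "direct_sum I U W" and ij: "i \<in> I" "j \<in> I" "i \<noteq> j" and x: "x \<in> U i" "x \<in> U j"
  shows "x = 0"
proof -
  let ?u = "\<lambda>l. (if l = i then x else 0) - (if l = j then x else 0)"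
  have "?u l \<in> U l" if "l \<in> I" for l
    using direct_sumD(2)[OF ds that] x by (intro subspace_diff) (auto simp: subspace_0)
  moreover have "sum ?u I = 0" using direct_sumD(1)[OF ds] ij by (simp add: sum_subtractf)
  ultimately have "?u i = 0" using direct_sumD(5)[OF ds, of ?u i] ij(1) by blast
  then show ?thesis using ij(3) by simp
qed

section \<open>Invertible matrices and the coordinate blocks of a decomposition\<close>

lemma group_GL_mat: "group (GL_mat :: (complex ^ 'n ^ 'n) monoid)"
proof (rule groupI)
  fix x :: "complex ^ 'n ^ 'n" assume "x \<in> carrier GL_mat"
  then obtain y where "x ** y = mat 1" "y ** x = mat 1" by (auto simp: GL_mat_def invertible_def)
  then show "\<exists>y\<in>carrier GL_mat. y \<otimes>\<^bsub>GL_mat\<^esub> x = \<one>\<^bsub>GL_mat\<^esub>"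
    by (intro bexI[of _ y]) (auto simp: GL_mat_def invertible_def)
next
  have "invertible (mat 1 :: complex ^ 'n ^ 'n)" by (auto simp: invertible_def intro: exI[of _ "mat 1"])
  then show "\<one>\<^bsub>GL_mat\<^esub> \<in> carrier (GL_mat :: (complex ^ 'n ^ 'n) monoid)" by (simp add: GL_mat_def)
qed (auto simp: GL_mat_def invertible_mult matrix_mul_assoc)

interpretation GLm: group "GL_mat :: (complex ^ 'n ^ 'n) monoid" by (rule group_GL_mat)

abbreviation minv :: "complex ^ 'n ^ 'n \<Rightarrow> complex ^ 'n ^ 'n" where
  "minv \<equiv> m_inv GL_mat"

lemma GL_mat_mult [simp]: "A \<otimes>\<^bsub>GL_mat\<^esub> B = A ** B"
  by (simp add: GL_mat_def)

lemma GL_mat_inv_vec: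
  fixes A :: "complex ^ 'n ^ 'n"
  assumes "A \<in> carrier GL_mat"
  shows "(minv A) *v (A *v v) = v" "A *v ((minv A) *v v) = v"
proof -
  have "(minv A) ** A = mat 1" "A ** (minv A) = mat 1"
    using GLm.l_inv[OF assms] GLm.r_inv[OF assms] by (simp_all add: GL_mat_def)
  then show "(minv A) *v (A *v v) = v" "A *v ((minv A) *v v) = v"
    by (simp_all add: matrix_vector_mul_assoc)
qed

lemma GL_mat_inj:
  assumes "A \<in> carrier GL_mat"
  shows "A *v v = A *v w \<longleftrightarrow> v = w"
  using GL_mat_inv_vec(1)[OF assms] by metis

lemma coords_coord_subspace [simp]: "coords (coord_subspace D) = D"
  by (auto simp: coords_def coord_subspace_def axis_def)

locale block_decomposition =
  fixes G :: "(complex ^ 'n ^ 'n) set" and m :: nat and k :: "nat \<Rightarrow> nat"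
    and V :: "nat \<Rightarrow> (complex ^ 'n::finite) set" and W :: "nat \<Rightarrow> nat \<Rightarrow> (complex ^ 'n) set"
  assumes dec: "decomposition_data G m k V W" and compat: "compatible_basis m k W"
begin

definition blocks :: "(nat \<times> nat) set" where
  "blocks = (SIGMA i:{1..m}. {1..k i})"

definition U :: "nat \<times> nat \<Rightarrow> (complex ^ 'n) set" where
  "U p = W (fst p) (snd p)"

definition C :: "nat \<times> nat \<Rightarrow> 'n set" where
  "C p = coords (U p)"

lemma finite_blocks: "finite blocks"
  by (simp add: blocks_def)

lemma card_blocks: "card blocks = (\<Sum>i=1..m. k i)"
  by (simp add: blocks_def)

lemma G: "subgroup G GL_mat" "finite G"
  using dec by (auto simp: decomposition_data_def)

lemma G_carrier: "A \<in> G \<Longrightarrow> A \<in> carrier GL_mat"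
  using G subgroup.mem_carrier by metis

lemma primitive: "p \<in> blocks \<Longrightarrow> cvec.primitive_GL (U p) (restrict_to (U p) (Stab G (U p)))"
  using dec unfolding decomposition_data_def blocks_def U_def by auto

text \<open>The basis of a block is a subset of the standard basis, so blocks become sets of
  variables; all later computations with coordinates rest on this.\<close>

lemma U_eq:
  assumes "p \<in> blocks"
  shows "U p = coord_subspace (C p)"
proof -
  obtain B where B: "\<forall>i\<in>{1..m}. \<forall>j\<in>{1..k i}. vec.independent (B i j) \<and> vec.span (B i j) = W i j"
    "(\<Union>i\<in>{1..m}. \<Union>j\<in>{1..k i}. B i j) = cart_basis"
    using compat by (auto simp: compatible_basis_def)
  have "B (fst p) (snd p) \<subseteq> cart_basis" "vec.span (B (fst p) (snd p)) = U p"
    using B assms by (auto simp: blocks_def U_def)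
  moreover obtain D where "B (fst p) (snd p) = (\<lambda>i. axis i 1) ` D"
    using \<open>B (fst p) (snd p) \<subseteq> cart_basis\<close> by (metis (no_types) cart_basis_def full_SetCompr_eq subset_imageE Setcompr_eq_image)
  ultimately have "U p = coord_subspace D" by (simp add: span_axis)
  then show ?thesis by (simp add: C_def)
qed

lemma C_cover: "(\<Union>p\<in>blocks. C p) = UNIV"
proof -
  obtain B where B: "\<forall>i\<in>{1..m}. \<forall>j\<in>{1..k i}. vec.independent (B i j) \<and> vec.span (B i j) = W i j"
    "(\<Union>i\<in>{1..m}. \<Union>j\<in>{1..k i}. B i j) = cart_basis"
    using compat by (auto simp: compatible_basis_def)
  have "\<exists>p\<in>blocks. x \<in> C p" for x
  proof -
    have "axis x 1 \<in> (\<Union>i\<in>{1..m}. \<Union>j\<in>{1..k i}. B i j)" unfolding B(2) by (auto simp: cart_basis_def)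
    then obtain i j where ij: "i \<in> {1..m}" "j \<in> {1..k i}" "axis x 1 \<in> B i j" by auto
    then have "axis x 1 \<in> W i j" using B(1) vec.span_base by blast
    then show ?thesis using ij by (intro bexI[of _ "(i, j)"]) (auto simp: C_def U_def coords_def blocks_def)
  qed
  then show ?thesis by auto
qed

lemma U_Int:
  assumes p: "p \<in> blocks" and q: "q \<in> blocks" and pq: "p \<noteq> q" and x: "x \<in> U p" "x \<in> U q"
  shows "x = 0"
proof -
  have dsV: "cvec.direct_sum {1..m} V UNIV" and
    dsW: "\<And>i. i \<in> {1..m} \<Longrightarrow> cvec.direct_sum {1..k i} (W i) (V i)"
    using dec by (auto simp: decomposition_data_def)
  show ?thesis
  proof (cases "fst p = fst q")
    case True
    then have "snd p \<noteq> snd q" using pq by (simp add: prod_eq_iff)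
    then show ?thesis
      using cvec.direct_sum_Int[OF dsW, of "fst p" "snd p" "snd q" x] p q x True
      by (simp add: blocks_def U_def mem_Times_iff mem_Sigma_iff split_beta) (auto simp: blocks_def U_def)
  next
    case False
    have "x \<in> V (fst p)" "x \<in> V (fst q)"
      using cvec.direct_sum_subset[OF dsW, of "fst p" "snd p"] cvec.direct_sum_subset[OF dsW, of "fst q" "snd q"] p q x
      by (auto simp: blocks_def U_def)
    then show ?thesis
      using cvec.direct_sum_Int[OF dsV, of "fst p" "fst q" x] False p q by (auto simp: blocks_def)
  qed
qed

lemma C_disjoint: "p \<in> blocks \<Longrightarrow> q \<in> blocks \<Longrightarrow> x \<in> C p \<Longrightarrow> x \<in> C q \<Longrightarrow> p = q"
  using U_Int[of p q "axis x 1"] by (auto simp: C_def coords_def axis_eq_0_iff)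

lemma U_neq_0: "p \<in> blocks \<Longrightarrow> U p \<noteq> {0}"
  using primitive by (auto simp: cvec.primitive_GL_def cvec.irreducible_action_def)

lemma C_nonempty:
  assumes "p \<in> blocks"
  shows "C p \<noteq> {}"
proof
  assume "C p = {}"
  then have "U p = {0}" using U_eq[OF assms] by (auto simp: coord_subspace_def vec_eq_iff)
  then show False using U_neq_0[OF assms] by simp
qed

definition block_of :: "'n \<Rightarrow> nat \<times> nat" where
  "block_of x = (THE p. p \<in> blocks \<and> x \<in> C p)"

lemma block_of: "block_of x \<in> blocks" "x \<in> C (block_of x)"
proof -
  have "\<exists>!p. p \<in> blocks \<and> x \<in> C p" using C_cover C_disjoint by blast
  then have "block_of x \<in> blocks \<and> x \<in> C (block_of x)" unfolding block_of_def by (rule theI')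
  then show "block_of x \<in> blocks" "x \<in> C (block_of x)" by auto
qed

lemma block_of_eq: "p \<in> blocks \<Longrightarrow> x \<in> C p \<Longrightarrow> block_of x = p"
  using C_disjoint block_of by blast

lemma card_C_sum: "(\<Sum>p\<in>blocks. card (C p)) = CARD('n)"
proof -
  have "card (\<Union>p\<in>blocks. C p) = (\<Sum>p\<in>blocks. card (C p))"
    using C_disjoint by (intro card_UN_disjoint) (auto simp: finite_blocks)
  then show ?thesis by (simp add: C_cover)
qed

lemma dim_U: "p \<in> blocks \<Longrightarrow> vec.dim (U p) = card (C p)"
  by (simp add: U_eq dim_coord_subspace)

lemma card_C_eq:
  assumes "(i, j) \<in> blocks" "(i, l) \<in> blocks"
  shows "card (C (i, j)) = card (C (i, l))"
proof -
  obtain A where A: "A \<in> G" "(*v) A ` W i j = W i l"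
    using dec assms unfolding decomposition_data_def blocks_def by blast
  have "vec.dim ((*v) A ` U (i, j)) = vec.dim (U (i, j))"
    using GL_mat_inj[OF G_carrier[OF A(1)]]
    by (intro vec.dim_image_eq matrix_vector_mul_linear_gen inj_onI) auto
  then show ?thesis using A(2) assms by (simp add: U_def dim_U[symmetric])
qed

definition Hcard :: "nat \<times> nat \<Rightarrow> nat" where
  "Hcard p = card (H_group G (U p))"

lemma Stab_subset: "Stab G S \<subseteq> G" by (auto simp: Stab_def)

lemma Stab_subgroup: "subgroup (Stab G S) GL_mat"
proof (rule GLm.subgroupI)
  show "Stab G S \<subseteq> carrier GL_mat" using G_carrier by (auto simp: Stab_def)
  have "mat 1 \<in> Stab G S"
    using subgroup.one_closed[OF G(1)] by (auto simp: Stab_def GL_mat_def image_def)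
  then show "Stab G S \<noteq> {}" by auto
next
  fix A assume A: "A \<in> Stab G S"
  then have AG: "A \<in> G" "(*v) A ` S = S" by (auto simp: Stab_def)
  have "(*v) (minv A) ` S = (*v) (minv A) ` (*v) A ` S" using AG by simp
  also have "\<dots> = S" using GL_mat_inv_vec(1)[OF G_carrier[OF AG(1)]] by (simp add: image_image)
  finally show "minv A \<in> Stab G S"
    using subgroup.m_inv_closed[OF G(1) AG(1)] by (simp add: Stab_def)
next
  fix A B assume AB: "A \<in> Stab G S" "B \<in> Stab G S"
  have "(*v) (A ** B) ` S = (*v) A ` (*v) B ` S" by (simp add: image_image matrix_vector_mul_assoc)
  then show "A \<otimes>\<^bsub>GL_mat\<^esub> B \<in> Stab G S"
    using AB subgroup.m_closed[OF G(1), of A B] by (simp add: Stab_def)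
qed

definition act :: "nat \<times> nat \<Rightarrow> complex ^ 'n ^ 'n \<Rightarrow> complex ^ 'n \<Rightarrow> complex ^ 'n" where
  "act p A = restrict ((*v) A) (U p)"

lemma subspace_U: "p \<in> blocks \<Longrightarrow> vec.subspace (U p)"
  by (simp add: U_eq subspace_coord_subspace)

lemma act_GL:
  assumes p: "p \<in> blocks" and A: "A \<in> Stab G (U p)"
  shows "act p A \<in> carrier (cvec.GL (U p))"
proof -
  have A: "A \<in> carrier GL_mat" "(*v) A ` U p = U p" using A G_carrier by (auto simp: Stab_def)
  have "bij_betw (act p A) (U p) (U p)"
    using A GL_mat_inj by (auto simp: bij_betw_def inj_on_def act_def)
  then show ?thesis
    using vec.subspace_add[OF subspace_U[OF p]] vec.subspace_scale[OF subspace_U[OF p]]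
    by (auto simp: cvec.GL_carrier_iff act_def matrix_vector_right_distrib vector_scalar_commute)
qed

definition proj :: "nat \<times> nat \<Rightarrow> complex ^ 'n ^ 'n \<Rightarrow> (complex ^ 'n \<Rightarrow> complex ^ 'n) set" where
  "proj p A = cvec.proj_class (U p) (act p A)"

lemma PGL_image_restrict_to: "cvec.PGL_image (U p) (restrict_to (U p) S) = proj p ` S"
  by (simp add: cvec.PGL_image_eq restrict_to_def proj_def act_def image_image)

lemma H_group_eq: "H_group G (U p) = proj p ` Stab G (U p)"
  by (simp add: H_group_def PGL_image_restrict_to)

lemma proj_eq_iff:
  assumes p: "p \<in> blocks" and A: "A \<in> Stab G (U p)" and B: "B \<in> Stab G (U p)"
  shows "proj p A = proj p B \<longleftrightarrow> (\<exists>c. c \<noteq> 0 \<and> (\<forall>w\<in>U p. A *v w = c *s (B *v w)))"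
  using cvec.proj_class_eq_iff[OF subspace_U[OF p] act_GL[OF p A] act_GL[OF p B]]
  by (simp add: proj_def act_def)

text \<open>Only the stabiliser of a block acts on it, which is why it is the source of the
  homomorphism.\<close>

lemma proj_hom:
  assumes p: "p \<in> blocks"
  shows "group_hom (GL_mat\<lparr>carrier := Stab G (U p)\<rparr>) (cvec.PGL (U p)) (proj p)"
proof (intro group_hom.intro group_hom_axioms.intro GLm.subgroup_imp_group Stab_subgroup
    cvec.group_PGL subspace_U p homI)
  have hom: "cvec.proj_class (U p) \<in> hom (cvec.GL (U p)) (cvec.PGL (U p))"
    by (rule cvec.proj_class_hom) (rule subspace_U[OF p])
  show "proj p A \<in> carrier (cvec.PGL (U p))" if "A \<in> carrier (GL_mat\<lparr>carrier := Stab G (U p)\<rparr>)" for A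
    using that act_GL[OF p] hom by (auto simp: proj_def hom_def)
  fix A B assume "A \<in> carrier (GL_mat\<lparr>carrier := Stab G (U p)\<rparr>)" "B \<in> carrier (GL_mat\<lparr>carrier := Stab G (U p)\<rparr>)"
  then have A: "A \<in> Stab G (U p)" and B: "B \<in> Stab G (U p)" by auto
  have AB: "A ** B \<in> Stab G (U p)" using subgroup.m_closed[OF Stab_subgroup A B] by simp
  have "act p (A ** B) = act p A \<otimes>\<^bsub>cvec.GL (U p)\<^esub> act p B"
  proof (rule cvec.GL_ext[OF act_GL[OF p AB]])
    show "act p A \<otimes>\<^bsub>cvec.GL (U p)\<^esub> act p B \<in> carrier (cvec.GL (U p))"
      using group.is_monoid[OF cvec.group_GL[OF subspace_U[OF p]]] act_GL[OF p A] act_GL[OF p B]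
      by (rule monoid.m_closed)
    fix w assume w: "w \<in> U p"
    then have "B *v w \<in> U p" using B by (auto simp: Stab_def)
    then show "act p (A ** B) w = (act p A \<otimes>\<^bsub>cvec.GL (U p)\<^esub> act p B) w"
      using w act_GL[OF p A] act_GL[OF p B]
      by (simp add: cvec.GL_mult_apply) (simp add: act_def matrix_vector_mul_assoc)
  qed
  then show "proj p (A \<otimes>\<^bsub>GL_mat\<lparr>carrier := Stab G (U p)\<rparr>\<^esub> B) = proj p A \<otimes>\<^bsub>cvec.PGL (U p)\<^esub> proj p B"
    using hom_mult[OF hom act_GL[OF p A] act_GL[OF p B]] by (simp add: proj_def)
qed

text \<open>Positivity allows division by the index and by \<open>JC\<close>; the upper bound is the
  place where the finiteness behind \<open>JC\<close> is used.\<close>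

lemma Hcard_bounds:
  assumes p: "p \<in> blocks"
  shows "0 < Hcard p" "Hcard p \<le> JC (card (C p))"
proof -
  have "finite (Stab G (U p))" using finite_subset[OF Stab_subset G(2)] .
  moreover have "Stab G (U p) \<noteq> {}" using subgroup.one_closed[OF Stab_subgroup] by auto
  ultimately show "0 < Hcard p" by (simp add: Hcard_def H_group_eq card_gt_0_iff)
  show "Hcard p \<le> JC (card (C p))"
    using primitive_card_le_JC[of "C p" "restrict_to (U p) (Stab G (U p))"] primitive[OF p]
    by (simp add: Hcard_def H_group_def flip: U_eq[OF p])
qed

definition scalar_on :: "nat \<times> nat \<Rightarrow> complex ^ 'n ^ 'n \<Rightarrow> bool" where
  "scalar_on p A \<longleftrightarrow> (\<exists>c. \<forall>w\<in>U p. A *v w = c *s w)"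

lemma scalar_on_inv_mult:
  assumes p: "p \<in> blocks" and A: "A \<in> Stab G (U p)" and B: "B \<in> Stab G (U p)" and eq: "proj p A = proj p B"
  shows "scalar_on p (minv A ** B)"
proof -
  obtain c where c: "c \<noteq> 0" "\<forall>w\<in>U p. B *v w = c *s (A *v w)"
    using proj_eq_iff[OF p B A] eq by metis
  have "(minv A ** B) *v w = c *s w" if "w \<in> U p" for w
  proof -
    have "A \<in> carrier GL_mat" using A G_carrier by (auto simp: Stab_def)
    then show ?thesis
      using that c by (simp add: matrix_vector_mul_assoc[symmetric] vector_scalar_commute GL_mat_inv_vec)
  qed
  then show ?thesis by (auto simp: scalar_on_def)
qed

lemma scalar_on_mult: "scalar_on p A \<Longrightarrow> scalar_on p B \<Longrightarrow> scalar_on p (A ** B)"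
  unfolding scalar_on_def by (auto simp: matrix_vector_mul_assoc[symmetric] vector_scalar_commute vector_smult_assoc)

lemma scalar_on_nonzero:
  assumes p: "p \<in> blocks" and A: "A \<in> G" and c: "\<forall>w\<in>U p. A *v w = c *s w"
  shows "c \<noteq> 0"
proof -
  obtain w where "w \<in> U p" "w \<noteq> 0"
    using U_neq_0[OF p] vec.subspace_0[OF subspace_U[OF p]] by auto
  then show ?thesis using c GL_mat_inj[OF G_carrier[OF A], of w 0] by auto
qed

lemma scalar_on_inv:
  assumes p: "p \<in> blocks" and A: "A \<in> G" and s: "scalar_on p A"
  shows "scalar_on p (minv A)"
proof -
  obtain c where c: "\<forall>w\<in>U p. A *v w = c *s w" using s by (auto simp: scalar_on_def)
  have "(minv A) *v w = inverse c *s w" if w: "w \<in> U p" for w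
  proof -
    have "A *v (inverse c *s w) = w"
      using c w scalar_on_nonzero[OF p A c] by (simp add: vector_scalar_commute vector_smult_assoc)
    then show ?thesis using GL_mat_inv_vec(1)[OF G_carrier[OF A]] by metis
  qed
  then show ?thesis by (auto simp: scalar_on_def)
qed

definition P :: "(complex ^ 'n ^ 'n) set" where
  "P = P_group G m k W"

lemma P_eq: "P = (\<Inter>p\<in>blocks. Stab G (U p))"
  unfolding P_def P_group_def blocks_def U_def
  by auto

text \<open>Blocks are permuted only within the same \<open>V i\<close>, so the permutations lie in
  a product of symmetric groups, which gives the factors \<open>k i !\<close>. Without blocks
  \<open>P\<close> would be an empty intersection, that is, the set of all matrices.\<close>

lemma card_G_le: 
  assumes "blocks \<noteq> {}"
  shows "card G \<le> card P * (\<Prod>i=1..m. fact (k i))"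
proof -
  have inG: "\<exists>j'\<in>{1..k i}. (*v) A ` W i j = W i j'" if "A \<in> G" "i \<in> {1..m}" "j \<in> {1..k i}" for A i j
    using dec that unfolding decomposition_data_def by blast
  \<comment> \<open>The identity outside \<open>{1..k i}\<close> is what \<open>permutes\<close>
    requires.\<close>
  define \<pi> where "\<pi> A i j = (if j \<in> {1..k i} then SOME j'. j' \<in> {1..k i} \<and> (*v) A ` W i j = W i j' else j)" for A i j
  have \<pi>: "\<pi> A i j \<in> {1..k i} \<and> (*v) A ` W i j = W i (\<pi> A i j)" if "A \<in> G" "i \<in> {1..m}" "j \<in> {1..k i}" for A i j
  proof -
    have "\<exists>j'. j' \<in> {1..k i} \<and> (*v) A ` W i j = W i j'" using inG[OF that] by blast
    from someI_ex[OF this] show ?thesis using that(3) by (simp only: \<pi>_def if_True)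
  qed
  have W_inj: "j = l" if "i \<in> {1..m}" "j \<in> {1..k i}" "l \<in> {1..k i}" "W i j = W i l" for i j l
  proof -
    have b: "(i, j) \<in> blocks" "(i, l) \<in> blocks" using that by (auto simp: blocks_def)
    have "C (i, j) = C (i, l)" using that by (simp add: C_def U_def)
    then show ?thesis using C_nonempty[OF b(1)] C_disjoint[OF b] by auto
  qed
  have perm: "\<pi> A i permutes {1..k i}" if A: "A \<in> G" "i \<in> {1..m}" for A i
  proof (rule bij_imp_permutes)
    have "inj_on (\<pi> A i) {1..k i}"
    proof (rule inj_onI)
      fix j l assume jl: "j \<in> {1..k i}" "l \<in> {1..k i}" "\<pi> A i j = \<pi> A i l"
      then have "(*v) A ` W i j = (*v) A ` W i l" using \<pi>[OF A] by metis
      then have "W i j = W i l"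
        using GL_mat_inj[OF G_carrier[OF A(1)]] by (subst (asm) inj_image_eq_iff) (auto simp: inj_def)
      then show "j = l" using W_inj A jl by blast
    qed
    moreover have "\<pi> A i ` {1..k i} \<subseteq> {1..k i}" using \<pi>[OF A] by blast
    ultimately show "bij_betw (\<pi> A i) {1..k i} {1..k i}"
      by (simp add: bij_betw_def endo_inj_surj)
    show "\<pi> A i x = x" if "x \<notin> {1..k i}" for x using that by (auto simp: \<pi>_def)
  qed
  let ?T = "\<Pi>\<^sub>E i\<in>{1..m}. {\<pi>. \<pi> permutes {1..k i}}"
  let ?f = "\<lambda>A. \<lambda>i\<in>{1..m}. \<pi> A i"
  have "card G \<le> card P * card ?T"
  proof (rule GLm.card_le_coset_fibres[where f = ?f])
    show "finite G" "G \<subseteq> carrier GL_mat" using G G_carrier by auto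
    show "finite ?T" by (intro finite_PiE) (auto simp: finite_permutations)
    show "?f ` G \<subseteq> ?T" using perm by auto
    have "P \<subseteq> G" using assms Stab_subset by (auto simp: P_eq)
    then show "finite P" using G finite_subset by blast
    fix A B assume A: "A \<in> G" and B: "B \<in> G" and eq: "?f A = ?f B"
    have AB: "minv A ** B \<in> G"
      using subgroup.m_closed[OF G(1) subgroup.m_inv_closed[OF G(1) A] B] by simp
    have "(*v) (minv A ** B) ` W i j = W i j" if i: "i \<in> {1..m}" and j: "j \<in> {1..k i}" for i j
    proof -
      have "\<pi> A i = \<pi> B i" using eq i by (metis restrict_apply')
      then have BA: "(*v) B ` W i j = (*v) A ` W i j" using \<pi>[OF A i j] \<pi>[OF B i j] by simp
      have "(*v) (minv A ** B) ` W i j = (*v) (minv A) ` (*v) B ` W i j"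
        by (simp add: image_image matrix_vector_mul_assoc)
      also have "\<dots> = W i j" unfolding BA using GL_mat_inv_vec(1)[OF G_carrier[OF A]] by (simp add: image_image)
      finally show ?thesis .
    qed
    then show "minv A \<otimes>\<^bsub>GL_mat\<^esub> B \<in> P" using AB by (auto simp: P_eq Stab_def blocks_def U_def)
  qed
  also have "card ?T = (\<Prod>i=1..m. fact (k i))"
    by (simp add: card_PiE card_permutations)
  finally show ?thesis .
qed

end

section \<open>The chain of subgroups attached to a marked block\<close>

locale marked_block = block_decomposition G m k V W
  for G :: "(complex ^ 'n ^ 'n) set" and m :: nat and k :: "nat \<Rightarrow> nat"
    and V :: "nat \<Rightarrow> (complex ^ 'n::finite) set" and W :: "nat \<Rightarrow> nat \<Rightarrow> (complex ^ 'n) set" +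
  fixes p1 :: "nat \<times> nat"
  assumes p1: "p1 \<in> blocks"
begin

lemma P_Stab: "p \<in> blocks \<Longrightarrow> P \<subseteq> Stab G (U p)"
  by (auto simp: P_eq)

lemma P_G: "P \<subseteq> G"
  using P_Stab[OF p1] Stab_subset by auto

lemma P_subgroup: "subgroup P GL_mat"
  unfolding P_eq using p1 Stab_subgroup by (intro GLm.subgroups_Inter) auto

definition T :: "(complex ^ 'n ^ 'n) set" where
  "T = {A \<in> P. \<forall>p\<in>blocks - {p1}. scalar_on p A}"

definition Q :: "(complex ^ 'n ^ 'n) set" where
  "Q = {A \<in> P. \<forall>p\<in>blocks. scalar_on p A}"

definition N :: "(complex ^ 'n \<Rightarrow> complex ^ 'n) set set" where
  "N = proj p1 ` T"

lemma T_P: "T \<subseteq> P" by (auto simp: T_def)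

lemma T_subgroup: "subgroup T GL_mat"
proof (rule GLm.subgroupI)
  show "T \<subseteq> carrier GL_mat" using T_P P_G G_carrier by auto
  have "mat 1 \<in> P" using subgroup.one_closed[OF P_subgroup] by (simp add: GL_mat_def)
  then have "mat 1 \<in> T" by (auto simp: T_def scalar_on_def intro!: exI[of _ 1])
  then show "T \<noteq> {}" by auto
next
  fix A assume A: "A \<in> T"
  have "scalar_on p (minv A)" if "p \<in> blocks - {p1}" for p
    using A that P_G by (intro scalar_on_inv) (auto simp: T_def)
  then show "minv A \<in> T"
    using A subgroup.m_inv_closed[OF P_subgroup] by (simp add: T_def)
next
  fix A B assume "A \<in> T" "B \<in> T"
  then show "A \<otimes>\<^bsub>GL_mat\<^esub> B \<in> T"
    using subgroup.m_closed[OF P_subgroup] scalar_on_mult by (auto simp: T_def)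
qed

text \<open>An element of \<open>P\<close> preserves every block, and a scalar on a block commutes
  with it there.\<close>

lemma T_conj:
  assumes A: "A \<in> P" and B: "B \<in> T"
  shows "A ** B ** minv A \<in> T"
proof -
  have Ai: "minv A \<in> P" using subgroup.m_inv_closed[OF P_subgroup A] .
  have "A ** B ** minv A \<in> P"
    using subgroup.m_closed[OF P_subgroup subgroup.m_closed[OF P_subgroup A, of B] Ai] B T_P by auto
  moreover have "scalar_on p (A ** B ** minv A)" if p: "p \<in> blocks - {p1}" for p
  proof -
    obtain c where c: "\<forall>w\<in>U p. B *v w = c *s w" using B p by (auto simp: T_def scalar_on_def)
    have AG: "A \<in> carrier GL_mat" using A P_G G_carrier by auto
    have "(A ** B ** minv A) *v w = c *s w" if w: "w \<in> U p" for w
    proof -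
      have "(minv A) *v w \<in> U p" using Ai w p P_Stab[of p] by (auto simp: Stab_def)
      then show ?thesis using c GL_mat_inv_vec(2)[OF AG]
        by (simp add: matrix_vector_mul_assoc[symmetric] vector_scalar_commute)
    qed
    then show ?thesis by (auto simp: scalar_on_def)
  qed
  ultimately show ?thesis by (simp add: T_def)
qed

lemma N_normal: "N \<lhd> (cvec.PGL (U p1))\<lparr>carrier := Hbar_group G m k W (U p1)\<rparr>"
proof -
  interpret h: group_hom "GL_mat\<lparr>carrier := Stab G (U p1)\<rparr>" "cvec.PGL (U p1)" "proj p1"
    by (rule proj_hom) (rule p1)
  have eq: "Hbar_group G m k W (U p1) = proj p1 ` P"
    by (simp add: Hbar_group_def PGL_image_restrict_to P_def)
  show ?thesis
    unfolding N_def eq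
  proof (rule h.normal_image)
    show "subgroup P (GL_mat\<lparr>carrier := Stab G (U p1)\<rparr>)" "subgroup T (GL_mat\<lparr>carrier := Stab G (U p1)\<rparr>)"
      using GLm.subgroup_incl[OF P_subgroup Stab_subgroup P_Stab[OF p1]]
        GLm.subgroup_incl[OF T_subgroup Stab_subgroup] P_Stab[OF p1] T_P by auto
    show "T \<subseteq> P" by (rule T_P)
    fix A B assume "A \<in> P" "B \<in> T"
    then show "A \<otimes>\<^bsub>GL_mat\<lparr>carrier := Stab G (U p1)\<rparr>\<^esub> B \<otimes>\<^bsub>GL_mat\<lparr>carrier := Stab G (U p1)\<rparr>\<^esub>
        inv\<^bsub>GL_mat\<lparr>carrier := Stab G (U p1)\<rparr>\<^esub> A \<in> T"
      using T_conj P_Stab[OF p1] GLm.m_inv_consistent[OF Stab_subgroup] by auto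
  qed
qed

text \<open>Lagrange's theorem for \<open>N\<close> inside the larger group \<open>H_group\<close>,
  in product form; this is what later turns division by the index into replacing
  \<open>Hcard p1\<close> by \<open>card N\<close>.\<close>

lemma card_rcosets_N:
  "card (rcosets\<^bsub>(cvec.PGL (U p1))\<lparr>carrier := H_group G (U p1)\<rparr>\<^esub> N) * card N = Hcard p1"
proof -
  interpret h: group_hom "GL_mat\<lparr>carrier := Stab G (U p1)\<rparr>" "cvec.PGL (U p1)" "proj p1"
    by (rule proj_hom) (rule p1)
  have H: "subgroup (H_group G (U p1)) (cvec.PGL (U p1))"
    using h.subgroup_img_is_subgroup[OF GLm.subgroup_incl[OF Stab_subgroup Stab_subgroup order.refl]]
    by (simp add: H_group_eq)
  have "subgroup T (GL_mat\<lparr>carrier := Stab G (U p1)\<rparr>)"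
    using GLm.subgroup_incl[OF T_subgroup Stab_subgroup] P_Stab[OF p1] T_P by auto
  then have N: "subgroup N (cvec.PGL (U p1))"
    unfolding N_def by (rule h.subgroup_img_is_subgroup)
  have "N \<subseteq> H_group G (U p1)" using T_P P_Stab[OF p1] by (auto simp: N_def H_group_eq)
  then have "subgroup N ((cvec.PGL (U p1))\<lparr>carrier := H_group G (U p1)\<rparr>)"
    by (rule h.H.subgroup_incl[OF N H])
  then show ?thesis
    using group.lagrange[OF h.H.subgroup_imp_group[OF H]] by (simp add: order_def Hcard_def)
qed

text \<open>Two elements of \<open>P\<close> with the same projective classes on all blocks other
  than \<open>p1\<close> differ by an element that is scalar there, that is, by an element of
  \<open>T\<close>.\<close>

lemma card_P_le: "card P \<le> card T * (\<Prod>p\<in>blocks - {p1}. Hcard p)"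
proof -
  let ?T = "\<Pi>\<^sub>E p\<in>blocks - {p1}. H_group G (U p)"
  have finP: "finite P" using P_G G finite_subset by blast
  have "card P \<le> card T * card ?T"
  proof (rule GLm.card_le_coset_fibres[where f = "\<lambda>A. \<lambda>p\<in>blocks - {p1}. proj p A"])
    show "finite P" "P \<subseteq> carrier GL_mat" using finP P_G G_carrier by auto
    have "finite (H_group G (U p))" for p
      using finite_subset[OF Stab_subset G(2)] by (simp add: H_group_eq)
    then show "finite ?T" using finite_blocks by (intro finite_PiE) auto
    show "(\<lambda>A. \<lambda>p\<in>blocks - {p1}. proj p A) ` P \<subseteq> ?T"
    proof
      fix x assume "x \<in> (\<lambda>A. \<lambda>p\<in>blocks - {p1}. proj p A) ` P"
      then obtain A where A: "A \<in> P" "x = (\<lambda>p\<in>blocks - {p1}. proj p A)" by blast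
      have "proj p A \<in> H_group G (U p)" if "p \<in> blocks - {p1}" for p
        unfolding H_group_eq using that A P_Stab by blast
      then show "x \<in> ?T" unfolding A(2) restrict_PiE_iff by blast
    qed
    show "finite T" using finP T_P finite_subset by blast
    fix A B assume A: "A \<in> P" and B: "B \<in> P"
      and eq: "(\<lambda>p\<in>blocks - {p1}. proj p A) = (\<lambda>p\<in>blocks - {p1}. proj p B)"
    have "minv A ** B \<in> P"
      using subgroup.m_closed[OF P_subgroup subgroup.m_inv_closed[OF P_subgroup A] B] by simp
    moreover have "scalar_on p (minv A ** B)" if p: "p \<in> blocks - {p1}" for p
    proof (rule scalar_on_inv_mult)
      show "proj p A = proj p B" using fun_cong[OF eq, of p] p by simp
      show "p \<in> blocks" "A \<in> Stab G (U p)" "B \<in> Stab G (U p)" using p P_Stab A B by blast+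
    qed
    ultimately show "minv A \<otimes>\<^bsub>GL_mat\<^esub> B \<in> T" by (simp add: T_def)
  qed
  also have "card ?T = (\<Prod>p\<in>blocks - {p1}. Hcard p)"
    using finite_blocks by (simp add: card_PiE Hcard_def)
  finally show ?thesis .
qed

text \<open>Within \<open>T\<close> only the class on the marked block is left to compare, and
  equality there means differing by an element of \<open>Q\<close>.\<close>

lemma card_T_le: "card T \<le> card Q * card N"
proof (rule GLm.card_le_coset_fibres[where f = "proj p1"])
  have finP: "finite P" using P_G G finite_subset by blast
  show "finite T" "T \<subseteq> carrier GL_mat" using finP T_P P_G G_carrier finite_subset by auto
  then show "finite N" by (simp add: N_def)
  show "proj p1 ` T \<subseteq> N" by (simp add: N_def)
  show "finite Q" using finP by (simp add: Q_def)
  fix A B assume A: "A \<in> T" and B: "B \<in> T" and eq: "proj p1 A = proj p1 B"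
  have "minv A ** B \<in> T"
    using subgroup.m_closed[OF T_subgroup subgroup.m_inv_closed[OF T_subgroup A] B] by simp
  moreover have "scalar_on p1 (minv A ** B)"
    using A B T_P P_Stab[OF p1] by (intro scalar_on_inv_mult p1 eq) auto
  ultimately show "minv A \<otimes>\<^bsub>GL_mat\<^esub> B \<in> Q" by (auto simp: T_def Q_def)
qed

end

section \<open>The form cut out by a mixed monomial\<close>

definition restrict_monomial :: "'n set \<Rightarrow> ('n::finite \<Rightarrow>\<^sub>0 nat) \<Rightarrow> ('n \<Rightarrow>\<^sub>0 nat)" where
  "restrict_monomial D \<mm> = (\<Sum>x\<in>D. single x (lookup \<mm> x))"

lemma lookup_restrict_monomial:
  "lookup (restrict_monomial D \<mm>) x = (if x \<in> D then lookup \<mm> x else 0)"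
proof -
  have "lookup (restrict_monomial D \<mm>) x
    = (\<Sum>y\<in>D. if y = x then lookup \<mm> x else 0)"
    unfolding restrict_monomial_def lookup_sum by (intro sum.cong) (auto simp: lookup_single when_def)
  then show ?thesis by simp
qed

lemma monom_eval_restrict_cong:
  assumes "\<And>x. x \<in> D \<Longrightarrow> v $ x = w $ x"
  shows "monom_eval (restrict_monomial D \<mm>) v = monom_eval (restrict_monomial D \<mm>) w"
  unfolding monom_eval_def using assms by (intro prod.cong) (auto simp: lookup_restrict_monomial)

lemma monom_eval_restrict_split:
  "monom_eval \<mm> v = monom_eval (restrict_monomial D \<mm>) v * monom_eval (restrict_monomial (- D) \<mm>) v"
proof -
  have "\<mm> = restrict_monomial D \<mm> + restrict_monomial (- D) \<mm>"
    by (rule poly_mapping_eqI) (auto simp: lookup_restrict_monomial lookup_add)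
  then show ?thesis by (metis monom_eval_add)
qed

lemma monom_eval_scale: "monom_eval \<mm> (a *s v) = a ^ (\<Sum>x\<in>UNIV. lookup \<mm> x) * monom_eval \<mm> v"
  by (simp add: monom_eval_def power_mult_distrib prod.distrib power_sum)

text \<open>The coefficient, as a polynomial in the variables in \<open>D\<close>, of the part of the monomial
  \<open>\<mm>\<close> in the other variables.\<close>

definition coeff_form :: "'n set \<Rightarrow> ('n::finite) mpoly \<Rightarrow> ('n \<Rightarrow>\<^sub>0 nat) \<Rightarrow> 'n mpoly" where
  "coeff_form D F \<mm> = (\<Sum>\<nn>\<in>{\<nn> \<in> keys F. restrict_monomial (- D) \<nn> = restrict_monomial (- D) \<mm>}.
     single (restrict_monomial D \<nn>) (lookup F \<nn>))"

text \<open>No cancellation can occur: among monomials with the same part outside \<open>D\<close>,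
  the part in \<open>D\<close> determines the monomial, so the coefficient of \<open>\<mm>\<close>
  survives.\<close>

lemma coeff_form_neq_0:
  assumes \<mm>: "\<mm> \<in> keys F"
  shows "coeff_form D F \<mm> \<noteq> 0"
proof -
  let ?M = "{\<nn> \<in> keys F. restrict_monomial (- D) \<nn> = restrict_monomial (- D) \<mm>}"
  have inj: "\<nn> = \<mm>" if "\<nn> \<in> ?M" "restrict_monomial D \<nn> = restrict_monomial D \<mm>" for \<nn>
  proof (rule poly_mapping_eqI)
    fix x
    have "lookup (restrict_monomial (if x \<in> D then D else - D) \<nn>) x
        = lookup (restrict_monomial (if x \<in> D then D else - D) \<mm>) x" using that by simp
    then show "lookup \<nn> x = lookup \<mm> x"
      by (simp add: lookup_restrict_monomial split: if_splits)
  qed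
  have "lookup (coeff_form D F \<mm>) (restrict_monomial D \<mm>)
      = (\<Sum>\<nn>\<in>?M. if \<nn> = \<mm> then lookup F \<mm> else 0)"
    unfolding coeff_form_def lookup_sum using inj
    by (intro sum.cong) (auto simp: lookup_single when_def)
  also have "\<dots> = lookup F \<mm>" using \<mm> by simp
  finally show ?thesis using \<mm> by (auto simp: in_keys_iff)
qed

lemma coeff_form_keys:
  "keys (coeff_form D F \<mm>) \<subseteq> restrict_monomial D `
     {\<nn> \<in> keys F. restrict_monomial (- D) \<nn> = restrict_monomial (- D) \<mm>}"
proof -
  let ?M = "{\<nn> \<in> keys F. restrict_monomial (- D) \<nn> = restrict_monomial (- D) \<mm>}"
  have "keys (\<Sum>\<nn>\<in>S. single (restrict_monomial D \<nn>) (lookup F \<nn>))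
      \<subseteq> restrict_monomial D ` S" if "finite S" for S
    using that
  proof (induction S rule: finite_induct)
    case (insert \<nn> S)
    let ?g = "\<lambda>\<nn>. single (restrict_monomial D \<nn>) (lookup F \<nn>)"
    have "keys (?g \<nn>) \<subseteq> {restrict_monomial D \<nn>}" by simp
    then have "keys (?g \<nn> + sum ?g S) \<subseteq> restrict_monomial D ` insert \<nn> S"
      using Poly_Mapping.keys_add[of "?g \<nn>" "sum ?g S"] insert.IH by blast
    then show ?case using insert.hyps by simp
  qed simp
  from this[of ?M] show ?thesis unfolding coeff_form_def by simp
qed

lemma restrict_monomial_degree:
  "(\<Sum>x\<in>UNIV. lookup (restrict_monomial D \<mm>) x) = (\<Sum>x\<in>D. lookup \<mm> x)"
  by (simp add: lookup_restrict_monomial sum.If_cases)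

text \<open>All contributing monomials have total degree \<open>d\<close> and the same part outside
  \<open>D\<close>, hence the same degree in \<open>D\<close>.\<close>

lemma coeff_form_on:
  assumes hom: "homogeneous d F" and \<mm>: "\<mm> \<in> keys F" and D: "coords S = D"
    and d1: "(\<Sum>x\<in>D. lookup \<mm> x) = d1"
  shows "form_on S d1 (coeff_form D F \<mm>)"
  unfolding form_on_def homogeneous_def
proof (intro conjI ballI)
  fix \<mm>' assume "\<mm>' \<in> keys (coeff_form D F \<mm>)"
  then obtain \<nn> where \<nn>: "\<nn> \<in> keys F" "restrict_monomial (- D) \<nn> = restrict_monomial (- D) \<mm>"
    "\<mm>' = restrict_monomial D \<nn>" using coeff_form_keys[of D F \<mm>] by blast
  have split: "(\<Sum>x\<in>UNIV. lookup \<kk> x)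
      = (\<Sum>x\<in>D. lookup \<kk> x) + (\<Sum>x\<in>-D. lookup \<kk> x)" for \<kk> :: "'a \<Rightarrow>\<^sub>0 nat"
    using sum.union_disjoint[of D "- D" "lookup \<kk>"] by (simp add: Compl_partition)
  have "(\<Sum>x\<in>-D. lookup \<nn> x) = (\<Sum>x\<in>-D. lookup \<mm> x)"
    using \<nn>(2) by (metis restrict_monomial_degree)
  moreover have "(\<Sum>x\<in>UNIV. lookup \<nn> x) = d" "(\<Sum>x\<in>UNIV. lookup \<mm> x) = d"
    using hom \<nn> \<mm> by (auto simp: homogeneous_def)
  ultimately have "(\<Sum>x\<in>D. lookup \<nn> x) = d1" using split[of \<nn>] split[of \<mm>] d1 by linarith
  then show "(\<Sum>x\<in>UNIV. lookup \<mm>' x) = d1" unfolding \<nn>(3) restrict_monomial_degree .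
  show "keys \<mm>' \<subseteq> coords S"
    unfolding \<nn>(3) D by (auto simp: in_keys_iff lookup_restrict_monomial split: if_splits)
qed

lemma coeff_form_eval:
  "mpoly_eval (coeff_form D F \<mm>) w =
     (\<Sum>\<nn>\<in>{\<nn> \<in> keys F. restrict_monomial (- D) \<nn> = restrict_monomial (- D) \<mm>}.
        lookup F \<nn> * monom_eval (restrict_monomial D \<nn>) w)"
  by (simp add: coeff_form_def mpoly_eval_sum mpoly_eval_single)

text \<open>Comparing coefficients of monomials in the variables outside \<open>D\<close>.\<close>

lemma coeff_form_semi_invariant:
  fixes t :: "'n::finite \<Rightarrow> complex"
  assumes inv: "\<And>u. mpoly_eval F (\<chi> x. if x \<in> D then w' $ x else t x * u $ x)
                 = mpoly_eval F (\<chi> x. if x \<in> D then w $ x else u $ x)"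
    and \<mm>: "\<mm> \<in> keys F"
  shows "monom_eval (restrict_monomial (- D) \<mm>) (\<chi> x. t x) * mpoly_eval (coeff_form D F \<mm>) w'
       = mpoly_eval (coeff_form D F \<mm>) w"
proof -
  let ?r = "restrict_monomial (- D)" and ?K = "keys F"
  \<comment> \<open>Reads \<open>F\<close> as a polynomial in the outer variables \<open>u\<close>
    whose coefficients depend on the inner point \<open>w\<close>; \<open>g \<rr> w\<close> is the
    coefficient of the outer monomial \<open>\<rr>\<close>.\<close>
  define g where "g \<rr> w = (\<Sum>\<nn>\<in>{\<nn> \<in> ?K. ?r \<nn> = \<rr>}. lookup F \<nn> * monom_eval (restrict_monomial D \<nn>) w)" for \<rr> w
  have expand: "mpoly_eval F (\<chi> x. if x \<in> D then w $ x else u $ x) = (\<Sum>\<rr>\<in>?r ` ?K. g \<rr> w * monom_eval \<rr> u)" for w u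
  proof -
    let ?v = "\<chi> x. if x \<in> D then w $ x else u $ x"
    have m: "monom_eval \<nn> ?v = monom_eval (restrict_monomial D \<nn>) w * monom_eval (?r \<nn>) u" for \<nn>
      using monom_eval_restrict_split[of \<nn> ?v D] monom_eval_restrict_cong[of D ?v w]
        monom_eval_restrict_cong[of "- D" ?v u] by simp
    have "mpoly_eval F ?v = (\<Sum>\<nn>\<in>?K. lookup F \<nn> * monom_eval \<nn> ?v)"
      by (rule mpoly_eval_superset) auto
    also have "\<dots> = (\<Sum>\<rr>\<in>?r ` ?K. \<Sum>\<nn>\<in>{\<nn> \<in> ?K. ?r \<nn> = \<rr>}. lookup F \<nn> * monom_eval \<nn> ?v)"
      by (rule sum.image_gen) simp
    also have "\<dots> = (\<Sum>\<rr>\<in>?r ` ?K. g \<rr> w * monom_eval \<rr> u)"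
      unfolding g_def sum_distrib_right by (intro sum.cong refl) (auto simp: m)
    finally show ?thesis .
  qed
  have "\<forall>\<rr>\<in>?r ` ?K. g \<rr> w' * monom_eval \<rr> (\<chi> x. t x) - g \<rr> w = 0"
  proof (rule monomials_independent)
    fix u :: "complex ^ 'n"
    have "(\<Sum>\<rr>\<in>?r ` ?K. g \<rr> w' * monom_eval \<rr> (\<chi> x. t x * u $ x)) = (\<Sum>\<rr>\<in>?r ` ?K. g \<rr> w * monom_eval \<rr> u)"
    proof -
      have "(\<chi> x. if x \<in> D then w' $ x else (\<chi> x. t x * u $ x) $ x) = (\<chi> x. if x \<in> D then w' $ x else t x * u $ x)"
        by (simp add: vec_eq_iff)
      then show ?thesis using inv[of u] expand[of w u] expand[of w' "\<chi> x. t x * u $ x"] by metis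
    qed
    moreover have "monom_eval \<rr> (\<chi> x. t x * u $ x) = monom_eval \<rr> (\<chi> x. t x) * monom_eval \<rr> u" for \<rr>
      using monom_eval_mult[of \<rr> "\<chi> x. t x" u] by simp
    ultimately show "(\<Sum>\<rr>\<in>?r ` ?K. (g \<rr> w' * monom_eval \<rr> (\<chi> x. t x) - g \<rr> w) * monom_eval \<rr> u) = 0"
      by (simp add: left_diff_distrib sum_subtractf mult.assoc)
  qed simp
  then have "g (?r \<mm>) w' * monom_eval (?r \<mm>) (\<chi> x. t x) = g (?r \<mm>) w" using \<mm> by simp
  then show ?thesis by (simp add: g_def coeff_form_eval mult.commute)
qed

section \<open>Forms on a coordinate subspace and their automorphisms\<close>

lemma homogeneous_eval_scale:
  assumes "homogeneous d F"
  shows "mpoly_eval F (a *s v) = a ^ d * mpoly_eval F v"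
  unfolding mpoly_eval_superset[OF finite_keys order.refl] monom_eval_scale sum_distrib_left
  using assms by (intro sum.cong) (auto simp: homogeneous_def)

lemma form_on_eval_cong:
  assumes f: "form_on S d f" and eq: "\<And>x. x \<in> coords S \<Longrightarrow> v $ x = w $ x"
  shows "mpoly_eval f v = mpoly_eval f w"
  unfolding mpoly_eval_def
proof (intro sum.cong arg_cong2[where f = "(*)"] prod.cong refl)
  fix \<mm> x assume \<mm>: "\<mm> \<in> keys f"
  show "v $ x ^ lookup \<mm> x = w $ x ^ lookup \<mm> x"
  proof (cases "x \<in> coords S")
    case False
    then have "lookup \<mm> x = 0" using f \<mm> by (auto simp: form_on_def in_keys_iff subset_iff)
    then show ?thesis by simp
  qed (simp add: eq)
qed

lemma vec_sum_axis: "v = (\<Sum>x\<in>UNIV. v $ x *s axis x (1::complex))" for v :: "complex ^ 'n::finite"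
proof -
  have "(\<Sum>x\<in>UNIV. v $ x *s axis x (1::complex)) $ y = v $ y" for y
    by (simp add: axis_def if_distrib cong: if_cong)
  then show ?thesis by (simp add: vec_eq_iff)
qed

lemma matrix_vector_mult_sum_axis:
  "A *v v = (\<Sum>x\<in>UNIV. v $ x *s (A *v axis x 1))" for v :: "complex ^ 'n::finite"
proof -
  have "(A *v axis x 1) $ i = A $ i $ x" for i x
    by (simp add: matrix_vector_mult_def axis_def if_distrib cong: if_cong)
  moreover have "(A *v v) $ i = (\<Sum>x\<in>UNIV. A $ i $ x * v $ x)" for i
    by (simp add: matrix_vector_mult_def)
  ultimately show ?thesis by (simp add: vec_eq_iff mult.commute)
qed

text \<open>Padding with zeros makes \<open>matrix_on\<close> act as \<open>g\<close> after
  projection to the subspace, and \<open>f\<close> does not see the coordinates lost by projecting.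
  So the formal substitution amounts to invariance of a function on the subspace.\<close>

lemma Aut_on_iff:
  fixes D :: "'n::finite set"
  assumes f: "form_on (coord_subspace D) d f"
  shows "g \<in> Aut_on (coord_subspace D) f \<longleftrightarrow> g \<in> carrier (cvec.GL (coord_subspace D)) \<and>
     (\<forall>w\<in>coord_subspace D. mpoly_eval f (g w) = mpoly_eval f w)"
proof -
  let ?W = "coord_subspace D"
  have "lin_subst (matrix_on ?W g) f = f \<longleftrightarrow> (\<forall>w\<in>?W. mpoly_eval f (g w) = mpoly_eval f w)"
    if g: "g \<in> carrier (cvec.GL ?W)"
  proof -
    define pr :: "complex ^ 'n \<Rightarrow> complex ^ 'n" where "pr v = (\<chi> x. if x \<in> D then v $ x else 0)" for v
    have pr: "pr v \<in> ?W" for v by (simp add: pr_def coord_subspace_def)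
    have pr_id: "pr w = w" if "w \<in> ?W" for w using that by (auto simp: pr_def coord_subspace_def vec_eq_iff)
    have mat: "matrix_on ?W g *v v = g (pr v)" for v
    proof -
      have "pr v = (\<Sum>x\<in>D. v $ x *s axis x 1)"
        by (subst vec_sum_axis[of "pr v"]) (auto simp: pr_def intro!: sum.mono_neutral_cong_right)
      then have "g (pr v) = g (\<Sum>x\<in>D. v $ x *s axis x 1)" by simp
      also have "\<dots> = (\<Sum>x\<in>D. g (v $ x *s axis x 1))"
        by (rule cvec.GL_sum[OF g subspace_coord_subspace]) (auto simp: coord_subspace_def axis_def)
      also have "\<dots> = (\<Sum>x\<in>D. v $ x *s g (axis x 1))"
        by (intro sum.cong refl cvec.GL_scale[OF g]) (auto simp: coord_subspace_def axis_def)
      also have "\<dots> = matrix_on ?W g *v v"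
        unfolding vec_eq_iff
      proof
        fix i
        have "(\<Sum>x\<in>D. v $ x *s g (axis x 1)) $ i = (\<Sum>x\<in>D. g (axis x 1) $ i * v $ x)"
          by (simp add: mult.commute)
        also have "\<dots> = (\<Sum>x\<in>UNIV. (if x \<in> D then g (axis x 1) $ i else 0) * v $ x)"
          by (rule sum.mono_neutral_cong_left) auto
        also have "\<dots> = (matrix_on ?W g *v v) $ i"
          by (simp add: matrix_vector_mult_def matrix_on_def)
        finally show "(\<Sum>x\<in>D. v $ x *s g (axis x 1)) $ i = (matrix_on ?W g *v v) $ i" .
      qed
      finally show ?thesis by simp
    qed
    have fpr: "mpoly_eval f (pr v) = mpoly_eval f v" for v
      by (rule form_on_eval_cong[OF f]) (simp add: pr_def)
    have "lin_subst (matrix_on ?W g) f = f \<longleftrightarrow> (\<forall>v. mpoly_eval f (g (pr v)) = mpoly_eval f v)"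
    proof (intro iffI allI)
      fix v assume "lin_subst (matrix_on ?W g) f = f"
      then show "mpoly_eval f (g (pr v)) = mpoly_eval f v"
        using mpoly_eval_lin_subst[of "matrix_on ?W g" f v] by (simp add: mat)
    next
      assume "\<forall>v. mpoly_eval f (g (pr v)) = mpoly_eval f v"
      then show "lin_subst (matrix_on ?W g) f = f"
        by (intro mpoly_eval_inject) (simp add: mpoly_eval_lin_subst mat)
    qed
    also have "\<dots> \<longleftrightarrow> (\<forall>w\<in>?W. mpoly_eval f (g w) = mpoly_eval f w)"
    proof (intro iffI allI ballI)
      fix w assume "\<forall>v. mpoly_eval f (g (pr v)) = mpoly_eval f v" "w \<in> ?W"
      then show "mpoly_eval f (g w) = mpoly_eval f w" using pr_id[of w] by metis
    next
      fix v assume "\<forall>w\<in>?W. mpoly_eval f (g w) = mpoly_eval f w"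
      then show "mpoly_eval f (g (pr v)) = mpoly_eval f v" using pr[of v] fpr[of v] by simp
    qed
    finally show ?thesis .
  qed
  then show ?thesis by (auto simp: Aut_on_def)
qed

section \<open>Consequences of the smoothness and the invariance of the form\<close>

locale smooth_marked_block = marked_block G m k V W p1
  for G :: "(complex ^ 'n ^ 'n) set" and m :: nat and k :: "nat \<Rightarrow> nat"
    and V :: "nat \<Rightarrow> (complex ^ 'n::finite) set" and W :: "nat \<Rightarrow> nat \<Rightarrow> (complex ^ 'n) set" and p1 +
  fixes F :: "'n mpoly" and d :: nat
  assumes d: "d \<ge> 3" and hom: "homogeneous d F" and smooth: "smooth_form F" and Aut: "G \<subseteq> Aut F"
begin

lemma invariant: "A \<in> G \<Longrightarrow> mpoly_eval F (A *v v) = mpoly_eval F v"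
  using Aut Aut_eval by blast

lemma axis_in_U: "p \<in> blocks \<Longrightarrow> x \<in> C p \<Longrightarrow> axis x 1 \<in> U p"
  by (simp add: C_def coords_def)

text \<open>One variable \<open>a p\<close> is picked in each block, and smoothness supplies a
  monomial dominated by it. The unknowns are the scalars of an element on the blocks, so the
  equations are as many as the blocks and not as the variables.\<close>

lemma card_Q_le: "card Q \<le> d ^ card blocks"
proof -
  define a where "a p = (SOME x. x \<in> C p)" for p
  have a: "a p \<in> C p" if "p \<in> blocks" for p
    unfolding a_def using C_nonempty[OF that] by (simp add: some_in_eq)
  obtain b where b: "\<And>x. single x (d - 1) + single (b x) 1 \<in> keys F"
    using smooth_form_monomial[OF hom smooth] d by (metis less_le_trans zero_less_numeral)
  define \<sigma> where "\<sigma> p = block_of (b (a p))" for p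
  define t where "t A = (\<lambda>p\<in>blocks. SOME c. \<forall>w\<in>U p. A *v w = c *s w)" for A :: "complex ^ 'n ^ 'n"
  have t: "A *v w = t A p *s w" if A: "A \<in> Q" and p: "p \<in> blocks" and w: "w \<in> U p" for A p w
  proof -
    have "\<exists>c. \<forall>w\<in>U p. A *v w = c *s w" using A p by (auto simp: Q_def scalar_on_def)
    from someI_ex[OF this] show ?thesis
      unfolding t_def restrict_apply'[OF p] using w by (rule bspec)
  qed
  \<comment> \<open>Elements of \<open>Q\<close> are diagonal, with an entry that is constant on
    each block.\<close>
  have tv: "A *v v = (\<chi> x. t A (block_of x) * v $ x)" if A: "A \<in> Q" for A v
  proof -
    have "A *v v = (\<Sum>x\<in>UNIV. v $ x *s (A *v axis x 1))"
      by (rule matrix_vector_mult_sum_axis)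
    also have "\<dots> = (\<Sum>x\<in>UNIV. (t A (block_of x) * v $ x) *s axis x 1)"
      using t[OF A block_of(1) axis_in_U[OF block_of]] by (simp add: vector_smult_assoc mult.commute)
    also have "\<dots> = (\<chi> x. t A (block_of x) * v $ x)"
      using vec_sum_axis[of "\<chi> x. t A (block_of x) * v $ x"] by simp
    finally show ?thesis .
  qed
  have "inj_on t Q"
  proof (rule inj_onI)
    fix A B assume "A \<in> Q" "B \<in> Q" "t A = t B"
    then have "\<forall>v. A *v v = B *v v" by (simp add: tv)
    then show "A = B" by (simp add: matrix_eq)
  qed
  moreover have "t ` Q \<subseteq> torus_solutions d \<sigma> blocks"
  proof
    fix s assume "s \<in> t ` Q"
    then obtain A where A: "A \<in> Q" "s = t A" by auto
    have "A \<in> G" using A P_G by (auto simp: Q_def)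
    have "s (\<sigma> p) * s p ^ (d - 1) = 1" if p: "p \<in> blocks" for p
    proof -
      have "monom_eval (single (a p) (d - 1) + single (b (a p)) 1) (\<chi> x. t A (block_of x)) = 1"
        using invariant[OF \<open>A \<in> G\<close>] by (intro torus_fixes_monomial[OF _ b]) (simp add: tv[OF A(1)])
      then show ?thesis
        using block_of_eq[OF p a[OF p]] by (simp add: monom_eval_add monom_eval_single A(2) \<sigma>_def mult.commute)
    qed
    then show "s \<in> torus_solutions d \<sigma> blocks" using A by (auto simp: torus_solutions_def t_def)
  qed
  moreover have "finite (torus_solutions d \<sigma> blocks) \<and> card (torus_solutions d \<sigma> blocks) \<le> d ^ card blocks"
    by (rule card_torus_solutions[OF d finite_blocks]) (auto simp: \<sigma>_def block_of)
  ultimately show ?thesis using card_inj_on_le by (metis order_trans)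
qed

lemma card_G_bound: "card G \<le> d ^ card blocks * card N * (\<Prod>p\<in>blocks - {p1}. Hcard p) * (\<Prod>i=1..m. fact (k i))"
proof -
  have "card G \<le> card P * (\<Prod>i=1..m. fact (k i))" using p1 by (intro card_G_le) auto
  also have "\<dots> \<le> (card T * (\<Prod>p\<in>blocks - {p1}. Hcard p)) * (\<Prod>i=1..m. fact (k i))"
    by (intro mult_le_mono1 card_P_le)
  also have "\<dots> \<le> (card Q * card N * (\<Prod>p\<in>blocks - {p1}. Hcard p)) * (\<Prod>i=1..m. fact (k i))"
    by (intro mult_le_mono1 card_T_le)
  also have "\<dots> \<le> (d ^ card blocks * card N * (\<Prod>p\<in>blocks - {p1}. Hcard p)) * (\<Prod>i=1..m. fact (k i))"
    by (intro mult_le_mono1 card_Q_le)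
  finally show ?thesis .
qed

text \<open>The number \<open>c\<close> is the value of the outer part of \<open>\<mm>\<close> at
  the scalars by which \<open>A\<close> acts on the other blocks.\<close>

lemma T_semi_invariant:
  assumes A: "A \<in> T" and \<mm>: "\<mm> \<in> keys F"
  shows "\<exists>c. c \<noteq> 0 \<and> (\<forall>w\<in>U p1. c * mpoly_eval (coeff_form (C p1) F \<mm>) (A *v w) = mpoly_eval (coeff_form (C p1) F \<mm>) w)"
proof -
  let ?f = "coeff_form (C p1) F \<mm>"
  have U1: "U p1 = coord_subspace (C p1)" by (rule U_eq[OF p1])
  have AG: "A \<in> G" "A \<in> P" using A T_P P_G by auto
  have "\<forall>p\<in>blocks - {p1}. \<exists>c. \<forall>w\<in>U p. A *v w = c *s w"
    using A unfolding T_def scalar_on_def by blast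
  from bchoice[OF this] obtain t where t: "\<And>p w. p \<in> blocks - {p1} \<Longrightarrow> w \<in> U p \<Longrightarrow> A *v w = t p *s w"
    by blast
  define s where "s x = t (block_of x)" for x
  define c where "c = monom_eval (restrict_monomial (- C p1) \<mm>) (\<chi> x. s x)"
  have AU: "A *v w \<in> U p1" if "w \<in> U p1" for w
    using AG P_Stab[OF p1] that by (auto simp: Stab_def)
  have eq: "c * mpoly_eval ?f (A *v w) = mpoly_eval ?f w" if w: "w \<in> U p1" for w
    unfolding c_def
  proof (rule coeff_form_semi_invariant[OF _ \<mm>])
    fix u :: "complex ^ 'n"
    let ?v = "\<chi> x. if x \<in> C p1 then w $ x else u $ x"
    have "A *v ?v = (\<chi> x. if x \<in> C p1 then (A *v w) $ x else s x * u $ x)"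
    proof -
      \<comment> \<open>The component of the vector in the other blocks, where \<open>A\<close> is
        diagonal; the component in the marked block is \<open>w\<close>.\<close>
      define u' where "u' = (\<chi> x. if x \<in> C p1 then 0 else u $ x)"
      have v: "?v = w + u'" using w by (auto simp: u'_def vec_eq_iff U1 coord_subspace_def)
      have "A *v u' = (\<Sum>x\<in>UNIV. u' $ x *s (A *v axis x 1))"
        by (rule matrix_vector_mult_sum_axis)
      also have "\<dots> = (\<Sum>x\<in>UNIV. (s x * u' $ x) *s axis x 1)"
      proof (rule sum.cong[OF refl])
        fix x
        show "u' $ x *s (A *v axis x 1) = (s x * u' $ x) *s axis x 1"
        proof (cases "x \<in> C p1")
          case True
          then show ?thesis by (simp add: u'_def)
        next
          case False
          then have "block_of x \<in> blocks - {p1}" using block_of by auto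
          then show ?thesis using t[OF _ axis_in_U[OF block_of]] by (simp add: s_def vector_smult_assoc mult.commute)
        qed
      qed
      also have "\<dots> = (\<chi> x. s x * u' $ x)" using vec_sum_axis[of "\<chi> x. s x * u' $ x"] by simp
      finally have "A *v u' = (\<chi> x. s x * u' $ x)" .
      then have "A *v ?v = A *v w + (\<chi> x. s x * u' $ x)" by (simp add: v matrix_vector_right_distrib)
      moreover have "(A *v w) $ x = 0" if "x \<notin> C p1" for x
        using AU[OF w] that by (simp add: U1 coord_subspace_def)
      ultimately show ?thesis by (auto simp: vec_eq_iff u'_def)
    qed
    then show "mpoly_eval F (\<chi> x. if x \<in> C p1 then (A *v w) $ x else s x * u $ x) = mpoly_eval F ?v"
      using invariant[OF AG(1)] by metis
  qed
  \<comment> \<open>If \<open>c\<close> were 0, the coefficient form would vanish on the whole block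
    and hence be the zero polynomial.\<close>
  have "c \<noteq> 0"
  proof
    assume "c = 0"
    have fo: "form_on (U p1) (\<Sum>x\<in>C p1. lookup \<mm> x) ?f"
      by (rule coeff_form_on[OF hom \<mm>]) (simp_all add: C_def)
    have "mpoly_eval ?f v = 0" for v
    proof -
      have "(\<chi> x. if x \<in> C p1 then v $ x else 0) \<in> U p1" by (simp add: U1 coord_subspace_def)
      then have "mpoly_eval ?f (\<chi> x. if x \<in> C p1 then v $ x else 0) = 0"
        using eq[of "\<chi> x. if x \<in> C p1 then v $ x else 0"] \<open>c = 0\<close> by simp
      then show ?thesis using form_on_eval_cong[OF fo, of v "\<chi> x. if x \<in> C p1 then v $ x else 0"] by (simp add: C_def)
    qed
    then have "?f = 0" by (intro mpoly_eval_inject) (simp add: mpoly_eval_0)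
    then show False using coeff_form_neq_0[OF \<mm>] by simp
  qed
  then show ?thesis using eq by blast
qed

text \<open>An element \<open>A\<close> of \<open>T\<close> need not fix the form, but some multiple
  of it does, and multiples have the same projective class. So \<open>N\<close> is the image of a
  group of rescaled elements of \<open>T\<close>.\<close>

lemma N_preserves:
  assumes \<mm>: "\<mm> \<in> keys F" and d1: "(\<Sum>x\<in>C p1. lookup \<mm> x) = d1" "d1 > 0"
  shows "preserves (U p1) N (coeff_form (C p1) F \<mm>)"
proof -
  let ?f = "coeff_form (C p1) F \<mm>"
  interpret GU: group "cvec.GL (U p1)" by (rule cvec.group_GL) (rule subspace_U[OF p1])
  have fo: "form_on (U p1) d1 ?f" by (rule coeff_form_on[OF hom \<mm> _ d1(1)]) (simp add: C_def)
  have Aut_iff: "g \<in> Aut_on (U p1) ?f \<longleftrightarrow> g \<in> carrier (cvec.GL (U p1)) \<and> (\<forall>w\<in>U p1. mpoly_eval ?f (g w) = mpoly_eval ?f w)" for g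
    using Aut_on_iff[of "C p1" d1 ?f g] fo by (simp add: U_eq[OF p1])
  \<comment> \<open>All multiples that fix the form are taken at once instead of one chosen root for
    each \<open>A\<close>: choices of roots need not be multiplicative, whereas this set is visibly
    closed under products and inverses.\<close>
  define K where "K = {g \<in> Aut_on (U p1) ?f. \<exists>A\<in>T. \<exists>a. a \<noteq> 0 \<and> (\<forall>w\<in>U p1. g w = a *s (A *v w))}"
  have TS: "T \<subseteq> Stab G (U p1)" using T_P P_Stab[OF p1] by auto
  have K_GL: "g \<in> carrier (cvec.GL (U p1))" if "g \<in> K" for g using that by (simp add: K_def Aut_iff)
  have AU: "A *v w \<in> U p1" if "A \<in> T" "w \<in> U p1" for A w using that TS by (auto simp: Stab_def)
  have gU: "g w \<in> U p1" if "g \<in> carrier (cvec.GL (U p1))" "w \<in> U p1" for g w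
    using that by (rule cvec.GL_closed)
  have sub: "subgroup K (cvec.GL (U p1))"
  proof (rule GU.subgroupI)
    show "K \<subseteq> carrier (cvec.GL (U p1))" using K_GL by auto
    have "mat 1 \<in> T" using subgroup.one_closed[OF T_subgroup] by (simp add: GL_mat_def)
    then have "\<one>\<^bsub>cvec.GL (U p1)\<^esub> \<in> K"
      using GU.one_closed by (auto simp: K_def Aut_iff cvec.GL_one intro!: bexI[of _ "mat 1"] exI[of _ 1])
    then show "K \<noteq> {}" by auto
  next
    fix g assume g: "g \<in> K"
    then obtain A a where A: "A \<in> T" "a \<noteq> 0" "\<forall>w\<in>U p1. g w = a *s (A *v w)" by (auto simp: K_def)
    let ?h = "inv\<^bsub>cvec.GL (U p1)\<^esub> g"
    have h: "?h \<in> carrier (cvec.GL (U p1))" using K_GL[OF g] by simp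
    have gh: "g (?h w) = w" "?h w \<in> U p1" if "w \<in> U p1" for w
      using cvec.GL_inv_apply(2)[OF subspace_U[OF p1] K_GL[OF g] that] gU[OF h that] by auto
    have "mpoly_eval ?f (?h w) = mpoly_eval ?f w" if w: "w \<in> U p1" for w
      using g gh[OF w] by (metis (no_types, lifting) Aut_iff K_def mem_Collect_eq)
    moreover have "?h w = inverse a *s ((minv A) *v w)" if w: "w \<in> U p1" for w
    proof -
      have "w = a *s (A *v ?h w)" using A(3) gh[OF w] by simp
      then have "(minv A) *v w = a *s ?h w"
        using GL_mat_inv_vec(1)[of A "?h w"] A(1) TS G_carrier Stab_subset
        by (metis subsetD vector_scalar_commute)
      then show ?thesis using A(2) by (simp add: vector_smult_assoc)
    qed
    ultimately show "?h \<in> K"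
      using h A(2) subgroup.m_inv_closed[OF T_subgroup A(1)] by (auto simp: K_def Aut_iff intro!: bexI[of _ "minv A"] exI[of _ "inverse a"])
  next
    fix g h assume g: "g \<in> K" and h: "h \<in> K"
    then obtain A a B b where A: "A \<in> T" "a \<noteq> 0" "\<forall>w\<in>U p1. g w = a *s (A *v w)"
      and B: "B \<in> T" "b \<noteq> 0" "\<forall>w\<in>U p1. h w = b *s (B *v w)" by (auto simp: K_def)
    have gh: "(g \<otimes>\<^bsub>cvec.GL (U p1)\<^esub> h) w = g (h w)" "h w \<in> U p1" if "w \<in> U p1" for w
      using that K_GL[OF g] K_GL[OF h] by (auto simp: cvec.GL_mult_apply gU)
    have inv: "mpoly_eval ?f (g w) = mpoly_eval ?f w" "mpoly_eval ?f (h w) = mpoly_eval ?f w" if "w \<in> U p1" for w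
      using g h that by (auto simp: K_def Aut_iff)
    have "(g \<otimes>\<^bsub>cvec.GL (U p1)\<^esub> h) w = (a * b) *s ((A ** B) *v w)" if w: "w \<in> U p1" for w
    proof -
      have ghw: "g (h w) = a *s (A *v (h w))" using A(3) gh(2)[OF w] by blast
      have hw: "h w = b *s (B *v w)" using B(3) w by blast
      show ?thesis
        unfolding gh(1)[OF w] ghw
        unfolding hw by (simp add: vector_scalar_commute vector_smult_assoc matrix_vector_mul_assoc)
    qed
    moreover have "A ** B \<in> T" using subgroup.m_closed[OF T_subgroup A(1) B(1)] by simp
    moreover have "a * b \<noteq> 0" using A B by simp
    moreover have "g \<otimes>\<^bsub>cvec.GL (U p1)\<^esub> h \<in> carrier (cvec.GL (U p1))" using K_GL[OF g] K_GL[OF h] by simp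
    moreover have "mpoly_eval ?f ((g \<otimes>\<^bsub>cvec.GL (U p1)\<^esub> h) w) = mpoly_eval ?f w" if "w \<in> U p1" for w
      using gh[OF that] inv that by simp
    ultimately show "g \<otimes>\<^bsub>cvec.GL (U p1)\<^esub> h \<in> K" unfolding K_def Aut_iff by blast
  qed
  have "cvec.PGL_image (U p1) K = N"
  proof (intro equalityI subsetI)
    fix x assume "x \<in> cvec.PGL_image (U p1) K"
    then obtain g where g: "g \<in> K" "x = cvec.proj_class (U p1) g" by (auto simp: cvec.PGL_image_eq)
    then obtain A a where A: "A \<in> T" "a \<noteq> 0" "\<forall>w\<in>U p1. g w = a *s (A *v w)" by (auto simp: K_def)
    have "cvec.proj_class (U p1) g = proj p1 A"
      unfolding proj_def using A TS
      by (subst cvec.proj_class_eq_iff[OF subspace_U[OF p1] K_GL[OF g(1)] act_GL[OF p1]]) (auto simp: act_def)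
    then show "x \<in> N" using A g by (simp add: N_def)
  next
    fix x assume "x \<in> N"
    then obtain A where A: "A \<in> T" "x = proj p1 A" by (auto simp: N_def)
    obtain c where c: "c \<noteq> 0" "\<And>w. w \<in> U p1 \<Longrightarrow> c * mpoly_eval ?f (A *v w) = mpoly_eval ?f w"
      using T_semi_invariant[OF A(1) \<mm>] by blast
    \<comment> \<open>A \<open>d1\<close>-th root \<open>a\<close> of \<open>c\<close> works, since
      homogeneity turns the form at \<open>a *s (A *v w)\<close> into \<open>a ^ d1 = c\<close>
      times its value at \<open>A *v w\<close>, which is its value at \<open>w\<close>.\<close>
    have "card {a. a ^ d1 = c} = d1" using card_nth_roots[OF c(1) d1(2)] .
    then have "{a. a ^ d1 = c} \<noteq> {}" using d1(2) by (metis card.empty less_irrefl)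
    then obtain a where a: "a ^ d1 = c" by blast
    then have a0: "a \<noteq> 0" using c d1 by auto
    define g where "g = (\<lambda>w\<in>U p1. a *s (A *v w))"
    have act: "act p1 A \<in> carrier (cvec.GL (U p1))" using A TS act_GL[OF p1] by auto
    have gG: "g \<in> carrier (cvec.GL (U p1))"
    proof -
      have "g = restrict ((*s) a) (U p1) \<otimes>\<^bsub>cvec.GL (U p1)\<^esub> act p1 A"
      proof (rule extensionalityI[of _ "U p1"])
        show "restrict ((*s) a) (U p1) \<otimes>\<^bsub>cvec.GL (U p1)\<^esub> act p1 A \<in> extensional (U p1)"
          using GU.m_closed[OF cvec.homothety_in_GL[OF subspace_U[OF p1] a0] act] by (simp add: cvec.GL_carrier_iff)
        show "g w = (restrict ((*s) a) (U p1) \<otimes>\<^bsub>cvec.GL (U p1)\<^esub> act p1 A) w" if "w \<in> U p1" for w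
          using that cvec.GL_mult_apply[OF cvec.homothety_in_GL[OF subspace_U[OF p1] a0] act that] AU[OF A(1) that]
          by (simp add: g_def act_def)
      qed (simp add: g_def)
      then show ?thesis using GU.m_closed[OF cvec.homothety_in_GL[OF subspace_U[OF p1] a0] act] by simp
    qed
    have "mpoly_eval ?f (g w) = mpoly_eval ?f w" if w: "w \<in> U p1" for w
      using w c(2)[OF w] a fo homogeneous_eval_scale[of d1 ?f a "A *v w"] by (simp add: g_def form_on_def)
    then have gK: "g \<in> K" using gG A a0 by (auto simp: K_def Aut_iff g_def)
    have "cvec.proj_class (U p1) g = proj p1 A"
      unfolding proj_def using a0
      by (subst cvec.proj_class_eq_iff[OF subspace_U[OF p1] gG act]) (auto simp: act_def g_def)
    then show "x \<in> cvec.PGL_image (U p1) K" using gK A by (force simp: cvec.PGL_image_eq)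
  qed
  moreover have "K \<subseteq> Aut_on (U p1) ?f" by (auto simp: K_def)
  ultimately show ?thesis unfolding preserves_def using sub by blast
qed

end

section \<open>Comparison with the Fermat-test ratio\<close>

text \<open>The quotient of the two sides is a multinomial coefficient.\<close>

lemma prod_fact_le_fact_sum:
  "finite I \<Longrightarrow> (\<Prod>i\<in>I. fact (k i)) \<le> (fact (\<Sum>i\<in>I. k i) :: nat)"
proof (induction I rule: finite_induct)
  case (insert i I)
  have "(\<Prod>i\<in>insert i I. fact (k i)) \<le> fact (k i) * (fact (\<Sum>i\<in>I. k i) :: nat)"
    using insert by simp
  also have "\<dots> \<le> fact (k i + (\<Sum>i\<in>I. k i))"
    by (intro dvd_imp_le fact_fact_dvd_fact) simp
  finally show ?case using insert.hyps by simp
qed simp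

context block_decomposition
begin

definition dims :: "nat list" where
  "dims = subdegree_sequence m k W"

text \<open>The Fermat-test ratio depends on the tuple only as a multiset, so the sorting can be
  forgotten and its length, sum, product and multiplicities computed over the blocks.\<close>

lemma mset_dims: "mset dims = image_mset (\<lambda>p. card (C p)) (mset_set blocks)"
proof -
  let ?L = "concat (map (\<lambda>i. map (Pair i) [1..<Suc (k i)]) [1..<Suc m])"
  have set_L: "set ?L = blocks"
    by (simp only: set_concat set_map set_upt image_image blocks_def Sigma_def atLeastLessThanSuc_atLeastAtMost)
      blast
  have "distinct (concat (map (\<lambda>i. map (Pair i) [1..<Suc (k i)]) xs))" if "distinct xs" for xs
    using that by (induction xs) (auto simp: distinct_map inj_on_def simp del: upt_Suc)
  then have "mset ?L = mset_set blocks"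
    using mset_set_set[of ?L] unfolding set_L by (metis distinct_upt)
  moreover have "mset dims = mset (map (\<lambda>(i, j). vec.dim (W i j)) ?L)"
    by (simp add: dims_def subdegree_sequence_def map_concat comp_def del: upt_Suc)
  ultimately have "mset dims = image_mset (\<lambda>(i, j). vec.dim (W i j)) (mset_set blocks)"
    by (metis mset_map)
  also have "\<dots> = image_mset (\<lambda>p. card (C p)) (mset_set blocks)"
    by (intro image_mset_cong) (auto simp: finite_blocks dim_U[symmetric] U_def)
  finally show ?thesis .
qed

lemma length_dims: "length dims = card blocks"
  using arg_cong[OF mset_dims, of size] by (simp add: finite_blocks)

lemma sum_list_dims: "sum_list dims = CARD('n)"
proof -
  have "sum_list dims = sum_mset (mset dims)" by (simp add: sum_mset_sum_list)
  then show ?thesis using card_C_sum by (simp add: mset_dims sum_unfold_sum_mset)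
qed

lemma prod_list_JC_dims: "prod_list (map JC dims) = (\<Prod>p\<in>blocks. JC (card (C p)))"
proof -
  have "prod_list (map JC dims) = prod_mset (image_mset JC (mset dims))"
    by (metis mset_map prod_mset_prod_list)
  then show ?thesis by (simp add: mset_dims prod_unfold_prod_mset image_mset.compositionality comp_def)
qed

lemma count_dims: "count_list dims v = card {p \<in> blocks. card (C p) = v}"
proof -
  have "count_list dims v = count (mset dims) v" by (simp add: count_mset)
  then show ?thesis unfolding mset_dims
    by (simp add: count_image_mset finite_blocks vimage_def Int_def conj_commute)
qed

lemma set_dims: "set dims = (\<lambda>p. card (C p)) ` blocks"
proof -
  have "set dims = set_mset (mset dims)" by simp
  then show ?thesis by (simp add: mset_dims finite_blocks)
qed

text \<open>The blocks inside a fixed \<open>V i\<close> have equal dimension, so the multiplicity of a value in the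
  subdegree sequence is the sum of some of the \<open>k i\<close>.\<close>

lemma prod_fact_le: "(\<Prod>i=1..m. fact (k i)) \<le> (\<Prod>v\<in>set dims. fact (count_list dims v) :: nat)"
proof -
  define \<delta> where "\<delta> i = card (C (i, 1))" for i
  \<comment> \<open>The index 1 serves as representative of the blocks in \<open>V i\<close>. It
    exists because an empty direct sum is zero, whereas \<open>V i\<close> is not.\<close>
  have kpos: "1 \<in> {1..k i}" if i: "i \<in> {1..m}" for i
  proof (rule ccontr)
    assume "1 \<notin> {1..k i}"
    then have "k i = 0" by simp
    moreover have "cvec.direct_sum {1..k i} (W i) (V i)" "V i \<noteq> {0}"
      using dec i unfolding decomposition_data_def cvec.irreducible_action_def by blast+
    ultimately show False by (auto simp: cvec.direct_sum_def bij_betw_def)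
  qed
  have \<delta>: "card (C (i, j)) = \<delta> i" if "(i, j) \<in> blocks" for i j
    unfolding \<delta>_def using that kpos by (intro card_C_eq) (auto simp: blocks_def)
  have count: "count_list dims v = (\<Sum>i\<in>{i \<in> {1..m}. \<delta> i = v}. k i)" for v
  proof -
    have "{p \<in> blocks. card (C p) = v} = (SIGMA i:{i \<in> {1..m}. \<delta> i = v}. {1..k i})"
    proof (rule Set.set_eqI)
      fix p
      show "p \<in> {p \<in> blocks. card (C p) = v} \<longleftrightarrow> p \<in> (SIGMA i:{i \<in> {1..m}. \<delta> i = v}. {1..k i})"
        using \<delta>[of "fst p" "snd p"] by (cases p) (auto simp: blocks_def)
    qed
    then show ?thesis by (simp add: count_dims)
  qed
  have sub: "\<delta> ` {1..m} \<subseteq> set dims"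
    using kpos by (auto simp: set_dims \<delta>_def blocks_def)
  have "(\<Prod>i=1..m. fact (k i)) = (\<Prod>v\<in>set dims. \<Prod>i\<in>{i \<in> {1..m}. \<delta> i = v}. fact (k i) :: nat)"
    using sub by (subst prod.group) auto
  also have "\<dots> \<le> (\<Prod>v\<in>set dims. fact (count_list dims v))"
    unfolding count by (intro prod_mono conjI prod_fact_le_fact_sum) auto
  finally show ?thesis .
qed

end

section \<open>The canonical bound divided by the index\<close>

context smooth_marked_block
begin

text \<open>Isolates the factor of the marked block, the only one affected by dividing by the
  index.\<close>

lemma canonical_bound_eq:
  "canonical_bound d G m k W = Hcard p1 * (d ^ card blocks * (\<Prod>p\<in>blocks - {p1}. Hcard p) * (\<Prod>i=1..m. fact (k i)))"
proof -
  have "(\<Prod>i=1..m. \<Prod>j=1..k i. card (H_group G (W i j))) = (\<Prod>p\<in>blocks. Hcard p)"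
    unfolding blocks_def Hcard_def U_def by (subst prod.Sigma) (auto simp: split_beta)
  also have "\<dots> = Hcard p1 * (\<Prod>p\<in>blocks - {p1}. Hcard p)"
    by (rule prod.remove[OF finite_blocks p1])
  finally show ?thesis unfolding canonical_bound_def card_blocks by simp
qed

lemma bound_div_index:
  "real (canonical_bound d G m k W) /
     real (card (rcosets\<^bsub>(cvec.PGL (U p1))\<lparr>carrier := H_group G (U p1)\<rparr>\<^esub> N))
   = real (d ^ card blocks * card N * (\<Prod>p\<in>blocks - {p1}. Hcard p) * (\<Prod>i=1..m. fact (k i)))"
proof -
  let ?R = "card (rcosets\<^bsub>(cvec.PGL (U p1))\<lparr>carrier := H_group G (U p1)\<rparr>\<^esub> N)"
  have R: "?R * card N = Hcard p1" by (rule card_rcosets_N)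
  have "?R \<noteq> 0" using R Hcard_bounds(1)[OF p1] by (metis mult_0 less_irrefl)
  then show ?thesis
    unfolding canonical_bound_eq R[symmetric] by (simp add: field_simps)
qed

text \<open>Multiplying by \<open>d ^ r * r!\<close> clears the denominator of the ratio, and
  dividing by \<open>JC\<close> of the marked dimension removes the factor of the marked block. What
  remains is compared factor by factor: each \<open>Hcard p\<close> with its \<open>JC\<close>, and
  the product of the \<open>k i !\<close> with that of the factorials of the multiplicities.\<close>

lemma bound_le_fermat:
  "real (d ^ card blocks * card N * (\<Prod>p\<in>blocks - {p1}. Hcard p) * (\<Prod>i=1..m. fact (k i)))
   \<le> fermat_ratio (subdegree_sequence m k W) d * real (card N) *
        real (d ^ CARD('n) * fact CARD('n)) / real (JC (vec.dim (U p1)))"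
proof -
  let ?M = "\<Prod>v\<in>set dims. fact (count_list dims v) :: nat"
  have J: "JC (card (C p1)) > 0" using Hcard_bounds[OF p1] by linarith
  have "(\<Prod>p\<in>blocks. JC (card (C p))) = JC (card (C p1)) * (\<Prod>p\<in>blocks - {p1}. JC (card (C p)))"
    by (rule prod.remove[OF finite_blocks p1])
  then have "fermat_ratio dims d * real (card N) * real (d ^ CARD('n) * fact CARD('n)) / real (JC (vec.dim (U p1)))
    = real (d ^ card blocks * card N * (\<Prod>p\<in>blocks - {p1}. JC (card (C p))) * ?M)"
    using J d unfolding fermat_ratio_def length_dims sum_list_dims prod_list_JC_dims dim_U[OF p1]
    by (simp add: field_simps)
  moreover have "d ^ card blocks * card N * (\<Prod>p\<in>blocks - {p1}. Hcard p) * (\<Prod>i=1..m. fact (k i))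
    \<le> d ^ card blocks * card N * (\<Prod>p\<in>blocks - {p1}. JC (card (C p))) * ?M"
    using Hcard_bounds(2) by (intro mult_le_mono prod_fact_le prod_mono order.refl) auto
  ultimately show ?thesis unfolding dims_def[symmetric] by (metis of_nat_le_iff)
qed

end

theorem lemma5p6:
  fixes F :: "('n::finite) mpoly"
    and G :: "(complex ^ 'n ^ 'n) set"
    and V :: "nat \<Rightarrow> (complex ^ 'n) set"
    and W :: "nat \<Rightarrow> nat \<Rightarrow> (complex ^ 'n) set"
    and k :: "nat \<Rightarrow> nat"
    and m d d1 i1 j1 :: nat
    and \<mm> :: "'n \<Rightarrow>\<^sub>0 nat"
  assumes "CARD('n) \<ge> 3"
    and "d \<ge> 3"
    and "homogeneous d F"
    and "smooth_form F"
    and "subgroup G GL_mat"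
    and "G \<subseteq> Aut F"
    and "decomposition_data G m k V W"
    and "compatible_basis m k W"
    and "i1 \<in> {1..m}"
    and "j1 \<in> {1..k i1}"
    and "0 < d1" and "d1 < d"
    and "\<mm> \<in> Poly_Mapping.keys F"
    and "(\<Sum>x\<in>coords (W i1 j1). Poly_Mapping.lookup \<mm> x) = d1"
    and "(\<Sum>x\<in>(\<Union>(i2, j2)\<in>(SIGMA i:{1..m}. {1..k i}) - {(i1, j1)}. coords (W i2 j2)).
            Poly_Mapping.lookup \<mm> x) = d - d1"
  shows "\<exists>N. N \<lhd> ((cvec.PGL (W i1 j1))\<lparr>carrier := Hbar_group G m k W (W i1 j1)\<rparr>) \<and>
           (\<exists>f. f \<noteq> 0 \<and> form_on (W i1 j1) d1 f \<and> preserves (W i1 j1) N f) \<and>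
           real (card G) \<le> real (canonical_bound d G m k W) /
             real (card (rcosets\<^bsub>(cvec.PGL (W i1 j1))\<lparr>carrier := H_group G (W i1 j1)\<rparr>\<^esub> N)) \<and>
           real (canonical_bound d G m k W) /
             real (card (rcosets\<^bsub>(cvec.PGL (W i1 j1))\<lparr>carrier := H_group G (W i1 j1)\<rparr>\<^esub> N))
           \<le> fermat_ratio (subdegree_sequence m k W) d * real (card N) *
                real (d ^ CARD('n) * fact CARD('n)) / real (JC (vec.dim (W i1 j1)))"
proof -
  interpret block_decomposition G m k V W by unfold_locales fact+
  interpret smooth_marked_block G m k V W "(i1, j1)" F d
    by unfold_locales (use assms in \<open>auto simp: blocks_def\<close>)
  have U1: "U (i1, j1) = W i1 j1" by (simp add: U_def)
  have C1: "C (i1, j1) = coords (W i1 j1)" by (simp add: C_def U1)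
  have "form_on (W i1 j1) d1 (coeff_form (C (i1, j1)) F \<mm>)"
    using assms by (intro coeff_form_on[OF hom]) (auto simp: C1)
  moreover have "coeff_form (C (i1, j1)) F \<mm> \<noteq> 0" using assms by (intro coeff_form_neq_0)
  moreover have "preserves (W i1 j1) N (coeff_form (C (i1, j1)) F \<mm>)"
    unfolding U1[symmetric] using assms by (intro N_preserves[where ?d1.0 = d1]) (auto simp: C1)
  moreover have "real (card G) \<le> real (d ^ card blocks * card N * (\<Prod>p\<in>blocks - {(i1, j1)}. Hcard p) * (\<Prod>i=1..m. fact (k i)))"
    using card_G_bound by (rule of_nat_mono)
  ultimately show ?thesis
    using N_normal bound_div_index bound_le_fermat unfolding U1 by (intro exI[of _ N]) auto
qed

end
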